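(* Let $\Omega\subset\mathbb{R}^n$ be a bounded domain with inradius $r_\Omega$. Then $J_*^\infty(\mu)$ is an equivalent norm on $\mathrm{KR}_\partial(\Omega)$. Moreover, if $r_\Omega\le1$, then for any $\mu\in\mathcal{M}(\Omega)$ it holds that $$J_*^\infty(\mu)=\|\mu\|_{\mathrm{KR}_\partial(\Omega)}.$$
   Context: $r_\Omega=\max_{x\in\Omega}\operatorname{dist}(x,\partial\Omega)$. $\mathcal{M}(\Omega)$, $\mathcal{M}(\overline\Omega)$: finite signed Radon measures. $\mathrm{Lip}(\overline\Omega)$: Lipschitz functions on $\overline\Omega$; $\mathrm{Lip}_0(\Omega)$: those vanishing on $\partial\Omega$. $J_*^\infty(\mu)=\sup\{\int_\Omega u\,d\mu:u\in\mathrm{Lip}_0(\Omega),\ \|\nabla u\|_{L^\infty}\le1\}$. Kantorovich–Rubinstein norm: $\|\mu\|_{\mathrm{KR}(\overline\Omega)}=\sup\{\int u\,d\mu:u\in\mathrm{Lip}(\overline\Omega),\ \|\nabla u\|_{L^\infty}\le1,\ \|u\|_\infty\le1\}$ for $\mu\in\mathcal{M}(\overline\Omega)$. $\mathrm{KR}(\overline\Omega)$ is the completion of $\mathcal{M}(\overline\Omega)$ in this norm; its dual is $\mathrm{Lip}(\overline\Omega)$. $\mathrm{KR}(\partial\Omega)$ is identified with the closed subspace of $\mathrm{KR}(\overline\Omega)$ generated by measures that vanish on $\Omega\setminus\partial\Omega$ (i.e. concentrated on $\partial\Omega$). $\mathrm{KR}_\partial(\Omega):=\mathrm{KR}(\overline\Omega)/\mathrm{KR}(\partial\Omega)$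 with quotient norm $\|\mu\|_{\mathrm{KR}_\partial(\Omega)}=\inf_{\nu\in\mathrm{KR}(\partial\Omega)}\|\mu-\nu\|_{\mathrm{KR}(\overline\Omega)}$. For an element of $\mathrm{KR}_\partial(\Omega)$, $J_*^\infty$ is defined by the same supremum, with $\int u\,d\mu$ replaced by the duality pairing with $u\in\mathrm{Lip}_0(\Omega)$. *)

theory Defs
  imports "HOL-Analysis.Analysis" "HOL-Probability.Discrete_Topology"
begin

section \<open>Finite signed measures\<close>

text \<open>
  A real-valued countably additive set function on the Borel sets; it is automatically finite, and on
  a Euclidean space automatically Radon. Off the Borel sets it is 0, so that
  equality of signed measures is equality on the Borel sets.
\<close>

typedef (overloaded) 'a signed_measure =
  "{\<sigma> :: 'a::topological_space set \<Rightarrow> real.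
      (\<forall>A. A \<notin> sets borel \<longrightarrow> \<sigma> A = 0) \<and>
      (\<forall>A :: nat \<Rightarrow> 'a set. range A \<subseteq> sets borel \<longrightarrow> disjoint_family A \<longrightarrow>
          (\<lambda>i. \<sigma> (A i)) sums \<sigma> (\<Union>i. A i))}"
  morphisms mass Abs_signed_measure
  by (rule exI[of _ "\<lambda>_. 0"]) simp

setup_lifting type_definition_signed_measure

instantiation signed_measure :: (topological_space) real_vector
begin

lift_definition zero_signed_measure :: "'a signed_measure" is "\<lambda>_. 0" by simp

lift_definition plus_signed_measure :: "'a signed_measure \<Rightarrow> 'a signed_measure \<Rightarrow> 'a signed_measure"
  is "\<lambda>\<sigma> \<tau> A. \<sigma> A + \<tau> A" by (auto intro: sums_add)

lift_definition minus_signed_measure :: "'a signed_measure \<Rightarrow> 'a signed_measure \<Rightarrow> 'a signed_measure"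
  is "\<lambda>\<sigma> \<tau> A. \<sigma> A - \<tau> A" by (auto intro: sums_diff)

lift_definition uminus_signed_measure :: "'a signed_measure \<Rightarrow> 'a signed_measure"
  is "\<lambda>\<sigma> A. - \<sigma> A" by (auto intro: sums_minus)

lift_definition scaleR_signed_measure :: "real \<Rightarrow> 'a signed_measure \<Rightarrow> 'a signed_measure"
  is "\<lambda>c \<sigma> A. c * \<sigma> A" by (auto intro: sums_mult)

instance
  by standard (transfer; force simp: algebra_simps)+

end

text \<open>The two parts of the Jordan decomposition, defined as the upper and lower variation.\<close>

definition upvar :: "'a::topological_space signed_measure \<Rightarrow> 'a set \<Rightarrow> ennreal" where
  "upvar \<mu> A = (SUP B\<in>{B \<in> sets borel. B \<subseteq> A}. ennreal (mass \<mu> B))"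

definition pos_part :: "'a::topological_space signed_measure \<Rightarrow> 'a measure" where
  "pos_part \<mu> = measure_of UNIV (sets borel) (upvar \<mu>)"

definition neg_part :: "'a::topological_space signed_measure \<Rightarrow> 'a measure" where
  "neg_part \<mu> = pos_part (- \<mu>)"

definition smint :: "'a::topological_space set \<Rightarrow> 'a signed_measure \<Rightarrow> ('a \<Rightarrow> real) \<Rightarrow> real" where
  "smint X \<mu> u = set_lebesgue_integral (pos_part \<mu>) X u - set_lebesgue_integral (neg_part \<mu>) X u"

text \<open>
  \<open>\<M>(X)\<close> for a Borel set \<open>X\<close>: the signed measures on the whole space that are concentrated on \<open>X\<close>.
  With this encoding \<open>\<M>(\<Omega>)\<close> and \<open>\<M>(\<partial>\<Omega>)\<close> are literally subspaces of \<open>\<M>(closure \<Omega>)\<close>.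
\<close>

definition signed_measures_on :: "'a::topological_space set \<Rightarrow> 'a signed_measure set" where
  "signed_measures_on X = {\<mu>. \<forall>A\<in>sets borel. A \<inter> X = {} \<longrightarrow> mass \<mu> A = 0}"


section \<open>Lipschitz functions and the inradius\<close>

definition inradius :: "'a::metric_space set \<Rightarrow> real" where
  "inradius \<Omega> = (SUP x\<in>\<Omega>. infdist x (frontier \<Omega>))"

text \<open>
  Functions on \<open>closure \<Omega>\<close> are represented by total functions whose values elsewhere play no role.
\<close>

definition Lip :: "'a::metric_space set \<Rightarrow> ('a \<Rightarrow> real) set" where
  "Lip X = {u. \<exists>L. L-lipschitz_on X u}"

definition Lip0 :: "'a::metric_space set \<Rightarrow> ('a \<Rightarrow> real) set" where
  "Lip0 \<Omega> = {u \<in> Lip (closure \<Omega>). \<forall>x\<in>frontier \<Omega>. u x = 0}"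

text \<open>
  The constraint that the gradient, which by Rademacher's theorem exists almost everywhere in the
  open set \<open>\<Omega>\<close> for a Lipschitz function, has \<open>L\<^sup>\<infinity>(\<Omega>)\<close> norm at most 1. This is not the same as having
  Lipschitz constant at most 1 unless \<open>\<Omega>\<close> is, for example, convex.
\<close>

definition grad_le_1 :: "'a::euclidean_space set \<Rightarrow> ('a \<Rightarrow> real) \<Rightarrow> bool" where
  "grad_le_1 \<Omega> u \<longleftrightarrow> (AE x in lebesgue_on \<Omega>. \<exists>g. (GDERIV u x :> g) \<and> norm g \<le> 1)"

definition Jstar :: "'a::euclidean_space set \<Rightarrow> 'a signed_measure \<Rightarrow> ereal" where
  "Jstar \<Omega> \<mu> = (SUP u\<in>{u \<in> Lip0 \<Omega>. grad_le_1 \<Omega> u}. ereal (smint \<Omega> \<mu> u))"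


section \<open>The Kantorovich--Rubinstein space and its quotient\<close>

definition KR_test :: "'a::euclidean_space set \<Rightarrow> ('a \<Rightarrow> real) set" where
  "KR_test \<Omega> = {u \<in> Lip (closure \<Omega>). grad_le_1 \<Omega> u \<and> (\<forall>x\<in>closure \<Omega>. \<bar>u x\<bar> \<le> 1)}"

definition KR_norm :: "'a::euclidean_space set \<Rightarrow> 'a signed_measure \<Rightarrow> real" where
  "KR_norm \<Omega> \<mu> = (SUP u\<in>KR_test \<Omega>. smint (closure \<Omega>) \<mu> u)"

text \<open>
  A completion of \<open>\<M>(closure \<Omega>)\<close> in the norm \<open>KR_norm \<Omega>\<close> is given by a linear isometric embedding
  \<open>\<iota>\<close> into some Banach space: it is the closure of the image of \<open>\<iota>\<close>. All completions are
  of this form, and below one exists (\<open>KR_embedding_exists\<close>).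
\<close>

definition KR_embedding ::
  "'a::euclidean_space set \<Rightarrow> ('a signed_measure \<Rightarrow> 'b::real_normed_vector) \<Rightarrow> bool" where
  "KR_embedding \<Omega> \<iota> \<longleftrightarrow>
     (\<forall>\<mu>\<in>signed_measures_on (closure \<Omega>). \<forall>\<nu>\<in>signed_measures_on (closure \<Omega>). \<iota> (\<mu> + \<nu>) = \<iota> \<mu> + \<iota> \<nu>) \<and>
     (\<forall>c. \<forall>\<mu>\<in>signed_measures_on (closure \<Omega>). \<iota> (c *\<^sub>R \<mu>) = c *\<^sub>R \<iota> \<mu>) \<and>
     (\<forall>\<mu>\<in>signed_measures_on (closure \<Omega>). norm (\<iota> \<mu>) = KR_norm \<Omega> \<mu>)"

definition KR :: "'a::euclidean_space set \<Rightarrow> ('a signed_measure \<Rightarrow> 'b::real_normed_vector) \<Rightarrow> 'b set" where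
  "KR \<Omega> \<iota> = closure (\<iota> ` signed_measures_on (closure \<Omega>))"

definition KR_boundary ::
  "'a::euclidean_space set \<Rightarrow> ('a signed_measure \<Rightarrow> 'b::real_normed_vector) \<Rightarrow> 'b set" where
  "KR_boundary \<Omega> \<iota> = closure (span (\<iota> ` signed_measures_on (frontier \<Omega>)))"

text \<open>
  The duality pairing with \<open>u \<in> Lip (closure \<Omega>)\<close> is the extension by continuity of
  \<open>\<iota> \<mu> \<mapsto> \<integral>u d\<mu>\<close> from the image of \<open>\<iota>\<close> to its closure.
\<close>

definition KR_pairing ::
  "'a::euclidean_space set \<Rightarrow> ('a signed_measure \<Rightarrow> 'b::real_normed_vector) \<Rightarrow> 'b \<Rightarrow> ('a \<Rightarrow> real) \<Rightarrow> real" where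
  "KR_pairing \<Omega> \<iota> \<xi> u = (THE l. \<forall>\<mu>. (\<forall>k::nat. \<mu> k \<in> signed_measures_on (closure \<Omega>)) \<longrightarrow>
     (\<lambda>k. \<iota> (\<mu> k)) \<longlonglongrightarrow> \<xi> \<longrightarrow> (\<lambda>k. smint (closure \<Omega>) (\<mu> k) u) \<longlonglongrightarrow> l)"

definition coset :: "'b::real_normed_vector set \<Rightarrow> 'b \<Rightarrow> 'b set" where
  "coset N \<xi> = (\<lambda>\<nu>. \<xi> + \<nu>) ` N"

definition quotient_norm :: "'b::real_normed_vector set \<Rightarrow> real" where
  "quotient_norm X = (INF \<xi>\<in>X. norm \<xi>)"

text \<open>
  \<open>F\<close> is an equivalent norm on the quotient \<open>V / N = {coset N \<xi> | \<xi> \<in> V}\<close> of a subspace \<open>V\<close> of a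
  normed space by a closed subspace \<open>N\<close>. Finiteness of the extended-real function \<open>F\<close> is part of
  the last condition.
\<close>

definition equivalent_quotient_norm ::
  "'b::real_normed_vector set \<Rightarrow> 'b set \<Rightarrow> ('b set \<Rightarrow> ereal) \<Rightarrow> bool" where
  "equivalent_quotient_norm V N F \<longleftrightarrow>
     (\<forall>\<xi>\<in>V. 0 \<le> F (coset N \<xi>)) \<and>
     (\<forall>\<xi>\<in>V. F (coset N \<xi>) = 0 \<longleftrightarrow> coset N \<xi> = coset N 0) \<and>
     (\<forall>c. \<forall>\<xi>\<in>V. F (coset N (c *\<^sub>R \<xi>)) = ereal \<bar>c\<bar> * F (coset N \<xi>)) \<and>
     (\<forall>\<xi>\<in>V. \<forall>\<eta>\<in>V. F (coset N (\<xi> + \<eta>)) \<le> F (coset N \<xi>) + F (coset N \<eta>)) \<and>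
     (\<exists>c>0. \<exists>C>0. \<forall>\<xi>\<in>V. ereal (c * quotient_norm (coset N \<xi>)) \<le> F (coset N \<xi>) \<and>
                           F (coset N \<xi>) \<le> ereal (C * quotient_norm (coset N \<xi>)))"

text \<open>
  A function in \<open>Lip0 \<Omega>\<close> annihilates \<open>KR_boundary \<Omega> \<iota>\<close>, so its pairing with a coset is the common
  value of its pairings with the members of the coset.
\<close>

definition Jstar_coset ::
  "'a::euclidean_space set \<Rightarrow> ('a signed_measure \<Rightarrow> 'b::real_normed_vector) \<Rightarrow> 'b set \<Rightarrow> ereal" where
  "Jstar_coset \<Omega> \<iota> X =
     (SUP u\<in>{u \<in> Lip0 \<Omega>. grad_le_1 \<Omega> u}. ereal (THE r. \<forall>\<xi>\<in>X. KR_pairing \<Omega> \<iota> \<xi> u = r))"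


section \<open>Existence of the completion\<close>

subsection \<open>The Jordan decomposition\<close>

lemma mass_nonborel: "A \<notin> sets borel \<Longrightarrow> mass \<mu> A = 0"
  by transfer simp

lemma mass_sums:
  "range A \<subseteq> sets borel \<Longrightarrow> disjoint_family A \<Longrightarrow> (\<lambda>i::nat. mass \<mu> (A i)) sums mass \<mu> (\<Union>i. A i)"
  by transfer simp

lemma mass_empty [simp]: "mass \<mu> {} = 0"
proof -
  have "(\<lambda>i::nat. mass \<mu> {}) sums mass \<mu> (\<Union>i::nat. {})"
    by (rule mass_sums) (auto simp: disjoint_family_on_def)
  then show ?thesis
    by (simp add: sums_iff summable_const_iff)
qed

lemma mass_union:
  assumes "A \<in> sets borel" "B \<in> sets borel" "A \<inter> B = {}"
  shows "mass \<mu> (A \<union> B) = mass \<mu> A + mass \<mu> B"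
proof -
  have "(\<lambda>i. mass \<mu> (binaryset A B i)) sums mass \<mu> (\<Union>i. binaryset A B i)"
    using assms by (intro mass_sums) (auto simp: binaryset_def disjoint_family_on_def)
  moreover have "(\<lambda>i. mass \<mu> (binaryset A B i)) sums (mass \<mu> A + mass \<mu> B)"
    by (rule binaryset_sums) simp
  ultimately show ?thesis
    by (metis UN_binaryset_eq sums_unique2)
qed

lemma mass_diff:
  assumes "A \<in> sets borel" "B \<in> sets borel" "B \<subseteq> A"
  shows "mass \<mu> (A - B) = mass \<mu> A - mass \<mu> B"
proof -
  have "A = B \<union> (A - B)" using assms by auto
  then show ?thesis
    using mass_union[of B "A - B" \<mu>] assms by fastforce
qed

lemma mass_simps [simp]:
  "mass (\<mu> + \<nu>) A = mass \<mu> A + mass \<nu> A" "mass (- \<mu>) A = - mass \<mu> A" "mass (c *\<^sub>R \<mu>) A = c * mass \<mu> A"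
  by (transfer; simp)+

lemma upvar_upper: "B \<in> sets borel \<Longrightarrow> B \<subseteq> A \<Longrightarrow> ennreal (mass \<mu> B) \<le> upvar \<mu> A"
  unfolding upvar_def by (auto intro!: SUP_upper)

lemma upvar_mono: "A \<subseteq> B \<Longrightarrow> upvar \<mu> A \<le> upvar \<mu> B"
  unfolding upvar_def by (auto intro!: SUP_subset_mono)

lemma upvar_superadditive:
  assumes "A \<inter> B = {}"
  shows "upvar \<mu> A + upvar \<mu> B \<le> upvar \<mu> (A \<union> B)"
proof -
  have *: "ennreal (mass \<mu> C) + ennreal (mass \<mu> D) \<le> upvar \<mu> (A \<union> B)"
    if "C \<in> sets borel" "C \<subseteq> A" "D \<in> sets borel" "D \<subseteq> B" for C D
  proof (cases "mass \<mu> C \<ge> 0 \<and> mass \<mu> D \<ge> 0")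
    case True
    have "ennreal (mass \<mu> C) + ennreal (mass \<mu> D) = ennreal (mass \<mu> (C \<union> D))"
      using that assms True by (subst mass_union) auto
    also have "\<dots> \<le> upvar \<mu> (A \<union> B)"
      using that by (intro upvar_upper) auto
    finally show ?thesis .
  next
    case False
    then have "ennreal (mass \<mu> C) = 0 \<or> ennreal (mass \<mu> D) = 0"
      by (auto simp: ennreal_neg)
    then show ?thesis
      using that upvar_upper[of C "A \<union> B" \<mu>] upvar_upper[of D "A \<union> B" \<mu>]
      by (metis add.left_neutral add.right_neutral le_supI1 le_supI2)
  qed
  have ne: "{C \<in> sets borel. C \<subseteq> A} \<noteq> {}" for A :: "'a set" by auto
  have 1: "ennreal (mass \<mu> C) + upvar \<mu> B \<le> upvar \<mu> (A \<union> B)" if "C \<in> sets borel" "C \<subseteq> A" for C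
  proof -
    have "ennreal (mass \<mu> C) + upvar \<mu> B =
        (SUP D\<in>{D \<in> sets borel. D \<subseteq> B}. ennreal (mass \<mu> C) + ennreal (mass \<mu> D))"
      unfolding upvar_def by (rule ennreal_SUP_add_right) (use ne in auto)
    also have "\<dots> \<le> upvar \<mu> (A \<union> B)"
      using * that by (intro SUP_least) auto
    finally show ?thesis .
  qed
  have "upvar \<mu> A + upvar \<mu> B =
      (SUP C\<in>{C \<in> sets borel. C \<subseteq> A}. ennreal (mass \<mu> C) + upvar \<mu> B)"
    unfolding upvar_def[of \<mu> A] by (rule ennreal_SUP_add_left[symmetric]) (use ne in auto)
  also have "\<dots> \<le> upvar \<mu> (A \<union> B)"
    using 1 by (intro SUP_least) auto
  finally show ?thesis .
qed

lemma upvar_subadditive: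
  assumes A: "range A \<subseteq> sets borel" "disjoint_family (A :: nat \<Rightarrow> _)"
  shows "upvar \<mu> (\<Union>i. A i) \<le> (\<Sum>i. upvar \<mu> (A i))"
  unfolding upvar_def[of \<mu> "\<Union>i. A i"]
proof (rule SUP_least)
  fix B assume "B \<in> {B \<in> sets borel. B \<subseteq> (\<Union>i. A i)}"
  then have B: "B \<in> sets borel" "B = (\<Union>i. B \<inter> A i)" by auto
  have "(\<lambda>i. mass \<mu> (B \<inter> A i)) sums mass \<mu> (\<Union>i. B \<inter> A i)"
    using A B(1) by (intro mass_sums) (auto simp: disjoint_family_on_def)
  then have "(\<lambda>n. \<Sum>i<n. mass \<mu> (B \<inter> A i)) \<longlonglongrightarrow> mass \<mu> B"
    using B(2) by (simp add: sums_def)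
  then have lim: "(\<lambda>n. ennreal (\<Sum>i<n. mass \<mu> (B \<inter> A i))) \<longlonglongrightarrow> ennreal (mass \<mu> B)"
    by (rule tendsto_ennrealI)
  have "ennreal (\<Sum>i<n. mass \<mu> (B \<inter> A i)) \<le> (\<Sum>i. upvar \<mu> (A i))" for n
  proof -
    have "ennreal (\<Sum>i<n. mass \<mu> (B \<inter> A i)) \<le> ennreal (\<Sum>i<n. max 0 (mass \<mu> (B \<inter> A i)))"
      by (intro ennreal_leI sum_mono) auto
    also have "\<dots> = (\<Sum>i<n. ennreal (max 0 (mass \<mu> (B \<inter> A i))))"
      by (rule sum_ennreal[symmetric]) simp
    also have "\<dots> = (\<Sum>i<n. ennreal (mass \<mu> (B \<inter> A i)))"
      by (intro sum.cong refl) (simp add: max_def ennreal_neg)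
    also have "\<dots> \<le> (\<Sum>i<n. upvar \<mu> (A i))"
      using A B(1) by (intro sum_mono upvar_upper) auto
    also have "\<dots> \<le> (\<Sum>i. upvar \<mu> (A i))"
      by (intro sum_le_suminf) auto
    finally show ?thesis .
  qed
  then show "ennreal (mass \<mu> B) \<le> (\<Sum>i. upvar \<mu> (A i))"
    using lim by (intro LIMSEQ_le_const2) auto
qed

lemma upvar_empty [simp]: "upvar \<mu> {} = 0"
proof -
  have "{B \<in> sets borel. B \<subseteq> {}} = {{}}" by auto
  then show ?thesis by (simp add: upvar_def)
qed

lemma upvar_countably_additive: "countably_additive (sets borel) (upvar \<mu>)"
proof (rule countably_additiveI)
  fix A :: "nat \<Rightarrow> 'a set"
  assume A: "range A \<subseteq> sets borel" "disjoint_family A"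
  have "(\<Sum>i<n. upvar \<mu> (A i)) \<le> upvar \<mu> (\<Union>i<n. A i)" for n
  proof (induction n)
    case (Suc n)
    have "(\<Sum>i<Suc n. upvar \<mu> (A i)) \<le> upvar \<mu> (\<Union>i<n. A i) + upvar \<mu> (A n)"
      using Suc by (simp add: add_right_mono)
    also have "\<dots> \<le> upvar \<mu> ((\<Union>i<n. A i) \<union> A n)"
    proof (rule upvar_superadditive)
      have "A i \<inter> A n = {}" if "i < n" for i
        using disjoint_family_onD[OF A(2), of i n] that by simp
      then show "(\<Union>i<n. A i) \<inter> A n = {}" by blast
    qed
    also have "(\<Union>i<n. A i) \<union> A n = (\<Union>i<Suc n. A i)"
      by (auto simp: lessThan_Suc)
    finally show ?case .
  qed simp
  then have "(\<Sum>i<n. upvar \<mu> (A i)) \<le> upvar \<mu> (\<Union>i. A i)" for n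
    by (rule order_trans) (intro upvar_mono, auto)
  then have "(\<Sum>i. upvar \<mu> (A i)) \<le> upvar \<mu> (\<Union>i. A i)"
    by (intro suminf_le_const) auto
  then show "(\<Sum>i. upvar \<mu> (A i)) = upvar \<mu> (\<Union>i. A i)"
    using upvar_subadditive[OF A] by (intro antisym)
qed

lemma upvar_union_le:
  assumes "A \<in> sets borel" "B \<in> sets borel" "A \<inter> B = {}"
  shows "upvar \<mu> (A \<union> B) \<le> upvar \<mu> A + upvar \<mu> B"
proof -
  have "(\<Union>i. binaryset A B i) = A \<union> B" by (rule UN_binaryset_eq)
  moreover have "(\<Sum>i. upvar \<mu> (binaryset A B i)) = upvar \<mu> A + upvar \<mu> B"
    by (rule suminf_binaryset_eq) simp
  moreover have "upvar \<mu> (\<Union>i. binaryset A B i) \<le> (\<Sum>i. upvar \<mu> (binaryset A B i))"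
    using assms by (intro upvar_subadditive) (auto simp: binaryset_def disjoint_family_on_def)
  ultimately show ?thesis by simp
qed

lemma upvar_finite: "upvar \<mu> UNIV < \<infinity>"
proof (rule ccontr)
  assume "\<not> upvar \<mu> UNIV < \<infinity>"
  then have top: "upvar \<mu> UNIV = \<infinity>" by (simp add: less_top[symmetric])
  have step: "\<exists>A'. (A' \<in> sets borel \<and> upvar \<mu> A' = \<infinity>) \<and> (A' \<subseteq> A \<and> \<bar>mass \<mu> (A - A')\<bar> \<ge> 1)"
    if A: "A \<in> sets borel \<and> upvar \<mu> A = \<infinity>" for A
  proof -
    have "ennreal (\<bar>mass \<mu> A\<bar> + 1) < upvar \<mu> A" using A by simp
    then obtain B where B: "B \<in> sets borel" "B \<subseteq> A" "ennreal (\<bar>mass \<mu> A\<bar> + 1) < ennreal (mass \<mu> B)"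
      unfolding upvar_def by (auto simp: less_SUP_iff)
    then have big: "\<bar>mass \<mu> A\<bar> + 1 < mass \<mu> B"
      using ennreal_less_iff[of "\<bar>mass \<mu> A\<bar> + 1" "mass \<mu> B"] by linarith
    have d: "mass \<mu> (A - B) = mass \<mu> A - mass \<mu> B"
      using A B by (intro mass_diff) auto
    have eq: "B \<union> (A - B) = A" using B(2) by blast
    have "upvar \<mu> (B \<union> (A - B)) \<le> upvar \<mu> B + upvar \<mu> (A - B)"
      using A B(1) by (intro upvar_union_le) auto
    then have "upvar \<mu> B + upvar \<mu> (A - B) = \<infinity>"
      using A unfolding eq by (simp add: top_unique)
    then consider "upvar \<mu> B = \<infinity>" | "upvar \<mu> (A - B) = \<infinity>"
      by (auto simp: ennreal_add_eq_top)
    then show ?thesis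
    proof cases
      case 1
      then show ?thesis using A B big d by (intro exI[of _ B]) auto
    next
      case 2
      have "A - (A - B) = B" using B by auto
      then show ?thesis using 2 A B big by (intro exI[of _ "A - B"]) auto
    qed
  qed
  have "\<exists>A. \<forall>n. (A n \<in> sets borel \<and> upvar \<mu> (A n) = \<infinity>) \<and>
      (A (Suc n) \<subseteq> A n \<and> \<bar>mass \<mu> (A n - A (Suc n))\<bar> \<ge> 1)"
    by (rule dependent_nat_choice[where P = "\<lambda>_ A. A \<in> sets borel \<and> upvar \<mu> A = \<infinity>"
          and Q = "\<lambda>_ A A'. A' \<subseteq> A \<and> \<bar>mass \<mu> (A - A')\<bar> \<ge> 1"])
       (rule exI[of _ UNIV], simp add: top, erule step)
  then obtain A where A: "\<And>n::nat. A n \<in> sets borel \<and> upvar \<mu> (A n) = \<infinity>"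
    and A': "\<And>n. A (Suc n) \<subseteq> A n \<and> \<bar>mass \<mu> (A n - A (Suc n))\<bar> \<ge> 1"
    by blast
  have dec: "A n \<subseteq> A m" if "m \<le> n" for m n
    using lift_Suc_antimono_le[of A m n] A' that by auto
  have "disjoint_family (\<lambda>n. A n - A (Suc n))"
  proof -
    have "(A m - A (Suc m)) \<inter> (A n - A (Suc n)) = {}" if "m < n" for m n
      using dec[of "Suc m" n] that by auto
    then show ?thesis
      unfolding disjoint_family_on_def by (metis Int_commute linorder_neqE_nat)
  qed
  then have "(\<lambda>n. mass \<mu> (A n - A (Suc n))) sums mass \<mu> (\<Union>n. A n - A (Suc n))"
    using A by (intro mass_sums) auto
  then have "(\<lambda>n. mass \<mu> (A n - A (Suc n))) \<longlonglongrightarrow> 0"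
    using sums_summable summable_LIMSEQ_zero by blast
  then have "(\<lambda>n. \<bar>mass \<mu> (A n - A (Suc n))\<bar>) \<longlonglongrightarrow> 0"
    by (rule tendsto_rabs_zero)
  then have "1 \<le> (0::real)"
    by (rule LIMSEQ_le_const) (use A' in auto)
  then show False by simp
qed

lemma sigma_algebra_borel: "sigma_algebra UNIV (sets borel)"
  using sets.sigma_algebra_axioms[of borel] by simp

lemma sets_pos_part [simp]: "sets (pos_part \<mu>) = sets borel"
  and space_pos_part [simp]: "space (pos_part \<mu>) = UNIV"
  unfolding pos_part_def
  by (simp_all add: sigma_algebra.sets_measure_of_eq[OF sigma_algebra_borel]
        sigma_algebra.space_measure_of_eq[OF sigma_algebra_borel])

lemma emeasure_pos_part: "A \<in> sets borel \<Longrightarrow> emeasure (pos_part \<mu>) A = upvar \<mu> A"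
proof -
  assume A: "A \<in> sets borel"
  show ?thesis
    unfolding pos_part_def
    by (rule emeasure_measure_of_sigma[OF sigma_algebra_borel])
       (simp_all add: A upvar_countably_additive positive_def)
qed

lemma finite_pos_part: "finite_measure (pos_part \<mu>)"
proof (rule finite_measureI)
  have "emeasure (pos_part \<mu>) (space (pos_part \<mu>)) = upvar \<mu> UNIV"
    by (simp add: emeasure_pos_part)
  then show "emeasure (pos_part \<mu>) (space (pos_part \<mu>)) \<noteq> \<infinity>"
    using upvar_finite[of \<mu>] by (metis less_irrefl)
qed

lemma sets_neg_part [simp]: "sets (neg_part \<mu>) = sets borel"
  and space_neg_part [simp]: "space (neg_part \<mu>) = UNIV"
  and finite_neg_part: "finite_measure (neg_part \<mu>)"
  unfolding neg_part_def by (rule sets_pos_part space_pos_part finite_pos_part)+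

lemma mass_le_pos_part:
  assumes "B \<in> sets borel" "A \<in> sets borel" "B \<subseteq> A"
  shows "mass \<mu> B \<le> measure (pos_part \<mu>) A"
proof -
  interpret finite_measure "pos_part \<mu>" by (rule finite_pos_part)
  have "ennreal (mass \<mu> B) \<le> ennreal (measure (pos_part \<mu>) A)"
    using upvar_upper[OF assms(1,3), of \<mu>]
    unfolding emeasure_pos_part[OF assms(2), symmetric] emeasure_eq_measure .
  then show ?thesis 
    using measure_nonneg[of "pos_part \<mu>" A] by (auto simp: ennreal_le_iff2)
qed

lemma pos_part_le:
  assumes A: "A \<in> sets borel"
  shows "measure (pos_part \<mu>) A \<le> mass \<mu> A + measure (neg_part \<mu>) A"
proof -
  interpret finite_measure "pos_part \<mu>" by (rule finite_pos_part)
  have le: "mass \<mu> B \<le> mass \<mu> A + measure (neg_part \<mu>) A" if "B \<in> sets borel" "B \<subseteq> A" for B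
    using mass_le_pos_part[of "A - B" A "- \<mu>"] that A mass_diff[of A B \<mu>]
    by (auto simp: neg_part_def)
  have "emeasure (pos_part \<mu>) A \<le> ennreal (mass \<mu> A + measure (neg_part \<mu>) A)"
    unfolding emeasure_pos_part[OF A] upvar_def using le by (intro SUP_least ennreal_leI) auto
  moreover have "0 \<le> mass \<mu> A + measure (neg_part \<mu>) A"
    using le[of "{}"] by simp
  ultimately show ?thesis by (simp add: emeasure_eq_measure)
qed

lemma jordan_decomposition:
  assumes A: "A \<in> sets borel"
  shows "mass \<mu> A = measure (pos_part \<mu>) A - measure (neg_part \<mu>) A"
  using pos_part_le[OF A, of \<mu>] pos_part_le[OF A, of "- \<mu>"] by (simp add: neg_part_def)



subsection \<open>Linearity of the integral\<close>

lemma combination_integral_eq_0: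
  fixes M :: "'i \<Rightarrow> 'a::topological_space measure" and f :: "'a \<Rightarrow> real"
  assumes I: "finite I"
    and M: "\<And>i. i \<in> I \<Longrightarrow> finite_measure (M i)" "\<And>i. i \<in> I \<Longrightarrow> sets (M i) = sets borel"
    and eq: "\<And>A. A \<in> sets borel \<Longrightarrow> (\<Sum>i\<in>I. a i * measure (M i) A) = 0"
    and f: "f \<in> borel_measurable borel" "\<And>x. \<bar>f x\<bar> \<le> c"
  shows "(\<Sum>i\<in>I. a i * (LINT x|M i. f x)) = 0"
proof -
  define T where "T = (\<Sum>i\<in>I. \<bar>a i\<bar> * measure (M i) UNIV)"
  have "0 \<le> c" using f(2)[of undefined] by linarith
  have bound: "\<bar>\<Sum>i\<in>I. a i * (LINT x|M i. f x)\<bar> \<le> T / real n" if n: "n > 0" for n :: nat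
  proof -
    define k where "k x = \<lfloor>real n * f x\<rfloor>" for x
    define K where "K = {- \<lceil>real n * c\<rceil> .. \<lceil>real n * c\<rceil>}"
    define A where "A j = {x. k x = j}" for j
    define g where "g x = (\<Sum>j\<in>K. (of_int j / real n) * indicator (A j) x :: real)" for x
    have A[measurable]: "A j \<in> sets borel" for j
      unfolding A_def k_def using f(1) by measurable
    have kK: "k x \<in> K" for x
    proof -
      have "real n * \<bar>f x\<bar> \<le> real n * c" using f(2)[of x] by (intro mult_left_mono) auto
      then have "\<bar>real n * f x\<bar> \<le> real n * c" by (simp add: abs_mult)
      then show ?thesis unfolding K_def k_def atLeastAtMost_iff by linarith
    qed
    have g: "g x = of_int (k x) / real n" for x
    proof -
      have "g x = (\<Sum>j\<in>K. if j = k x then of_int j / real n else 0)"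
        unfolding g_def by (intro sum.cong refl) (auto simp: A_def)
      also have "\<dots> = of_int (k x) / real n"
        using kK[of x] by (simp add: K_def)
      finally show ?thesis .
    qed
    have close: "\<bar>f x - g x\<bar> \<le> 1 / real n" for x
    proof -
      have "\<bar>real n * f x - of_int (k x)\<bar> \<le> 1" unfolding k_def by linarith
      moreover have "real n * f x - of_int (k x) = real n * (f x - g x)"
        using n by (simp add: g field_simps)
      ultimately have "real n * \<bar>f x - g x\<bar> \<le> 1" by (simp add: abs_mult)
      then show ?thesis using n by (simp add: field_simps)
    qed
    have int: "integrable (M i) f" "integrable (M i) g"
      "(LINT x|M i. g x) = (\<Sum>j\<in>K. (of_int j / real n) * measure (M i) (A j))"
      "\<bar>(LINT x|M i. f x) - (LINT x|M i. g x)\<bar> \<le> (1 / real n) * measure (M i) UNIV" if i: "i \<in> I" for i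
    proof -
      interpret finite_measure "M i" using M i by blast
      have s[measurable_cong]: "sets (M i) = sets borel" using M i by blast
      have sp: "space (M i) = UNIV" using sets_eq_imp_space_eq[OF s] by simp
      have fm: "f \<in> borel_measurable (M i)" using f(1) by (simp add: measurable_def s sp)
      show fi: "integrable (M i) f"
        by (rule integrable_const_bound[of _ c]) (use f(2) fm in auto)
      have ind: "integrable (M i) (\<lambda>x. (of_int j / real n) * indicator (A j) x :: real)" for j
        using A[of j] s by (intro integrable_mult_right integrable_real_indicator) (auto simp: less_top[symmetric])
      show gi: "integrable (M i) g"
        unfolding g_def using ind by (intro Bochner_Integration.integrable_sum) auto
      show "(LINT x|M i. g x) = (\<Sum>j\<in>K. (of_int j / real n) * measure (M i) (A j))"
        unfolding g_def using ind by (subst Bochner_Integration.integral_sum) (auto simp: sp)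
      have "\<bar>(LINT x|M i. f x) - (LINT x|M i. g x)\<bar> = \<bar>LINT x|M i. f x - g x\<bar>"
        using fi gi by simp
      also have "\<dots> \<le> (LINT x|M i. \<bar>f x - g x\<bar>)"
        by (rule integral_abs_bound)
      also have "\<dots> \<le> (LINT x|M i. 1 / real n)"
        using fi gi close by (intro integral_mono) auto
      finally show "\<bar>(LINT x|M i. f x) - (LINT x|M i. g x)\<bar> \<le> (1 / real n) * measure (M i) UNIV"
        by (simp add: sp)
    qed
    have "(\<Sum>i\<in>I. a i * (LINT x|M i. g x)) =
        (\<Sum>i\<in>I. \<Sum>j\<in>K. (of_int j / real n) * (a i * measure (M i) (A j)))"
      by (intro sum.cong refl) (simp add: int sum_distrib_left mult_ac)
    also have "\<dots> = (\<Sum>j\<in>K. (of_int j / real n) * (\<Sum>i\<in>I. a i * measure (M i) (A j)))"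
      by (subst sum.swap) (simp add: sum_distrib_left)
    also have "\<dots> = 0" using eq[OF A] by simp
    finally have "(\<Sum>i\<in>I. a i * (LINT x|M i. f x)) =
        (\<Sum>i\<in>I. a i * ((LINT x|M i. f x) - (LINT x|M i. g x)))"
      by (simp add: right_diff_distrib sum_subtractf)
    also have "\<bar>\<dots>\<bar> \<le> (\<Sum>i\<in>I. \<bar>a i\<bar> * ((1 / real n) * measure (M i) UNIV))"
      by (rule order_trans[OF sum_abs], rule sum_mono) (unfold abs_mult, rule mult_left_mono[OF int(4)], auto)
    also have "\<dots> = T / real n"
      by (simp add: T_def sum_divide_distrib)
    finally show ?thesis .
  qed
  have "(\<lambda>n. T / real n) \<longlonglongrightarrow> 0" by (rule lim_const_over_n)
  then have "\<bar>\<Sum>i\<in>I. a i * (LINT x|M i. f x)\<bar> \<le> 0"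
    by (rule LIMSEQ_le_const) (use bound in \<open>auto intro!: exI[of _ 1]\<close>)
  then show ?thesis by simp
qed

lemma smint_add_scale:
  fixes u :: "'a::topological_space \<Rightarrow> real"
  assumes u: "(\<lambda>x. indicator X x * u x) \<in> borel_measurable borel" "\<And>x. x \<in> X \<Longrightarrow> \<bar>u x\<bar> \<le> c"
    and c: "0 \<le> c"
  shows "smint X (\<mu> + \<nu>) u = smint X \<mu> u + smint X \<nu> u"
    and "smint X (r *\<^sub>R \<mu>) u = r * smint X \<mu> u"
proof -
  define f where "f x = indicator X x *\<^sub>R u x" for x
  have f: "f \<in> borel_measurable borel" "\<And>x. \<bar>f x\<bar> \<le> c"
    using u c unfolding f_def by (auto simp: indicator_def)
  have pos: "measure (pos_part \<kappa>) A = mass \<kappa> A + measure (neg_part \<kappa>) A"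
    if "A \<in> sets borel" for \<kappa> :: "'a signed_measure" and A
    using jordan_decomposition[OF that, of \<kappa>] by simp
  define M where "M = (!) [pos_part (\<mu> + \<nu>), neg_part (\<mu> + \<nu>), pos_part \<mu>, neg_part \<mu>, pos_part \<nu>, neg_part \<nu>]"
  define a where "a = (!) [1, -1, -1, 1, -1, 1::real]"
  have "(\<Sum>i<6. a i * (LINT x|M i. f x)) = 0"
    by (rule combination_integral_eq_0[OF _ _ _ _ f])
       (auto simp: M_def a_def eval_nat_numeral less_Suc_eq finite_pos_part finite_neg_part pos)
  then show "smint X (\<mu> + \<nu>) u = smint X \<mu> u + smint X \<nu> u"
    by (simp add: M_def a_def eval_nat_numeral smint_def set_lebesgue_integral_def f_def)
  define M where "M = (!) [pos_part (r *\<^sub>R \<mu>), neg_part (r *\<^sub>R \<mu>), pos_part \<mu>, neg_part \<mu>]"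
  define a where "a = (!) [1, -1, -r, r]"
  have "(\<Sum>i<4. a i * (LINT x|M i. f x)) = 0"
    by (rule combination_integral_eq_0[OF _ _ _ _ f])
       (auto simp: M_def a_def eval_nat_numeral less_Suc_eq finite_pos_part finite_neg_part pos algebra_simps)
  then show "smint X (r *\<^sub>R \<mu>) u = r * smint X \<mu> u"
    by (simp add: M_def a_def eval_nat_numeral smint_def set_lebesgue_integral_def f_def algebra_simps)
qed


subsection \<open>The embedding\<close>

text \<open>
  The evaluation of signed measures on the test functions embeds \<open>\<M>(closure \<Omega>)\<close> into the
  Banach space of all bounded real functions on the set of test functions.
\<close>

lemma KR_test_measurable:
  assumes "u \<in> KR_test \<Omega>"
  shows "(\<lambda>x. indicator (closure \<Omega>) x * u x) \<in> borel_measurable borel"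
    and "\<And>x. x \<in> closure \<Omega> \<Longrightarrow> \<bar>u x\<bar> \<le> 1"
proof -
  obtain L where "L-lipschitz_on (closure \<Omega>) u"
    using assms unfolding KR_test_def Lip_def by blast
  then have "continuous_on (closure \<Omega>) u" by (rule lipschitz_on_continuous_on)
  then show "(\<lambda>x. indicator (closure \<Omega>) x * u x) \<in> borel_measurable borel"
    using borel_measurable_continuous_on_indicator[of "closure \<Omega>" u] by simp
  show "\<And>x. x \<in> closure \<Omega> \<Longrightarrow> \<bar>u x\<bar> \<le> 1"
    using assms unfolding KR_test_def by blast
qed

lemma zero_in_KR_test: "(\<lambda>_. 0) \<in> KR_test \<Omega>"
proof -
  have "grad_le_1 \<Omega> (\<lambda>_. 0)"
    unfolding grad_le_1_def by (intro AE_I2 exI[of _ 0] conjI GDERIV_const) simp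
  then show ?thesis
    by (auto simp: KR_test_def Lip_def lipschitz_on_def)
qed

lemma uminus_in_KR_test:
  assumes "u \<in> KR_test \<Omega>"
  shows "(\<lambda>x. - u x) \<in> KR_test \<Omega>"
proof -
  have "AE x in lebesgue_on \<Omega>. \<exists>g. (GDERIV u x :> g) \<and> norm g \<le> 1"
    using assms by (simp add: KR_test_def grad_le_1_def)
  then have "grad_le_1 \<Omega> (\<lambda>x. - u x)"
    unfolding grad_le_1_def by eventually_elim (metis GDERIV_minus norm_minus_cancel)
  moreover have "(\<lambda>x. - u x) \<in> Lip (closure \<Omega>)"
    using assms by (auto simp: KR_test_def Lip_def lipschitz_on_minus)
  ultimately show ?thesis
    using assms by (simp add: KR_test_def)
qed

lemma smint_uminus_fun: "smint X \<mu> (\<lambda>x. - u x) = - smint X \<mu> u"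
  by (simp add: smint_def set_lebesgue_integral_def)

lemma smint_bound:
  assumes "u \<in> KR_test \<Omega>"
  shows "\<bar>smint (closure \<Omega>) \<mu> u\<bar> \<le> measure (pos_part \<mu>) UNIV + measure (neg_part \<mu>) UNIV"
proof -
  have *: "\<bar>set_lebesgue_integral M (closure \<Omega>) u\<bar> \<le> measure M UNIV"
    if M: "finite_measure M" "sets M = sets borel" for M
  proof -
    interpret finite_measure M by fact
    have sp: "space M = UNIV" using sets_eq_imp_space_eq[OF M(2)] by simp
    have "integrable M (\<lambda>x. indicator (closure \<Omega>) x * u x)"
      by (rule integrable_const_bound[of _ 1])
         (use KR_test_measurable[OF assms] M(2) sp in \<open>auto simp: measurable_def indicator_def\<close>)
    then have "\<bar>LINT x|M. indicator (closure \<Omega>) x * u x\<bar> \<le> (LINT x|M. 1)"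
      using KR_test_measurable(2)[OF assms]
      by (intro order_trans[OF integral_abs_bound] integral_mono) (auto simp: indicator_def)
    then show ?thesis
      by (simp add: set_lebesgue_integral_def sp)
  qed
  show ?thesis
    using *[OF finite_pos_part[of \<mu>]] *[OF finite_neg_part[of \<mu>]] by (simp add: smint_def)
qed

lemma KR_embedding_exists:
  fixes \<Omega> :: "'a::euclidean_space set"
  shows "\<exists>\<iota> :: 'a signed_measure \<Rightarrow> (('a \<Rightarrow> real) discrete \<Rightarrow>\<^sub>C real). KR_embedding \<Omega> \<iota>"
proof -
  define e where "e \<mu> d = (if of_discrete d \<in> KR_test \<Omega> then smint (closure \<Omega>) \<mu> (of_discrete d) else 0)"
    for \<mu> and d :: "('a \<Rightarrow> real) discrete"
  define \<iota> where "\<iota> \<mu> = Bcontfun (e \<mu>)" for \<mu>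
  have e_bound: "\<bar>e \<mu> d\<bar> \<le> measure (pos_part \<mu>) UNIV + measure (neg_part \<mu>) UNIV" for \<mu> d
    using smint_bound[of "of_discrete d" \<Omega> \<mu>] by (auto simp: e_def)
  have "e \<mu> \<in> bcontfun" for \<mu>
  proof -
    have "continuous_on UNIV (e \<mu>)"
      unfolding continuous_on_open_vimage[OF open_UNIV] by (simp add: open_discrete)
    moreover have "bounded (range (e \<mu>))"
      using e_bound[of \<mu>] unfolding bounded_iff by auto
    ultimately show ?thesis by (simp add: bcontfun_def)
  qed
  then have \<iota>: "apply_bcontfun (\<iota> \<mu>) = e \<mu>" for \<mu>
    by (simp add: \<iota>_def Bcontfun_inverse)
  have bdd: "bdd_above (smint (closure \<Omega>) \<mu> ` KR_test \<Omega>)" for \<mu>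
    using smint_bound[of _ \<Omega> \<mu>]
    by (intro bdd_aboveI2[of _ _ "measure (pos_part \<mu>) UNIV + measure (neg_part \<mu>) UNIV"])
       (meson abs_le_D1)
  have upper: "smint (closure \<Omega>) \<mu> u \<le> KR_norm \<Omega> \<mu>" if "u \<in> KR_test \<Omega>" for u \<mu>
    unfolding KR_norm_def using bdd that by (rule cSUP_upper2) simp
  have "norm (\<iota> \<mu>) = KR_norm \<Omega> \<mu>" for \<mu>
  proof (rule antisym)
    show "norm (\<iota> \<mu>) \<le> KR_norm \<Omega> \<mu>"
    proof (rule norm_bound)
      fix d
      have "0 \<le> KR_norm \<Omega> \<mu>"
        using upper[OF zero_in_KR_test, of \<mu>] by (simp add: smint_def set_lebesgue_integral_def)
      then show "norm (apply_bcontfun (\<iota> \<mu>) d) \<le> KR_norm \<Omega> \<mu>"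
        using upper[of "of_discrete d" \<mu>] upper[OF uminus_in_KR_test, of "of_discrete d" \<mu>]
        by (auto simp: \<iota> e_def smint_uminus_fun)
    qed
    have "smint (closure \<Omega>) \<mu> u \<le> norm (\<iota> \<mu>)" if "u \<in> KR_test \<Omega>" for u
      using norm_bounded[of "\<iota> \<mu>" "discrete u"] that by (simp add: \<iota> e_def discrete_inverse)
    then show "KR_norm \<Omega> \<mu> \<le> norm (\<iota> \<mu>)"
      unfolding KR_norm_def using zero_in_KR_test by (intro cSUP_least) auto
  qed
  moreover have lin: "smint (closure \<Omega>) (\<mu> + \<nu>) u = smint (closure \<Omega>) \<mu> u + smint (closure \<Omega>) \<nu> u"
    "smint (closure \<Omega>) (c *\<^sub>R \<mu>) u = c * smint (closure \<Omega>) \<mu> u"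
    if "u \<in> KR_test \<Omega>" for \<mu> \<nu> c u
    using smint_add_scale[OF KR_test_measurable[OF that] zero_le_one] by auto
  moreover have "\<iota> (\<mu> + \<nu>) = \<iota> \<mu> + \<iota> \<nu>" for \<mu> \<nu>
    by (rule bcontfun_eqI)
       (simp add: \<iota> e_def plus_bcontfun.rep_eq lin(1))
  moreover have "\<iota> (c *\<^sub>R \<mu>) = c *\<^sub>R \<iota> \<mu>" for c \<mu>
    by (rule bcontfun_eqI)
       (simp add: \<iota> e_def scaleR_bcontfun.rep_eq lin(2))
  ultimately show ?thesis
    unfolding KR_embedding_def by blast
qed

end

theory Submission
  imports Defs "HOL-Probability.Giry_Monad"
begin

text \<open>
  Write \<open>N\<close> for \<open>KR_boundary \<Omega> \<iota>\<close>, \<open>q\<close> for the quotient norm modulo \<open>N\<close>, \<open>F\<close> for \<open>Jstar_coset \<Omega> \<iota>\<close> and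
  \<open>r\<close> for the inradius. Both claims follow from the two inequalities \<open>q \<le> F \<le> max 1 r * q\<close>.

  The upper bound holds because the values of a function competing in \<open>F\<close> are controlled by its
  gradient: a Lipschitz function whose gradient has norm at most 1 almost everywhere is 1-Lipschitz
  along each segment whose interior lies in \<open>\<Omega>\<close> (averaging over small balls turns the almost-everywhere
  bound into a bound on increments: \<open>ball_average_increment_le\<close>). If it also vanishes on the boundary,
  then comparing \<open>x\<close> with the nearest boundary point gives \<open>\<bar>u x\<bar> \<le> r\<close>. Hence \<open>u / max 1 r\<close> is a test function for
  the Kantorovich--Rubinstein norm, and it does not see \<open>N\<close>.

  The lower bound is duality. By the Hahn--Banach theorem there is a linear functional \<open>f\<close> of norm at
  most 1 that vanishes on \<open>N\<close> and takes the value \<open>q \<xi>\<close> at \<open>\<xi>\<close>. Put \<open>u x = f (\<iota> \<delta>\<^sub>x)\<close>, where \<open>\<delta>\<^sub>x\<close> is the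
  unit mass at \<open>x\<close>. Measures on \<open>\<Omega>\<close> are limits of combinations of point masses
  (\<open>approximation_by_point_masses\<close>), and therefore \<open>f (\<iota> \<mu>) = \<integral>u d\<mu>\<close> for them. In general a
  functional of norm at most 1 yields only a function that is 1-Lipschitz along segments inside \<open>\<Omega>\<close>, and near a cusp of
  the complement such a function need not be Lipschitz for the Euclidean distance. But here \<open>u\<close> vanishes
  on the boundary, and that makes it 1-Lipschitz on all of \<open>closure \<Omega>\<close>: a segment that leaves
  \<open>\<Omega>\<close> passes through a point outside \<open>\<Omega>\<close>, and \<open>\<bar>u\<bar>\<close> is bounded by the distance to that point at both ends
  (\<open>segment_Lipschitz_imp_Lipschitz\<close>).

  It remains to pass from the Euclidean Lipschitz constant back to the gradient. The function \<open>u\<close> is a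
  uniform limit of everywhere differentiable functions with gradient bounded by 1 that vanish on
  the boundary (\<open>Lip0_approximation\<close>), and integrals against a finite measure converge along with
  them. This gives \<open>q \<le> F\<close> for measures, and then for all elements of the completion by density.
\<close>

section \<open>The Hahn--Banach theorem and quotient norms\<close>

definition sublinear :: "('b::real_vector \<Rightarrow> real) \<Rightarrow> bool" where
  "sublinear q \<longleftrightarrow> (\<forall>x y. q (x + y) \<le> q x + q y) \<and> (\<forall>c\<ge>0. \<forall>x. q (c *\<^sub>R x) = c * q x)"

lemma sublinearD:
  assumes "sublinear q"
  shows "q (x + y) \<le> q x + q y" and "0 \<le> c \<Longrightarrow> q (c *\<^sub>R x) = c * q x" and "q 0 = 0"
    and "- q (- x) \<le> q x"
proof -
  show add: "q (x + y) \<le> q x + q y" for x y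
    using assms by (simp add: sublinear_def)
  show scale: "q (c *\<^sub>R x) = c * q x" if "0 \<le> c" for c x
    using assms that by (simp add: sublinear_def)
  show zero: "q 0 = 0" using scale[of 0 0] by simp
  show "- q (- x) \<le> q x" using add[of x "- x"] zero by simp
qed

text \<open>
  A minimal sublinear functional is linear: the tilted functional \<open>tilt q y\<close> is again sublinear and
  lies below \<open>q\<close>, and at \<open>- y\<close> it is at most \<open>- q y\<close>. If it equals \<open>q\<close>, then \<open>q (- y) = - q y\<close>. Tilting along
  \<open>x0\<close> before minimizing also ensures that the value at \<open>x0\<close> is kept.
\<close>

definition tilt :: "('b::real_vector \<Rightarrow> real) \<Rightarrow> 'b \<Rightarrow> 'b \<Rightarrow> real" where
  "tilt q y x = (INF t\<in>{0..}. q (x + t *\<^sub>R y) - t * q y)"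

lemma
  fixes q :: "'b::real_vector \<Rightarrow> real"
  assumes q: "sublinear q"
  shows sublinear_tilt: "sublinear (tilt q y)"
    and tilt_le: "tilt q y x \<le> q x"
    and tilt_minus_le: "tilt q y (- y) \<le> - q y"
proof -
  note qD = sublinearD[OF q]
  have bdd: "bdd_below ((\<lambda>t. q (x + t *\<^sub>R y) - t * q y) ` {0..})" for x
  proof (rule bdd_belowI2[of _ "- q (- x)"])
    fix t :: real assume "t \<in> {0..}"
    then show "- q (- x) \<le> q (x + t *\<^sub>R y) - t * q y"
      using qD(1)[of "x + t *\<^sub>R y" "- x"] qD(2)[of t y] by simp
  qed
  have le: "tilt q y x \<le> q (x + t *\<^sub>R y) - t * q y" if "0 \<le> t" for x t
    unfolding tilt_def using that by (intro cINF_lower bdd) auto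
  have ge: "a \<le> tilt q y x" if "\<And>t. 0 \<le> t \<Longrightarrow> a \<le> q (x + t *\<^sub>R y) - t * q y" for a x
    unfolding tilt_def using that by (intro cINF_greatest) auto
  show "tilt q y x \<le> q x" for x
    using le[of 0 x] by simp
  show "tilt q y (- y) \<le> - q y"
    using le[of 1 "- y"] qD(3) by simp
  have add: "tilt q y (x + z) \<le> tilt q y x + tilt q y z" for x z
  proof -
    have *: "tilt q y (x + z) \<le> (q (x + s *\<^sub>R y) - s * q y) + (q (z + t *\<^sub>R y) - t * q y)"
      if "0 \<le> s" "0 \<le> t" for s t
      using le[of "s + t" "x + z"] that qD(1)[of "x + s *\<^sub>R y" "z + t *\<^sub>R y"]
      by (simp add: algebra_simps)
    have "tilt q y (x + z) - (q (x + s *\<^sub>R y) - s * q y) \<le> tilt q y z" if "0 \<le> s" for s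
      by (rule ge) (use *[OF that] in \<open>simp add: algebra_simps\<close>)
    then have "tilt q y (x + z) - tilt q y z \<le> tilt q y x"
      by (intro ge) (smt (verit))
    then show ?thesis by simp
  qed
  have scale_le: "tilt q y (c *\<^sub>R x) \<le> c * tilt q y x" if c: "0 < c" for c x
  proof -
    have "tilt q y (c *\<^sub>R x) / c \<le> tilt q y x"
    proof (rule ge)
      fix t :: real assume t: "0 \<le> t"
      have "tilt q y (c *\<^sub>R x) \<le> q (c *\<^sub>R (x + t *\<^sub>R y)) - (c * t) * q y"
        using le[of "c * t" "c *\<^sub>R x"] t c by (simp add: scaleR_add_right)
      also have "\<dots> = c * (q (x + t *\<^sub>R y) - t * q y)"
        using c qD(2)[of c] by (simp add: right_diff_distrib)
      finally show "tilt q y (c *\<^sub>R x) / c \<le> q (x + t *\<^sub>R y) - t * q y"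
        using c by (simp add: field_simps)
    qed
    then show ?thesis using c by (simp add: field_simps)
  qed
  have "tilt q y (c *\<^sub>R x) = c * tilt q y x" if c: "0 \<le> c" for c x
  proof (cases "c = 0")
    case True
    have "tilt q y 0 = 0"
      using le[of 0 0] ge[of 0 0] qD(2,3) by (intro antisym) auto
    then show ?thesis using True by simp
  next
    case False
    then have "c * tilt q y x \<le> tilt q y (c *\<^sub>R x)"
      using scale_le[of "inverse c" "c *\<^sub>R x"] c by (simp add: field_simps)
    then show ?thesis using scale_le[of c x] c False by simp
  qed
  then show "sublinear (tilt q y)"
    using add by (simp add: sublinear_def)
qed

lemma minimal_sublinear_exists:
  fixes p :: "'b::real_vector \<Rightarrow> real"
  assumes p: "sublinear p"
  shows "\<exists>m. sublinear m \<and> m \<le> p \<and> (\<forall>q. sublinear q \<longrightarrow> q \<le> m \<longrightarrow> q = m)"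
proof -
  define A where "A = {q. sublinear q \<and> q \<le> p}"
  have "\<exists>m\<in>A. \<forall>q\<in>A. m \<ge> q \<longrightarrow> q = m"
  proof (rule predicate_Zorn)
    show "partial_order_on A (relation_of (\<ge>) A)"
      by (rule partial_order_on_relation_ofI) auto
    fix C assume C: "C \<in> Chains (relation_of (\<ge>) A)"
    then have CA: "C \<subseteq> A" and chain: "\<And>q r. q \<in> C \<Longrightarrow> r \<in> C \<Longrightarrow> q \<le> r \<or> r \<le> q"
      by (auto simp: Chains_def relation_of_def)
    show "\<exists>u\<in>A. \<forall>a\<in>C. u \<le> a"
    proof (cases "C = {}")
      case True
      then show ?thesis using p by (auto simp: A_def)
    next
      case False
      define u where "u x = (INF q\<in>C. q x)" for x
      have sub: "sublinear q" "q \<le> p" if "q \<in> C" for q using that CA by (auto simp: A_def)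
      have "bdd_below ((\<lambda>q. q x) ` C)" for x
      proof (rule bdd_belowI2)
        fix q assume q: "q \<in> C"
        show "- p (- x) \<le> q x"
          using sublinearD(4)[OF sub(1)[OF q], of x] le_funD[OF sub(2)[OF q], of "- x"] by linarith
      qed
      then have le: "u x \<le> q x" if "q \<in> C" for q x
        unfolding u_def using that by (intro cINF_lower) auto
      have ge: "a \<le> u x" if "\<And>q. q \<in> C \<Longrightarrow> a \<le> q x" for a x
        unfolding u_def using that False by (intro cINF_greatest) auto
      have add: "u (x + y) \<le> u x + u y" for x y
      proof -
        have *: "u (x + y) \<le> q x + r y" if qr: "q \<in> C" "r \<in> C" for q r
        proof -
          obtain s where s: "s \<in> C" "s \<le> q" "s \<le> r" using chain[OF qr] qr by blast
          show ?thesis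
            using le[OF s(1), of "x + y"] sublinearD(1)[OF sub(1)[OF s(1)], of x y]
              le_funD[OF s(2), of x] le_funD[OF s(3), of y] by linarith
        qed
        have "u (x + y) - q x \<le> u y" if "q \<in> C" for q
          by (rule ge) (use *[OF that] in \<open>simp add: algebra_simps\<close>)
        then have "u (x + y) - u y \<le> u x" by (intro ge) (smt (verit))
        then show ?thesis by simp
      qed
      have "u (c *\<^sub>R x) = c * u x" if c: "0 \<le> c" for c x
      proof (cases "c = 0")
        case True
        have "u 0 = 0" using False sub(1) by (simp add: u_def sublinearD(3))
        then show ?thesis using True by simp
      next
        case False
        have eq: "q (c *\<^sub>R x) = c * q x" if "q \<in> C" for q
          using sublinearD(2)[OF sub(1)[OF that] c] .
        have "c * u x \<le> u (c *\<^sub>R x)"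
        proof (rule ge)
          fix q assume q: "q \<in> C"
          show "c * u x \<le> q (c *\<^sub>R x)"
            unfolding eq[OF q] using le[OF q] c by (rule mult_left_mono)
        qed
        moreover have "u (c *\<^sub>R x) / c \<le> u x"
        proof (rule ge)
          fix q assume q: "q \<in> C"
          show "u (c *\<^sub>R x) / c \<le> q x"
            using le[OF q, of "c *\<^sub>R x"] c False unfolding eq[OF q] by (simp add: field_simps)
        qed
        ultimately show ?thesis using c False by (simp add: field_simps)
      qed
      then have "sublinear u" using add by (simp add: sublinear_def)
      moreover have "u \<le> p"
      proof -
        obtain q where "q \<in> C" using False by blast
        then show ?thesis using le sub(2) by (meson le_fun_def order_trans)
      qed
      ultimately show ?thesis using le by (auto simp: A_def le_fun_def)
    qed
  qed
  then show ?thesis unfolding A_def by (auto intro: order_trans)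
qed

theorem Hahn_Banach_dominated:
  fixes p :: "'b::real_vector \<Rightarrow> real"
  assumes p: "sublinear p"
  shows "\<exists>f. linear f \<and> (\<forall>x. f x \<le> p x) \<and> f x0 = p x0"
proof -
  obtain m where m: "sublinear m" "m \<le> tilt p x0"
    and minimal: "\<And>q. sublinear q \<Longrightarrow> q \<le> m \<Longrightarrow> q = m"
    using minimal_sublinear_exists[OF sublinear_tilt[OF p]] by blast
  note mD = sublinearD[OF m(1)]
  have mp: "m x \<le> p x" for x
    using le_funD[OF m(2), of x] tilt_le[OF p, of x0 x] by linarith
  have neg: "m (- y) = - m y" for y
  proof -
    have "tilt m y = m"
      using tilt_le[OF m(1)] by (intro minimal sublinear_tilt[OF m(1)]) (simp add: le_fun_def)
    then show ?thesis using tilt_minus_le[OF m(1), of y] mD(4)[of "- y"] by simp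
  qed
  have "linear m"
  proof (rule linearI)
    fix x y and c :: real
    show "m (x + y) = m x + m y"
      using mD(1)[of x y] mD(1)[of "- x" "- y"] neg[of "x + y"] neg[of x] neg[of y] by simp
    show "m (c *\<^sub>R x) = c *\<^sub>R m x"
    proof (cases "0 \<le> c")
      case True
      then show ?thesis using mD(2) by simp
    next
      case False
      then show ?thesis using mD(2)[of "- c" x] neg[of "c *\<^sub>R x"] by simp
    qed
  qed
  moreover have "m x0 = p x0"
    using mp[of x0] le_funD[OF m(2), of "- x0"] tilt_minus_le[OF p, of x0] neg[of x0] by simp
  ultimately show ?thesis using mp by blast
qed

lemma quotient_norm_coset: "quotient_norm (coset N \<xi>) = (INF \<nu>\<in>N. norm (\<xi> + \<nu>))"
  by (simp add: quotient_norm_def coset_def image_image)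

lemma quotient_norm_coset_le: "\<nu> \<in> N \<Longrightarrow> quotient_norm (coset N \<xi>) \<le> norm (\<xi> + \<nu>)"
  unfolding quotient_norm_coset by (rule cINF_lower) (auto intro!: bdd_belowI2[of _ 0])

lemma quotient_norm_coset_ge:
  "N \<noteq> {} \<Longrightarrow> (\<And>\<nu>. \<nu> \<in> N \<Longrightarrow> a \<le> norm (\<xi> + \<nu>)) \<Longrightarrow> a \<le> quotient_norm (coset N \<xi>)"
  unfolding quotient_norm_coset by (rule cINF_greatest)

lemma sublinear_quotient_norm:
  fixes N :: "'b::real_normed_vector set"
  assumes N: "subspace N"
  shows "sublinear (\<lambda>\<xi>. quotient_norm (coset N \<xi>))"
proof -
  let ?q = "\<lambda>\<xi>. quotient_norm (coset N \<xi>)"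
  have ne: "N \<noteq> {}" using subspace_0[OF N] by blast
  have add: "?q (\<xi> + \<eta>) \<le> ?q \<xi> + ?q \<eta>" for \<xi> \<eta>
  proof -
    have *: "?q (\<xi> + \<eta>) \<le> norm (\<xi> + \<nu>) + norm (\<eta> + \<nu>')" if "\<nu> \<in> N" "\<nu>' \<in> N" for \<nu> \<nu>'
      using quotient_norm_coset_le[OF subspace_add[OF N that], of "\<xi> + \<eta>"]
        norm_triangle_ineq[of "\<xi> + \<nu>" "\<eta> + \<nu>'"] by (simp add: algebra_simps)
    have "?q (\<xi> + \<eta>) - norm (\<xi> + \<nu>) \<le> ?q \<eta>" if "\<nu> \<in> N" for \<nu>
      by (rule quotient_norm_coset_ge[OF ne]) (use *[OF that] in \<open>simp add: algebra_simps\<close>)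
    then have "?q (\<xi> + \<eta>) - ?q \<eta> \<le> ?q \<xi>"
      by (intro quotient_norm_coset_ge[OF ne]) (smt (verit))
    then show ?thesis by simp
  qed
  have scale_le: "?q (c *\<^sub>R \<xi>) \<le> c * ?q \<xi>" if c: "0 < c" for c \<xi>
  proof -
    have "?q (c *\<^sub>R \<xi>) / c \<le> ?q \<xi>"
    proof (rule quotient_norm_coset_ge[OF ne])
      fix \<nu> assume "\<nu> \<in> N"
      then have "?q (c *\<^sub>R \<xi>) \<le> norm (c *\<^sub>R (\<xi> + \<nu>))"
        using quotient_norm_coset_le[OF subspace_scale[OF N], of \<nu> "c *\<^sub>R \<xi>" c]
        by (simp add: scaleR_add_right)
      then have "?q (c *\<^sub>R \<xi>) \<le> c * norm (\<xi> + \<nu>)"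
        unfolding norm_scaleR using c by simp
      then show "?q (c *\<^sub>R \<xi>) / c \<le> norm (\<xi> + \<nu>)"
        using c by (simp add: pos_divide_le_eq mult.commute)
    qed
    then show ?thesis using c by (simp add: field_simps)
  qed
  have "?q (c *\<^sub>R \<xi>) = c * ?q \<xi>" if c: "0 \<le> c" for c \<xi>
  proof (cases "c = 0")
    case True
    have "?q 0 = 0"
      using quotient_norm_coset_le[OF subspace_0[OF N], of 0] quotient_norm_coset_ge[OF ne, of 0 0]
      by simp
    then show ?thesis using True by simp
  next
    case False
    then have "c * ?q \<xi> \<le> ?q (c *\<^sub>R \<xi>)"
      using scale_le[of "inverse c" "c *\<^sub>R \<xi>"] c by (simp add: field_simps)
    then show ?thesis using scale_le[of c \<xi>] c False by simp
  qed
  then show ?thesis using add by (simp add: sublinear_def)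
qed

text \<open>
  The quotient norm is a sublinear function on the whole space that vanishes on \<open>N\<close>; a linear
  functional below it that touches it at \<open>\<xi>0\<close> is therefore the required functional on the quotient.
\<close>

lemma quotient_norming_functional:
  fixes N :: "'b::real_normed_vector set"
  assumes N: "subspace N"
  shows "\<exists>f. linear f \<and> (\<forall>\<xi>. \<bar>f \<xi>\<bar> \<le> norm \<xi>) \<and> (\<forall>\<nu>\<in>N. f \<nu> = 0) \<and>
    f \<xi>0 = quotient_norm (coset N \<xi>0)"
proof -
  obtain f where f: "linear f" "\<And>\<xi>. f \<xi> \<le> quotient_norm (coset N \<xi>)"
    "f \<xi>0 = quotient_norm (coset N \<xi>0)"
    using Hahn_Banach_dominated[OF sublinear_quotient_norm[OF N]] by blast
  have le: "f \<xi> \<le> norm (\<xi> + \<nu>)" if "\<nu> \<in> N" for \<xi> \<nu>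
    using f(2)[of \<xi>] quotient_norm_coset_le[OF that, of \<xi>] by linarith
  have "\<bar>f \<xi>\<bar> \<le> norm \<xi>" for \<xi>
    using le[OF subspace_0[OF N], of \<xi>] le[OF subspace_0[OF N], of "- \<xi>"]
    by (simp add: linear_neg[OF f(1)])
  moreover have "f \<nu> = 0" if "\<nu> \<in> N" for \<nu>
    using le[OF subspace_neg[OF N that], of \<nu>] le[OF that, of "- \<nu>"]
    by (simp add: linear_neg[OF f(1)])
  ultimately show ?thesis using f by blast
qed

section \<open>From the gradient bound to increments along segments\<close>

text \<open>
  Differentiability in the form in which it passes under an integral: truncating the difference
  quotient at \<open>norm v\<close> makes the limit the constant 0 instead of a function of the base point.
\<close>

lemma excess_difference_quotient_tendsto_0:
  fixes u :: "'a::real_inner \<Rightarrow> real"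
  assumes "GDERIV u q :> g" "norm g \<le> 1"
  shows "((\<lambda>h. max 0 (\<bar>u (q + h *\<^sub>R v) - u q\<bar> / \<bar>h\<bar> - norm v)) \<longlongrightarrow> 0) (at 0)"
proof -
  have u: "(u has_derivative (\<lambda>h. inner h g)) (at (q + 0 *\<^sub>R v))"
    using assms(1) by (simp add: gderiv_def)
  have "((\<lambda>h. q + h *\<^sub>R v) has_derivative (\<lambda>h. h *\<^sub>R v)) (at 0)"
    by (auto intro!: derivative_eq_intros)
  from has_derivative_compose[OF this u]
  have "((\<lambda>h. u (q + h *\<^sub>R v)) has_real_derivative inner v g) (at 0)"
    by (simp add: has_field_derivative_def mult_commute_abs)
  then have "((\<lambda>h. (u (q + h *\<^sub>R v) - u q) / h) \<longlongrightarrow> inner v g) (at 0)"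
    by (simp add: has_field_derivative_iff)
  then have "((\<lambda>h. max 0 (\<bar>(u (q + h *\<^sub>R v) - u q) / h\<bar> - norm v)) \<longlongrightarrow> max 0 (\<bar>inner v g\<bar> - norm v)) (at 0)"
    by (intro tendsto_intros)
  moreover have "\<bar>inner v g\<bar> \<le> norm v"
    using Cauchy_Schwarz_ineq2[of v g] mult_left_mono[OF assms(2), of "norm v"] by simp
  ultimately show ?thesis by (simp add: abs_divide)
qed

lemma AE_grad_translate:
  fixes \<Omega> B :: "'a::euclidean_space set"
  assumes grad: "grad_le_1 \<Omega> u" and \<Omega>: "open \<Omega>" and B: "open B" "\<And>z. z \<in> B \<Longrightarrow> p + z \<in> \<Omega>"
  shows "AE z in lebesgue_on B. \<exists>g. (GDERIV u (p + z) :> g) \<and> norm g \<le> 1"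
proof -
  define P where "P x \<longleftrightarrow> (\<exists>g. (GDERIV u x :> g) \<and> norm g \<le> 1)" for x
  have "AE x in lebesgue. x \<in> \<Omega> \<longrightarrow> P x"
    using grad \<Omega> unfolding grad_le_1_def P_def by (subst (asm) AE_restrict_space_iff) auto
  then obtain N where N: "negligible N" "{x. \<not> (x \<in> \<Omega> \<longrightarrow> P x)} \<subseteq> N"
    unfolding eventually_ae_filter_negligible by blast
  have "{z. \<not> (z \<in> B \<longrightarrow> P (p + z))} \<subseteq> (+) (- p) ` N"
  proof
    fix z assume "z \<in> {z. \<not> (z \<in> B \<longrightarrow> P (p + z))}"
    then have "p + z \<in> N" using N(2) B(2) by auto
    then show "z \<in> (+) (- p) ` N" by (intro image_eqI[of _ _ "p + z"]) auto
  qed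
  then have "AE z in lebesgue. z \<in> B \<longrightarrow> P (p + z)"
    unfolding eventually_ae_filter_negligible using negligible_translation[OF N(1), of "- p"] by blast
  then show ?thesis
    using B(1) unfolding P_def by (subst AE_restrict_space_iff) auto
qed

text \<open>
  A bound on difference quotients near each point, with radii that depend on the point, adds up to
  a bound on the increment; this replaces the mean value theorem for a function whose
  derivative is not known to exist.
\<close>

lemma locally_Lipschitz_imp_increment_le:
  fixes G :: "real \<Rightarrow> real"
  assumes loc: "\<And>t. 0 \<le> t \<Longrightarrow> t \<le> 1 \<Longrightarrow>
      \<exists>d>0. \<forall>s. 0 \<le> s \<and> s \<le> 1 \<and> \<bar>s - t\<bar> < d \<longrightarrow> \<bar>G s - G t\<bar> \<le> K * \<bar>s - t\<bar>"
  shows "\<bar>G 1 - G 0\<bar> \<le> K"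
proof -
  define P where "P a b \<longleftrightarrow> (0 \<le> a \<and> a \<le> b \<and> b \<le> 1 \<longrightarrow> \<bar>G b - G a\<bar> \<le> K * (b - a))" for a b
  have "P 0 1"
  proof (rule Bolzano)
    fix a b c assume "P a b" "P b c" "a \<le> b" "b \<le> c"
    then show "P a c" unfolding P_def by (auto simp: algebra_simps)
  next
    fix x :: real assume x: "0 \<le> x" "x \<le> 1"
    obtain d where d: "d > 0"
      "\<And>s. 0 \<le> s \<Longrightarrow> s \<le> 1 \<Longrightarrow> \<bar>s - x\<bar> < d \<Longrightarrow> \<bar>G s - G x\<bar> \<le> K * \<bar>s - x\<bar>"
      using loc[OF x] by blast
    have "P a b" if "a \<le> x" "x \<le> b" "b - a < d" for a b
      unfolding P_def
    proof
      assume "0 \<le> a \<and> a \<le> b \<and> b \<le> 1"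
      then show "\<bar>G b - G a\<bar> \<le> K * (b - a)"
        using d(2)[of a] d(2)[of b] that by (auto simp: algebra_simps)
    qed
    then show "\<exists>d>0. \<forall>a b. a \<le> x \<and> x \<le> b \<and> b - a < d \<longrightarrow> P a b" using d(1) by blast
  qed simp
  then show ?thesis by (simp add: P_def)
qed

text \<open>
  The gradient bound holds only almost everywhere, so it says nothing about the particular segment
  from \<open>x\<close> to \<open>x + v\<close>. The average \<open>G t\<close> of \<open>u\<close> over a small ball that travels along the segment does see
  it: by dominated convergence its difference quotients are asymptotically at most \<open>norm v\<close>
  times the volume of the ball. Replacing \<open>u\<close> by its average costs at most \<open>L * r\<close> at each end.
\<close>

lemma ball_average_increment_le:
  fixes u :: "'a::euclidean_space \<Rightarrow> real"
  assumes \<Omega>: "open \<Omega>" and u: "L-lipschitz_on (closure \<Omega>) u" and grad: "grad_le_1 \<Omega> u"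
    and in\<Omega>: "\<And>t z. 0 \<le> t \<Longrightarrow> t \<le> 1 \<Longrightarrow> z \<in> ball 0 r \<Longrightarrow> x + t *\<^sub>R v + z \<in> \<Omega>"
    and r: "0 < r" and \<eta>: "0 < \<eta>"
  shows "\<bar>u (x + v) - u x\<bar> \<le> norm v + \<eta> + 2 * L * r"
proof -
  have u_le: "\<bar>u a - u b\<bar> \<le> L * dist a b" if "a \<in> \<Omega>" "b \<in> \<Omega>" for a b
    using lipschitz_onD[OF u, of a b] that closure_subset by (force simp: dist_real_def)
  have L: "0 \<le> L" using u by (rule lipschitz_on_nonneg)
  define B where "B = ball (0::'a) r"
  define M where "M = lebesgue_on B"
  define m where "m = measure lebesgue B"
  define F where "F t z = u (x + t *\<^sub>R v + z)" for t z
  define G where "G t = (LINT z|M. F t z)" for t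
  interpret M: finite_measure M
    unfolding M_def B_def by (intro finite_measure_lebesgue_on) (simp add: lmeasurable_ball)
  have spM: "space M = B" by (simp add: M_def B_def)
  have mM: "measure M B = m" unfolding M_def m_def by (rule measure_restrict_space) (auto simp: B_def)
  have m: "0 < m" using r by (simp add: m_def B_def content_ball_pos)
  have F_meas: "F t \<in> borel_measurable M" if "0 \<le> t" "t \<le> 1" for t
  proof -
    have "continuous_on \<Omega> u"
      using lipschitz_on_continuous_on[OF u] closure_subset by (rule continuous_on_subset)
    then have "continuous_on B (F t)"
      unfolding F_def
      by (rule continuous_on_compose2)
         (use in\<Omega> that in \<open>auto simp: B_def image_subset_iff simp del: image_add_ball intro!: continuous_intros\<close>)
    then show ?thesis
      unfolding M_def by (rule continuous_imp_measurable_on_sets_lebesgue) (simp add: B_def)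
  qed
  have F_diff: "\<bar>F s z - F t z\<bar> \<le> L * norm v * \<bar>s - t\<bar>"
    if "0 \<le> s" "s \<le> 1" "0 \<le> t" "t \<le> 1" "z \<in> B" for s t z
  proof -
    have "dist (x + s *\<^sub>R v + z) (x + t *\<^sub>R v + z) = \<bar>s - t\<bar> * norm v"
      by (simp add: dist_norm scaleR_left_diff_distrib[symmetric])
    then show ?thesis
      using u_le[of "x + s *\<^sub>R v + z" "x + t *\<^sub>R v + z"] in\<Omega> that by (simp add: F_def B_def mult_ac)
  qed
  have F_near: "\<bar>F t z - F t 0\<bar> \<le> L * r" if "0 \<le> t" "t \<le> 1" "z \<in> B" for t z
  proof -
    have "\<bar>F t z - F t 0\<bar> \<le> L * norm z"
      using u_le[of "x + t *\<^sub>R v + z" "x + t *\<^sub>R v + 0"] in\<Omega>[of t z] in\<Omega>[of t 0] that r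
      by (simp add: F_def B_def dist_norm)
    also have "\<dots> \<le> L * r" using that L by (intro mult_left_mono) (auto simp: B_def)
    finally show ?thesis .
  qed
  have F_int: "integrable M (F t)" if t: "0 \<le> t" "t \<le> 1" for t
  proof (rule M.integrable_const_bound)
    show "AE z in M. norm (F t z) \<le> \<bar>F t 0\<bar> + L * r"
      using F_near[OF t] by (intro AE_I2) (force simp: spM)
  qed (rule F_meas[OF t])
  have "\<bar>G 1 - G 0\<bar> \<le> (norm v + \<eta>) * m"
  proof (rule locally_Lipschitz_imp_increment_le)
    fix t :: real assume t: "0 \<le> t" "t \<le> 1"
    define S where "S = {h. 0 \<le> t + h \<and> t + h \<le> 1}"
    \<comment> \<open>the amount by which the difference quotient of \<open>F\<close> at \<open>t\<close> exceeds \<open>norm v\<close>\<close>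
    define E where "E h z = max 0 (\<bar>F (t + h) z - F t z\<bar> / \<bar>h\<bar> - norm v)" for h z
    have E_meas: "E h \<in> borel_measurable M" if "h \<in> S" for h
      unfolding E_def using F_meas[of "t + h"] F_meas[OF t] that by (simp add: S_def)
    have E_bound: "norm (E h z) \<le> L * norm v" if "h \<in> S" "h \<noteq> 0" "z \<in> B" for h z
    proof -
      have "\<bar>F (t + h) z - F t z\<bar> / \<bar>h\<bar> \<le> L * norm v"
        using F_diff[of "t + h" t z] t that by (simp add: S_def pos_divide_le_eq)
      moreover have "0 \<le> L * norm v" using L by simp
      ultimately show ?thesis unfolding E_def real_norm_def using norm_ge_zero[of v] by linarith
    qed
    have E_lim: "AE z in M. ((\<lambda>h. E h z) \<longlongrightarrow> 0) (at 0)"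
    proof -
      have "AE z in M. \<exists>g. (GDERIV u (x + t *\<^sub>R v + z) :> g) \<and> norm g \<le> 1"
        unfolding M_def using in\<Omega>[OF t] by (intro AE_grad_translate[OF grad \<Omega>]) (auto simp: B_def)
      then show ?thesis
      proof eventually_elim
        case (elim z)
        then obtain g where "GDERIV u (x + t *\<^sub>R v + z) :> g" "norm g \<le> 1" by blast
        from excess_difference_quotient_tendsto_0[OF this, of v] show ?case
          unfolding E_def F_def by (simp add: algebra_simps)
      qed
    qed
    have "((\<lambda>h. LINT z|M. E h z) \<longlongrightarrow> 0) (at 0 within S)"
      unfolding tendsto_at_iff_sequentially comp_def
    proof (intro allI impI)
      fix X :: "nat \<Rightarrow> real" assume X: "\<forall>i. X i \<in> S - {0}" "X \<longlonglongrightarrow> 0"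
      then have X0: "filterlim X (at 0) sequentially" by (simp add: filterlim_at)
      have lim: "AE z in M. (\<lambda>i. E (X i) z) \<longlonglongrightarrow> 0"
        by (rule eventually_mono[OF E_lim]) (rule filterlim_compose[OF _ X0])
      have "(\<lambda>i. LINT z|M. E (X i) z) \<longlonglongrightarrow> (LINT z|M. 0)"
        by (rule integral_dominated_convergence[where w = "\<lambda>_. L * norm v"])
           (use X E_meas E_bound lim in \<open>auto simp: spM intro!: AE_I2\<close>)
      then show "(\<lambda>i. LINT z|M. E (X i) z) \<longlonglongrightarrow> 0" by simp
    qed
    then have "\<forall>\<^sub>F h in at 0 within S. (LINT z|M. E h z) < \<eta> * m"
      by (rule order_tendstoD) (use \<eta> m in simp)
    then obtain d where d: "d > 0" "\<And>h. h \<in> S \<Longrightarrow> h \<noteq> 0 \<Longrightarrow> \<bar>h\<bar> < d \<Longrightarrow> (LINT z|M. E h z) < \<eta> * m"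
      unfolding eventually_at by (auto simp: dist_real_def)
    have "\<bar>G s - G t\<bar> \<le> (norm v + \<eta>) * m * \<bar>s - t\<bar>" if s: "0 \<le> s" "s \<le> 1" "\<bar>s - t\<bar> < d" for s
    proof (cases "s = t")
      case False
      define h where "h = s - t"
      have h: "h \<in> S" "h \<noteq> 0" "\<bar>h\<bar> < d" "s = t + h" using s False by (auto simp: S_def h_def)
      have E_int: "integrable M (E h)"
        using E_bound[OF h(1,2)] E_meas[OF h(1)]
        by (intro M.integrable_const_bound[of _ "L * norm v"]) (auto simp: spM intro!: AE_I2)
      have "\<bar>G s - G t\<bar> = \<bar>LINT z|M. F s z - F t z\<bar>"
        unfolding G_def using F_int s t by (subst Bochner_Integration.integral_diff) auto
      also have "\<dots> \<le> (LINT z|M. \<bar>F s z - F t z\<bar>)" by (rule integral_abs_bound)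
      also have "\<dots> \<le> (LINT z|M. \<bar>h\<bar> * (E h z + norm v))"
      proof (rule integral_mono)
        show "integrable M (\<lambda>z. \<bar>F s z - F t z\<bar>)" using F_int s t by auto
        show "integrable M (\<lambda>z. \<bar>h\<bar> * (E h z + norm v))" using E_int by auto
        fix z
        have "\<bar>F s z - F t z\<bar> / \<bar>h\<bar> \<le> E h z + norm v" by (simp add: E_def h(4))
        then show "\<bar>F s z - F t z\<bar> \<le> \<bar>h\<bar> * (E h z + norm v)"
          using h(2) by (simp add: pos_divide_le_eq mult.commute)
      qed
      also have "\<dots> = \<bar>h\<bar> * ((LINT z|M. E h z) + norm v * m)"
        using E_int by (simp add: spM mM mult.commute)
      also have "\<dots> \<le> \<bar>h\<bar> * (\<eta> * m + norm v * m)"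
        using d(2)[OF h(1-3)] by (intro mult_left_mono) auto
      finally show ?thesis by (simp add: h_def algebra_simps)
    qed simp
    then show "\<exists>d>0. \<forall>s. 0 \<le> s \<and> s \<le> 1 \<and> \<bar>s - t\<bar> < d \<longrightarrow> \<bar>G s - G t\<bar> \<le> (norm v + \<eta>) * m * \<bar>s - t\<bar>"
      using d(1) by blast
  qed
  moreover have "\<bar>(G 1 - G 0) - (F 1 0 - F 0 0) * m\<bar> \<le> 2 * L * r * m"
  proof -
    have "(G 1 - G 0) - (F 1 0 - F 0 0) * m = (LINT z|M. (F 1 z - F 1 0) - (F 0 z - F 0 0))"
      unfolding G_def using F_int[of 0] F_int[of 1] by (simp add: spM mM algebra_simps)
    also have "\<bar>\<dots>\<bar> \<le> (LINT z|M. \<bar>(F 1 z - F 1 0) - (F 0 z - F 0 0)\<bar>)" by (rule integral_abs_bound)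
    also have "\<dots> \<le> (LINT z|M. 2 * L * r)"
    proof (rule integral_mono)
      show "integrable M (\<lambda>z. \<bar>(F 1 z - F 1 0) - (F 0 z - F 0 0)\<bar>)" using F_int[of 0] F_int[of 1] by auto
      fix z assume "z \<in> space M"
      then show "\<bar>(F 1 z - F 1 0) - (F 0 z - F 0 0)\<bar> \<le> 2 * L * r"
        using F_near[of 1 z] F_near[of 0 z] by (simp add: spM)
    qed auto
    finally show ?thesis by (simp add: spM mM mult.commute)
  qed
  moreover have "\<bar>(F 1 0 - F 0 0) * m\<bar> = \<bar>F 1 0 - F 0 0\<bar> * m" using m by (simp add: abs_mult)
  ultimately have "\<bar>F 1 0 - F 0 0\<bar> * m \<le> (norm v + \<eta> + 2 * L * r) * m"
    by (simp add: algebra_simps)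
  then show ?thesis using m by (simp add: F_def)
qed

lemma grad_le_1_imp_increment_le_closed_segment:
  fixes u :: "'a::euclidean_space \<Rightarrow> real"
  assumes \<Omega>: "open \<Omega>" and u: "L-lipschitz_on (closure \<Omega>) u" and grad: "grad_le_1 \<Omega> u"
    and seg: "closed_segment x y \<subseteq> \<Omega>"
  shows "\<bar>u x - u y\<bar> \<le> dist x y"
proof -
  obtain \<delta> where \<delta>: "\<delta> > 0" "(\<Union>p\<in>closed_segment x y. ball p \<delta>) \<subseteq> \<Omega>"
    using compact_subset_open_imp_ball_epsilon_subset[OF compact_segment \<Omega> seg] by blast
  have L: "0 \<le> L" using u by (rule lipschitz_on_nonneg)
  have bound: "\<bar>u x - u y\<bar> \<le> dist x y + r + 2 * L * r" if r: "0 < r" "r \<le> \<delta>" for r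
  proof -
    have "\<bar>u (x + (y - x)) - u x\<bar> \<le> norm (y - x) + r + 2 * L * r"
    proof (rule ball_average_increment_le[OF \<Omega> u grad])
      fix t :: real and z :: 'a assume t: "0 \<le> t" "t \<le> 1" "z \<in> ball 0 r"
      have "x + t *\<^sub>R (y - x) \<in> closed_segment x y"
        using t unfolding in_segment by (intro exI[of _ t]) (auto simp: algebra_simps)
      moreover have "x + t *\<^sub>R (y - x) + z \<in> ball (x + t *\<^sub>R (y - x)) \<delta>"
        using t r by (simp add: dist_norm)
      ultimately show "x + t *\<^sub>R (y - x) + z \<in> \<Omega>" using \<delta>(2) by blast
    qed (use r in auto)
    then show ?thesis by (simp add: dist_norm norm_minus_commute abs_minus_commute)
  qed
  show ?thesis
  proof (rule field_le_epsilon)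
    fix e :: real assume e: "0 < e"
    define r where "r = min \<delta> (e / (1 + 2 * L))"
    have "r * (1 + 2 * L) \<le> e / (1 + 2 * L) * (1 + 2 * L)"
      using L by (intro mult_right_mono) (auto simp: r_def)
    also have "\<dots> = e" using L by simp
    finally have "r * (1 + 2 * L) \<le> e" .
    moreover have "0 < r" "r \<le> \<delta>"
      using e \<delta>(1) L by (auto simp: r_def)
    ultimately show "\<bar>u x - u y\<bar> \<le> dist x y + e" using bound[of r] by (simp add: algebra_simps)
  qed
qed

text \<open>
  The endpoints may lie on the boundary, where there is no room for a ball; the inequality extends to
  them by continuity on the closure.
\<close>

lemma grad_le_1_imp_increment_le_open_segment:
  fixes u :: "'a::euclidean_space \<Rightarrow> real"
  assumes \<Omega>: "open \<Omega>" and u: "u \<in> Lip (closure \<Omega>)" and grad: "grad_le_1 \<Omega> u"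
    and seg: "open_segment x y \<subseteq> \<Omega>" and xy: "x \<in> closure \<Omega>" "y \<in> closure \<Omega>"
  shows "\<bar>u x - u y\<bar> \<le> dist x y"
proof (cases "x = y")
  case False
  obtain L where L: "L-lipschitz_on (closure \<Omega>) u" using u unfolding Lip_def by blast
  have cont: "continuous_on (closure \<Omega>) u" using L by (rule lipschitz_on_continuous_on)
  define a where "a k = x + (1 / real (k + 2)) *\<^sub>R (y - x)" for k
  define b where "b k = y + (1 / real (k + 2)) *\<^sub>R (x - y)" for k
  have ab: "a k \<in> open_segment x y" "b k \<in> open_segment x y" for k
  proof -
    show "a k \<in> open_segment x y"
      unfolding in_segment using False
      by (intro conjI exI[of _ "1 / real (k + 2)"]) (auto simp: a_def algebra_simps)
    have "b k \<in> open_segment y x"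
      unfolding in_segment using False
      by (intro conjI exI[of _ "1 / real (k + 2)"]) (auto simp: b_def algebra_simps)
    then show "b k \<in> open_segment x y" by (simp add: open_segment_commute)
  qed
  have le: "\<bar>u (a k) - u (b k)\<bar> \<le> dist (a k) (b k)" for k
  proof -
    have "closed_segment (a k) (b k) \<subseteq> open_segment x y"
      using ab by (intro closed_segment_subset convex_open_segment)
    then show ?thesis using seg by (intro grad_le_1_imp_increment_le_closed_segment[OF \<Omega> L grad]) auto
  qed
  have lim0: "(\<lambda>k. 1 / real (k + 2)) \<longlonglongrightarrow> 0"
    using LIMSEQ_ignore_initial_segment[OF lim_1_over_n, of 2] by simp
  have "a \<longlonglongrightarrow> x + 0 *\<^sub>R (y - x)" "b \<longlonglongrightarrow> y + 0 *\<^sub>R (x - y)"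
    unfolding a_def b_def by (intro tendsto_intros lim0)+
  then have lim: "a \<longlonglongrightarrow> x" "b \<longlonglongrightarrow> y" by simp_all
  have "(\<lambda>k. u (a k)) \<longlonglongrightarrow> u x" "(\<lambda>k. u (b k)) \<longlonglongrightarrow> u y"
    by (rule continuous_on_tendsto_compose[OF cont], (rule lim xy)+,
        use ab seg closure_subset in \<open>force intro!: always_eventually\<close>)+
  then show ?thesis
    using le lim
    by (intro LIMSEQ_le[where X = "\<lambda>k. \<bar>u (a k) - u (b k)\<bar>" and Y = "\<lambda>k. dist (a k) (b k)"])
       (auto intro!: tendsto_intros)
qed simp

lemma ball_infdist_frontier_subset:
  fixes \<Omega> :: "'a::euclidean_space set"
  assumes x: "x \<in> \<Omega>" and fr: "frontier \<Omega> \<noteq> {}"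
  shows "ball x (infdist x (frontier \<Omega>)) \<subseteq> \<Omega>"
proof (rule ccontr)
  assume nsub: "\<not> ball x (infdist x (frontier \<Omega>)) \<subseteq> \<Omega>"
  then have "0 < infdist x (frontier \<Omega>)" by (metis ball_eq_empty empty_subsetI not_less)
  then have "ball x (infdist x (frontier \<Omega>)) \<inter> frontier \<Omega> \<noteq> {}"
    using nsub x by (intro connected_Int_frontier) (auto simp: disjoint_iff intro!: bexI[of _ x])
  then obtain y where "y \<in> frontier \<Omega>" "dist x y < infdist x (frontier \<Omega>)" by auto
  then show False using infdist_le[of y "frontier \<Omega>" x] by simp
qed

lemma frontier_bounded_ne:
  fixes \<Omega> :: "'a::euclidean_space set"
  assumes "open \<Omega>" "bounded \<Omega>" "\<Omega> \<noteq> {}"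
  shows "frontier \<Omega> \<noteq> {}"
  using assms by (metis frontier_eq_empty not_bounded_UNIV)

text \<open>
  The property shared by the Kantorovich--Rubinstein test functions and by the functions
  \<open>x \<mapsto> f (\<iota> \<delta>\<^sub>x)\<close> for functionals \<open>f\<close> of norm at most 1. For a domain that is not convex it can be weaker than
  being 1-Lipschitz on \<open>closure \<Omega>\<close>.
\<close>

definition segment_Lipschitz :: "'a::euclidean_space set \<Rightarrow> ('a \<Rightarrow> real) \<Rightarrow> bool" where
  "segment_Lipschitz \<Omega> u \<longleftrightarrow>
     (\<forall>x\<in>closure \<Omega>. \<forall>y\<in>closure \<Omega>. open_segment x y \<subseteq> \<Omega> \<longrightarrow> \<bar>u x - u y\<bar> \<le> dist x y)"

text \<open>
  The segment from a point of \<open>\<Omega>\<close> to a nearest boundary point stays in \<open>\<Omega>\<close> until it ends.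
\<close>

lemma abs_le_infdist_frontier:
  fixes u :: "'a::euclidean_space \<Rightarrow> real"
  assumes \<Omega>: "open \<Omega>" "bounded \<Omega>" "\<Omega> \<noteq> {}" and u: "segment_Lipschitz \<Omega> u"
    and zero: "\<And>x. x \<in> frontier \<Omega> \<Longrightarrow> u x = 0" and x: "x \<in> closure \<Omega>"
  shows "\<bar>u x\<bar> \<le> infdist x (frontier \<Omega>)"
proof (cases "x \<in> \<Omega>")
  case False
  then show ?thesis using x \<Omega>(1) zero infdist_nonneg by (simp add: frontier_def interior_open)
next
  case True
  obtain y where y: "y \<in> frontier \<Omega>" "infdist x (frontier \<Omega>) = dist x y"
    using infdist_attains_inf[OF frontier_closed frontier_bounded_ne[OF \<Omega>]] by metis
  have "open_segment x y \<subseteq> ball x (dist x y)"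
  proof
    fix z assume "z \<in> open_segment x y"
    from dist_decreases_open_segment[OF this, of x] show "z \<in> ball x (dist x y)"
      using dist_in_open_segment[OF \<open>z \<in> open_segment x y\<close>] by (simp add: dist_commute)
  qed
  then have "open_segment x y \<subseteq> \<Omega>"
    using ball_infdist_frontier_subset[OF True frontier_bounded_ne[OF \<Omega>]] y(2) by auto
  moreover have "y \<in> closure \<Omega>" using y(1) by (simp add: frontier_def)
  ultimately have "\<bar>u x - u y\<bar> \<le> dist x y" using u x unfolding segment_Lipschitz_def by blast
  then show ?thesis using zero[OF y(1)] y(2) by simp
qed

text \<open>
  Let \<open>z \<notin> \<Omega>\<close> lie on the segment from \<open>x\<close> to \<open>y\<close>. The distance of \<open>x\<close> to the boundary is at most
  \<open>dist x z\<close>, and likewise for \<open>y\<close>, so \<open>\<bar>u x\<bar> + \<bar>u y\<bar> \<le> dist x z + dist z y = dist x y\<close>. Thus the zero boundary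
  values compensate for a bad shape of \<open>\<Omega>\<close>.
\<close>

lemma segment_Lipschitz_imp_Lipschitz:
  fixes u :: "'a::euclidean_space \<Rightarrow> real"
  assumes \<Omega>: "open \<Omega>" "bounded \<Omega>" "\<Omega> \<noteq> {}" and u: "segment_Lipschitz \<Omega> u"
    and zero: "\<And>x. x \<in> frontier \<Omega> \<Longrightarrow> u x = 0"
  shows "1-lipschitz_on (closure \<Omega>) u"
proof (rule lipschitz_onI)
  fix x y assume xy: "x \<in> closure \<Omega>" "y \<in> closure \<Omega>"
  have le: "\<bar>u w\<bar> \<le> dist w z" if w: "w \<in> closure \<Omega>" and z: "z \<notin> \<Omega>" for w z
  proof -
    have "infdist w (frontier \<Omega>) \<le> dist w z"
    proof (cases "w \<in> \<Omega>")
      case True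
      then show ?thesis
        using ball_infdist_frontier_subset[OF True frontier_bounded_ne[OF \<Omega>]] z
        by (meson in_mono mem_ball not_less)
    next
      case False
      then show ?thesis using w \<Omega>(1) by (simp add: frontier_def interior_open)
    qed
    then show ?thesis
      using abs_le_infdist_frontier[OF \<Omega> u zero w] by linarith
  qed
  show "dist (u x) (u y) \<le> 1 * dist x y"
  proof (cases "open_segment x y \<subseteq> \<Omega>")
    case True
    then show ?thesis using u xy by (simp add: segment_Lipschitz_def dist_real_def)
  next
    case False
    then obtain z where z: "z \<in> open_segment x y" "z \<notin> \<Omega>" by blast
    then have "dist x y = dist x z + dist y z"
      using between[of x y z] by (simp add: between_mem_segment open_closed_segment dist_commute)
    then show ?thesis
      using le[OF xy(1) z(2)] le[OF xy(2) z(2)] by (simp add: dist_real_def)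
  qed
qed simp

lemma Lip_grad_le_1_imp_segment_Lipschitz:
  assumes "open \<Omega>" "u \<in> Lip (closure \<Omega>)" "grad_le_1 \<Omega> u"
  shows "segment_Lipschitz \<Omega> u"
  unfolding segment_Lipschitz_def
  using grad_le_1_imp_increment_le_open_segment[OF assms] by blast

lemma Lip0_abs_le_inradius:
  fixes u :: "'a::euclidean_space \<Rightarrow> real"
  assumes \<Omega>: "open \<Omega>" "bounded \<Omega>" "\<Omega> \<noteq> {}" and u: "u \<in> Lip0 \<Omega>" "grad_le_1 \<Omega> u"
    and x: "x \<in> closure \<Omega>"
  shows "\<bar>u x\<bar> \<le> inradius \<Omega>"
proof -
  obtain a where a: "a \<in> frontier \<Omega>" using frontier_bounded_ne[OF \<Omega>] by blast
  obtain R where R: "\<And>y. y \<in> \<Omega> \<Longrightarrow> dist a y \<le> R" using \<Omega>(2) unfolding bounded_any_center[of _ a] by blast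
  have bdd: "bdd_above ((\<lambda>x. infdist x (frontier \<Omega>)) ` \<Omega>)"
    by (rule bdd_aboveI2[of _ _ R]) (metis R a dist_commute infdist_le order_trans)
  have in_le: "infdist y (frontier \<Omega>) \<le> inradius \<Omega>" if "y \<in> \<Omega>" for y
    unfolding inradius_def using bdd that by (rule cSUP_upper2) simp
  have "\<bar>u x\<bar> \<le> infdist x (frontier \<Omega>)"
    by (rule abs_le_infdist_frontier[OF \<Omega>])
       (use u x Lip_grad_le_1_imp_segment_Lipschitz[OF \<Omega>(1)] in \<open>auto simp: Lip0_def\<close>)
  also have "\<dots> \<le> inradius \<Omega>"
  proof (cases "x \<in> \<Omega>")
    case False
    then have "infdist x (frontier \<Omega>) = 0" using x \<Omega>(1) by (simp add: frontier_def interior_open)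
    moreover obtain y where "y \<in> \<Omega>" using \<Omega>(3) by blast
    ultimately show ?thesis using in_le[of y] infdist_nonneg[of y "frontier \<Omega>"] by simp
  qed (rule in_le)
  finally show ?thesis .
qed

section \<open>Smooth approximation of Lipschitz functions\<close>

lemma differentiable_1_Lipschitz_imp_GDERIV:
  fixes w :: "'a::euclidean_space \<Rightarrow> real"
  assumes lip: "\<And>y z. \<bar>w y - w z\<bar> \<le> dist y z" and diff: "w differentiable (at x)"
  shows "\<exists>g. (GDERIV w x :> g) \<and> norm g \<le> 1"
proof -
  obtain D where D: "(w has_derivative D) (at x)" using diff unfolding differentiable_def by blast
  define g where "g = adjoint D 1"
  have Dg: "D h = inner h g" for h
    using adjoint_works[OF has_derivative_linear[OF D], of h 1] by (simp add: g_def)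
  then have D_eq: "D = (\<lambda>h. inner h g)" by blast
  have wx: "(w has_derivative (\<lambda>h. inner h g)) (at (x + 0 *\<^sub>R g))" using D D_eq by simp
  have "((\<lambda>h. x + h *\<^sub>R g) has_derivative (\<lambda>h. h *\<^sub>R g)) (at 0)"
    by (auto intro!: derivative_eq_intros)
  from has_derivative_compose[OF this wx]
  have "((\<lambda>h. w (x + h *\<^sub>R g)) has_real_derivative inner g g) (at 0)"
    by (simp add: has_field_derivative_def mult_commute_abs)
  then have "((\<lambda>h. (w (x + h *\<^sub>R g) - w x) / h) \<longlongrightarrow> inner g g) (at 0)"
    by (simp add: has_field_derivative_iff)
  moreover have "(w (x + h *\<^sub>R g) - w x) / h \<le> norm g" if "h \<noteq> 0" for h
  proof -
    have "\<bar>w (x + h *\<^sub>R g) - w x\<bar> \<le> norm g * \<bar>h\<bar>"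
      using lip[of "x + h *\<^sub>R g" x] by (simp add: dist_norm mult.commute)
    then have "\<bar>(w (x + h *\<^sub>R g) - w x) / h\<bar> \<le> norm g"
      using that by (simp add: abs_divide pos_divide_le_eq)
    then show ?thesis by linarith
  qed
  ultimately have "inner g g \<le> norm g"
    by (intro tendsto_upperbound[where F = "at (0::real)"]) (auto simp: eventually_at_filter)
  then have "norm g * norm g \<le> norm g * 1" by (simp add: power2_norm_eq_inner[symmetric] power2_eq_square)
  then have "norm g \<le> 1" by (cases "g = 0") (auto simp: mult_le_cancel_left)
  then show ?thesis using D D_eq by (auto simp: gderiv_def)
qed

lemma GDERIV_le_1_imp_Lipschitz:
  fixes w :: "'a::euclidean_space \<Rightarrow> real"
  assumes "\<And>x. \<exists>g. (GDERIV w x :> g) \<and> norm g \<le> 1"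
  shows "1-lipschitz_on S w"
proof (rule lipschitz_onI)
  obtain g where g: "\<And>x. GDERIV w x :> g x" "\<And>x. norm (g x) \<le> 1" using assms by metis
  fix x y
  have "norm (w x - w y) \<le> 1 * norm (x - y)"
  proof (rule differentiable_bound[where S = UNIV])
    fix z show "(w has_derivative (\<lambda>h. inner h (g z))) (at z within UNIV)"
      using g(1) by (simp add: gderiv_def)
    show "onorm (\<lambda>h. inner h (g z)) \<le> 1"
    proof (rule onorm_le)
      fix h show "norm (inner h (g z)) \<le> 1 * norm h"
        using Cauchy_Schwarz_ineq2[of h "g z"] mult_left_mono[OF g(2)[of z], of "norm h"] by simp
    qed
  qed auto
  then show "dist (w x) (w y) \<le> 1 * dist x y" by (simp add: dist_norm)
qed simp

text \<open>
  The smooth minimum: a differentiable substitute for the minimum of finitely many numbers, which is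
  monotone and commutes with adding a constant, and hence is nonexpansive for the maximum
  distance.
\<close>

definition softmin :: "real \<Rightarrow> 'i set \<Rightarrow> ('i \<Rightarrow> real) \<Rightarrow> real" where
  "softmin e I t = - e * ln (\<Sum>i\<in>I. exp (- t i / e))"

lemma
  assumes e: "0 < e" and I: "finite I" "I \<noteq> {}"
  shows softmin_le: "i \<in> I \<Longrightarrow> softmin e I t \<le> t i"
    and softmin_ge: "(\<And>i. i \<in> I \<Longrightarrow> a \<le> t i) \<Longrightarrow> a - e * ln (card I) \<le> softmin e I t"
    and softmin_nonexpansive:
      "(\<And>i. i \<in> I \<Longrightarrow> \<bar>t i - s i\<bar> \<le> d) \<Longrightarrow> \<bar>softmin e I t - softmin e I s\<bar> \<le> d"
proof -
  have pos: "0 < (\<Sum>i\<in>I. exp (- t i / e))" for t :: "'a \<Rightarrow> real"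
    using I by (intro sum_pos) auto
  show "softmin e I t \<le> t i" if "i \<in> I"
  proof -
    have "exp (- t i / e) \<le> (\<Sum>i\<in>I. exp (- t i / e))"
      using that I by (intro member_le_sum) auto
    then have "- t i / e \<le> ln (\<Sum>i\<in>I. exp (- t i / e))"
      using pos[of t] by (simp add: ln_ge_iff)
    then show ?thesis using e by (simp add: softmin_def field_simps)
  qed
  show "a - e * ln (card I) \<le> softmin e I t" if "\<And>i. i \<in> I \<Longrightarrow> a \<le> t i"
  proof -
    have "(\<Sum>i\<in>I. exp (- t i / e)) \<le> (\<Sum>i\<in>I. exp (- a / e))"
      using that e by (intro sum_mono) (auto simp: divide_right_mono)
    also have "\<dots> = exp (ln (card I) - a / e)"
      using I by (simp add: exp_diff exp_minus field_simps card_gt_0_iff)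
    finally have "ln (\<Sum>i\<in>I. exp (- t i / e)) \<le> ln (card I) - a / e"
      using pos[of t] by (metis ln_exp ln_mono exp_gt_zero)
    then show ?thesis using e by (simp add: softmin_def field_simps)
  qed
  have le: "softmin e I t \<le> softmin e I s + d" if "\<And>i. i \<in> I \<Longrightarrow> \<bar>t i - s i\<bar> \<le> d" for s t d
  proof -
    have "(\<Sum>i\<in>I. exp (- s i / e)) \<le> (\<Sum>i\<in>I. exp (d / e) * exp (- t i / e))"
    proof (rule sum_mono)
      fix i assume "i \<in> I"
      then have "- s i \<le> d + - t i" using that by force
      then have "- s i / e \<le> d / e + - t i / e"
        using e by (metis add_divide_distrib divide_right_mono less_imp_le)
      then show "exp (- s i / e) \<le> exp (d / e) * exp (- t i / e)"
        by (simp add: exp_add[symmetric])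
    qed
    also have "\<dots> = exp (d / e) * (\<Sum>i\<in>I. exp (- t i / e))" by (simp add: sum_distrib_left)
    finally have "ln (\<Sum>i\<in>I. exp (- s i / e)) \<le> ln (exp (d / e) * (\<Sum>i\<in>I. exp (- t i / e)))"
      using pos[of s] by (intro ln_mono)
    also have "\<dots> = d / e + ln (\<Sum>i\<in>I. exp (- t i / e))"
      using pos[of t] by (subst ln_mult) auto
    finally show ?thesis using e by (simp add: softmin_def field_simps)
  qed
  show "\<bar>softmin e I t - softmin e I s\<bar> \<le> d" if "\<And>i. i \<in> I \<Longrightarrow> \<bar>t i - s i\<bar> \<le> d"
    using le[of t s d] le[of s t d] that by (simp add: abs_le_iff abs_minus_commute)
qed

lemma differentiable_softmin:
  fixes f :: "'i \<Rightarrow> 'a::real_normed_vector \<Rightarrow> real"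
  assumes I: "finite I" "I \<noteq> {}" and f: "\<And>i. i \<in> I \<Longrightarrow> f i differentiable (at x)"
  shows "(\<lambda>x. softmin e I (\<lambda>i. f i x)) differentiable (at x)"
proof -
  obtain D where D: "\<And>i. i \<in> I \<Longrightarrow> (f i has_derivative D i) (at x)"
    using f unfolding differentiable_def by metis
  have pos: "0 < (\<Sum>i\<in>I. exp (- f i x / e))"
    using I by (intro sum_pos) auto
  have "((\<lambda>x. \<Sum>i\<in>I. exp (- f i x / e)) has_derivative (\<lambda>h. \<Sum>i\<in>I. exp (- f i x / e) * (- D i h / e))) (at x)"
  proof (rule has_derivative_sum)
    fix i assume i: "i \<in> I"
    have "((\<lambda>x. - f i x / e) has_derivative (\<lambda>h. - D i h / e)) (at x)"
      using has_derivative_mult_right[OF has_derivative_minus[OF D[OF i]], of "inverse e"]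
      by (simp add: divide_inverse mult.commute)
    then show "((\<lambda>x. exp (- f i x / e)) has_derivative (\<lambda>h. exp (- f i x / e) * (- D i h / e))) (at x)"
      by (rule has_derivative_exp[THEN has_derivative_eq_rhs]) (simp add: fun_eq_iff)
  qed
  from has_derivative_mult_right[OF has_derivative_ln[OF pos this], of "- e"] show ?thesis
    unfolding softmin_def differentiable_def by (intro exI)
qed

lemma DERIV_square_positive_part: "((\<lambda>s::real. (max s 0)\<^sup>2) has_real_derivative 2 * max s 0) (at s)"
proof -
  consider "0 < s" | "s < 0" | "s = 0" by linarith
  then show ?thesis
  proof cases
    case 1
    have "((\<lambda>s::real. s\<^sup>2) has_real_derivative 2 * max s 0) (at s)"
      using 1 by (auto intro!: derivative_eq_intros)
    then show ?thesis
      by (rule has_field_derivative_transform_within[where d = s]) (use 1 in \<open>auto simp: dist_real_def max_def\<close>)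
  next
    case 2
    have "((\<lambda>s::real. 0) has_real_derivative 2 * max s 0) (at s)"
      using 2 by (auto intro!: derivative_eq_intros)
    then show ?thesis
      by (rule has_field_derivative_transform_within[where d = "- s"]) (use 2 in \<open>auto simp: dist_real_def max_def\<close>)
  next
    case 3
    have "((\<lambda>h::real. (max h 0)\<^sup>2 / h) \<longlongrightarrow> 0) (at 0)"
    proof (rule Lim_null_comparison)
      show "\<forall>\<^sub>F h in at 0. norm ((max h 0)\<^sup>2 / h) \<le> \<bar>h :: real\<bar>"
        by (auto simp: max_def power2_eq_square intro!: always_eventually)
    qed (auto intro!: tendsto_eq_intros)
    then show ?thesis using 3 by (simp add: has_field_derivative_iff)
  qed
qed

text \<open>
  A \<open>C\<^sup>1\<close> substitute for the positive part that vanishes up to \<open>\<eta>\<close>. The odd function \<open>soft_cut \<eta>\<close>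
  below, made of two copies of it, sends small values to 0, is 1-Lipschitz, and moves every number by
  at most \<open>2 * \<eta>\<close>.
\<close>

definition soft_pos :: "real \<Rightarrow> real \<Rightarrow> real" where
  "soft_pos \<eta> s = sqrt ((max (s - \<eta>) 0)\<^sup>2 + \<eta>\<^sup>2) - \<eta>"

lemma
  assumes "0 < \<eta>"
  shows soft_pos_eq_0: "s \<le> \<eta> \<Longrightarrow> soft_pos \<eta> s = 0"
    and soft_pos_bounds: "0 \<le> s \<Longrightarrow> s - 2 * \<eta> \<le> soft_pos \<eta> s" "0 \<le> s \<Longrightarrow> soft_pos \<eta> s \<le> s"
    and DERIV_soft_pos: "\<exists>D. (soft_pos \<eta> has_real_derivative D) (at s) \<and> 0 \<le> D \<and> D \<le> 1 \<and> (s \<le> \<eta> \<longrightarrow> D = 0)"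
proof -
  define m where "m = max (s - \<eta>) 0"
  have m: "0 \<le> m" by (simp add: m_def)
  have le: "m \<le> sqrt (m\<^sup>2 + \<eta>\<^sup>2)" by (rule real_le_rsqrt) simp
  have pos: "0 < m\<^sup>2 + \<eta>\<^sup>2" using assms by (simp add: add_nonneg_pos)
  show "s \<le> \<eta> \<Longrightarrow> soft_pos \<eta> s = 0"
    using assms by (simp add: soft_pos_def)
  show "0 \<le> s \<Longrightarrow> s - 2 * \<eta> \<le> soft_pos \<eta> s"
    using le unfolding soft_pos_def m_def by linarith
  show "soft_pos \<eta> s \<le> s" if "0 \<le> s"
  proof -
    have "sqrt (m\<^sup>2 + \<eta>\<^sup>2) \<le> m + \<eta>" using m assms by (intro real_le_lsqrt) (auto simp: power2_sum)
    then show ?thesis using that assms by (auto simp: soft_pos_def m_def max_def split: if_splits)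
  qed
  define D where "D = m / sqrt (m\<^sup>2 + \<eta>\<^sup>2)"
  have "((\<lambda>s. (max (s - \<eta>) 0)\<^sup>2) has_real_derivative 2 * m * 1) (at s)"
    unfolding m_def
    by (rule DERIV_chain2[OF DERIV_square_positive_part]) (auto intro!: derivative_eq_intros)
  from DERIV_add[OF this DERIV_const[of "\<eta>\<^sup>2"]]
  have "((\<lambda>s. (max (s - \<eta>) 0)\<^sup>2 + \<eta>\<^sup>2) has_real_derivative 2 * m) (at s)" by simp
  from DERIV_chain2[OF DERIV_real_sqrt this] pos
  have "((\<lambda>s. sqrt ((max (s - \<eta>) 0)\<^sup>2 + \<eta>\<^sup>2)) has_real_derivative D) (at s)"
    by (simp add: D_def m_def[symmetric] field_simps)
  from DERIV_diff[OF this DERIV_const[of \<eta>]] have "(soft_pos \<eta> has_real_derivative D) (at s)"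
    unfolding soft_pos_def by simp
  moreover have "0 \<le> D" "D \<le> 1" using m le pos by (auto simp: D_def)
  moreover have "s \<le> \<eta> \<longrightarrow> D = 0" by (simp add: D_def m_def)
  ultimately show "\<exists>D. (soft_pos \<eta> has_real_derivative D) (at s) \<and> 0 \<le> D \<and> D \<le> 1 \<and> (s \<le> \<eta> \<longrightarrow> D = 0)"
    by blast
qed

definition soft_cut :: "real \<Rightarrow> real \<Rightarrow> real" where
  "soft_cut \<eta> t = soft_pos \<eta> t - soft_pos \<eta> (- t)"

lemma
  assumes \<eta>: "0 < \<eta>"
  shows soft_cut_eq_0: "\<bar>t\<bar> \<le> \<eta> \<Longrightarrow> soft_cut \<eta> t = 0"
    and soft_cut_near: "\<bar>soft_cut \<eta> t - t\<bar> \<le> 2 * \<eta>"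
    and DERIV_soft_cut: "\<exists>D. (soft_cut \<eta> has_real_derivative D) (at t) \<and> \<bar>D\<bar> \<le> 1"
proof -
  show "\<bar>t\<bar> \<le> \<eta> \<Longrightarrow> soft_cut \<eta> t = 0"
    using \<eta> by (simp add: soft_cut_def soft_pos_eq_0)
  show "\<bar>soft_cut \<eta> t - t\<bar> \<le> 2 * \<eta>"
    using \<eta> soft_pos_bounds[OF \<eta>, of t] soft_pos_bounds[OF \<eta>, of "- t"]
      soft_pos_eq_0[OF \<eta>, of t] soft_pos_eq_0[OF \<eta>, of "- t"]
    by (cases "0 \<le> t") (auto simp: soft_cut_def)
  obtain D E where
    D: "(soft_pos \<eta> has_real_derivative D) (at t)" "0 \<le> D" "D \<le> 1" "t \<le> \<eta> \<longrightarrow> D = 0" and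
    E: "(soft_pos \<eta> has_real_derivative E) (at (- t))" "0 \<le> E" "E \<le> 1" "- t \<le> \<eta> \<longrightarrow> E = 0"
    using DERIV_soft_pos[OF \<eta>, of t] DERIV_soft_pos[OF \<eta>, of "- t"] by blast
  have "((\<lambda>t. soft_pos \<eta> (- t)) has_real_derivative E * (- 1)) (at t)"
    by (rule DERIV_chain2[where f = "soft_pos \<eta>" and g = uminus, OF E(1)]) (auto intro!: derivative_eq_intros)
  from DERIV_diff[OF D(1) this] have "(soft_cut \<eta> has_real_derivative D + E) (at t)"
    unfolding soft_cut_def by simp
  moreover have "\<bar>D + E\<bar> \<le> 1"
    using D E \<eta> by (cases "t \<le> \<eta>") auto
  ultimately show "\<exists>D. (soft_cut \<eta> has_real_derivative D) (at t) \<and> \<bar>D\<bar> \<le> 1" by blast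
qed

text \<open>
  McShane's formula represents \<open>u x\<close> as the minimum of \<open>u p + dist x p\<close> over \<open>p \<in> K\<close>. Three changes make it
  smooth at the price of an error of order \<open>r\<close>: \<open>p\<close> runs through a finite net, the distance is
  replaced by the smooth function \<open>norm (x - p, r)\<close>, and the minimum becomes a smooth minimum. None
  of them increases the Lipschitz constant.
\<close>

lemma smooth_Lipschitz_approximation:
  fixes u :: "'a::euclidean_space \<Rightarrow> real"
  assumes K: "compact K" and u: "1-lipschitz_on K u" and r: "0 < r"
  shows "\<exists>s. (\<forall>x. \<exists>g. (GDERIV s x :> g) \<and> norm g \<le> 1) \<and> (\<forall>x\<in>K. \<bar>s x - u x\<bar> \<le> 3 * r)"
proof (cases "K = {}")
  case True
  have "\<exists>g. (GDERIV (\<lambda>_. 0) x :> g) \<and> norm g \<le> 1" for x :: 'a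
    by (intro exI[of _ 0] conjI GDERIV_const) simp
  then show ?thesis using True by (intro exI[of _ "\<lambda>_. 0"]) simp
next
  case False
  obtain F where F: "finite F" "F \<subseteq> K" "K \<subseteq> (\<Union>p\<in>F. ball p r)"
    using seq_compact_imp_totally_bounded[OF compact_imp_seq_compact[OF K]] r by meson
  have F_ne: "F \<noteq> {}" using False F(3) by blast
  define f where "f p x = u p + norm (x - p, r)" for p x
  have f_lip: "\<bar>f p x - f p y\<bar> \<le> dist x y" for p x y
    using norm_triangle_ineq3[of "(x - p, r)" "(y - p, r)"] by (simp add: f_def dist_norm norm_Pair)
  have f_diff: "f p differentiable (at x)" for p x
  proof -
    have "((\<lambda>x. (x - p, r)) has_derivative (\<lambda>h. (h - 0, 0))) (at x)"
      by (intro has_derivative_Pair has_derivative_diff has_derivative_ident has_derivative_const)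
    then have pair: "(\<lambda>x. (x - p, r)) differentiable (at x)" unfolding differentiable_def by blast
    have "norm differentiable (at (x - p, r))"
      using r by (intro differentiable_norm_at) (simp add: zero_prod_def)
    from differentiable_compose[OF this pair] show ?thesis unfolding f_def by (rule differentiable_add[OF differentiable_const])
  qed
  have u_le: "\<bar>u x - u y\<bar> \<le> dist x y" if "x \<in> K" "y \<in> K" for x y
    using lipschitz_onD[OF u that] by (simp add: dist_real_def)
  \<comment> \<open>chosen so that the smooth minimum is within \<open>r\<close> of the minimum\<close>
  define e where "e = r / (1 + ln (card F))"
  have ln_card: "0 \<le> ln (card F)" using F(1) F_ne by (simp add: Suc_leI card_gt_0_iff)
  then have e: "0 < e" using r by (simp add: e_def)
  have "e * (1 + ln (card F)) = r" using ln_card by (simp add: e_def)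
  then have e_ln: "e * ln (card F) \<le> r" using e by (simp add: algebra_simps)
  define s where "s x = softmin e F (\<lambda>p. f p x)" for x
  have "\<exists>g. (GDERIV s x :> g) \<and> norm g \<le> 1" for x
  proof (rule differentiable_1_Lipschitz_imp_GDERIV)
    show "\<bar>s y - s z\<bar> \<le> dist y z" for y z
      unfolding s_def by (rule softmin_nonexpansive[OF e F(1) F_ne f_lip])
    show "s differentiable (at x)"
      using differentiable_softmin[OF F(1) F_ne f_diff] by (simp add: s_def[abs_def])
  qed
  moreover have "\<bar>s x - u x\<bar> \<le> 3 * r" if x: "x \<in> K" for x
  proof -
    have "u x \<le> f p x" if "p \<in> F" for p
      using u_le[of x p] x that F(2) norm_fst_le[of "x - p" r] by (auto simp: f_def dist_norm)
    then have lower: "u x - e * ln (card F) \<le> s x"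
      unfolding s_def by (rule softmin_ge[OF e F(1) F_ne])
    obtain p where p: "p \<in> F" "dist p x < r" using x F(3) by auto
    have "\<bar>u p - u x\<bar> \<le> dist x p" using u_le[of p x] x p(1) F(2) by (auto simp: dist_commute)
    moreover have "norm (x - p, r) \<le> dist x p + r"
      using norm_Pair_le[of "x - p" r] r by (simp add: dist_norm)
    ultimately have "f p x \<le> u x + 3 * r"
      using p(2) by (simp add: f_def dist_commute)
    moreover have "s x \<le> f p x"
      unfolding s_def by (rule softmin_le[OF e F(1) F_ne p(1)])
    ultimately show ?thesis using lower e_ln r by linarith
  qed
  ultimately show ?thesis by blast
qed

text \<open>
  On the boundary the smooth approximation is small but not zero; \<open>soft_cut\<close> makes it vanish there
  without increasing the gradient.
\<close>

lemma Lip0_approximation: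
  fixes u :: "'a::euclidean_space \<Rightarrow> real"
  assumes \<Omega>: "bounded \<Omega>" and u: "1-lipschitz_on (closure \<Omega>) u"
    and zero: "\<And>x. x \<in> frontier \<Omega> \<Longrightarrow> u x = 0" and \<eta>: "0 < \<eta>"
  shows "\<exists>w\<in>Lip0 \<Omega>. grad_le_1 \<Omega> w \<and> (\<forall>x\<in>closure \<Omega>. \<bar>w x - u x\<bar> \<le> \<eta>)"
proof -
  define r where "r = \<eta> / 9"
  have r: "0 < r" "0 < 3 * r" using \<eta> by (auto simp: r_def)
  obtain s where s: "\<And>x. \<exists>g. (GDERIV s x :> g) \<and> norm g \<le> 1"
    "\<And>x. x \<in> closure \<Omega> \<Longrightarrow> \<bar>s x - u x\<bar> \<le> 3 * r"
    using smooth_Lipschitz_approximation[OF compact_closure[THEN iffD2, OF \<Omega>] u r(1)] by blast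
  define w where "w x = soft_cut (3 * r) (s x)" for x
  have w_grad: "\<exists>g. (GDERIV w x :> g) \<and> norm g \<le> 1" for x
  proof -
    obtain g where g: "GDERIV s x :> g" "norm g \<le> 1" using s(1) by blast
    obtain D where D: "(soft_cut (3 * r) has_real_derivative D) (at (s x))" "\<bar>D\<bar> \<le> 1"
      using DERIV_soft_cut[OF r(2)] by blast
    have "\<bar>D\<bar> * norm g \<le> 1 * 1" using g(2) D(2) by (intro mult_mono) auto
    then show ?thesis
      using GDERIV_DERIV_compose[OF g(1) D(1)] by (intro exI[of _ "D *\<^sub>R g"]) (simp add: w_def[abs_def])
  qed
  have "w \<in> Lip0 \<Omega>"
    unfolding Lip0_def Lip_def
  proof (intro CollectI conjI ballI exI)
    show "1-lipschitz_on (closure \<Omega>) w" by (rule GDERIV_le_1_imp_Lipschitz[OF w_grad])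
    fix x assume x: "x \<in> frontier \<Omega>"
    then have "\<bar>s x\<bar> \<le> 3 * r" using s(2)[of x] zero[OF x] by (simp add: frontier_def)
    then show "w x = 0" unfolding w_def by (rule soft_cut_eq_0[OF r(2)])
  qed
  moreover have "grad_le_1 \<Omega> w" unfolding grad_le_1_def using w_grad by simp
  moreover have "\<bar>w x - u x\<bar> \<le> \<eta>" if "x \<in> closure \<Omega>" for x
    using s(2)[OF that] soft_cut_near[OF r(2), of "s x"] unfolding w_def r_def by linarith
  ultimately show ?thesis by blast
qed

section \<open>Signed measures and point masses\<close>

lemma signed_measure_eqI:
  assumes "\<And>A. A \<in> sets borel \<Longrightarrow> mass \<mu> A = mass \<nu> A"
  shows "\<mu> = \<nu>"
proof -
  have "mass \<mu> A = mass \<nu> A" for A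
    using assms[of A] mass_nonborel[of A] by (cases "A \<in> sets borel") auto
  then show ?thesis by (metis ext mass_inject)
qed

lift_definition dirac :: "'a::topological_space \<Rightarrow> 'a signed_measure" is "\<lambda>x. measure (return borel x)"
proof (intro CollectI conjI allI impI)
  fix x :: 'a and A :: "nat \<Rightarrow> 'a set"
  interpret prob_space "return borel x" by (rule prob_space_return) simp
  show "(\<lambda>i. measure (return borel x) (A i)) sums measure (return borel x) (\<Union>i. A i)"
    if "range A \<subseteq> sets borel" "disjoint_family A"
    using that by (intro finite_measure_UNION) auto
qed (simp add: measure_notin_sets)

lift_definition restrict_sm :: "'a::topological_space set \<Rightarrow> 'a signed_measure \<Rightarrow> 'a signed_measure"
  is "\<lambda>S \<sigma> A. if S \<in> sets borel \<and> A \<in> sets borel then \<sigma> (A \<inter> S) else 0"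
proof (intro CollectI conjI allI impI, goal_cases)
  case (2 S \<sigma> A)
  show ?case
  proof (cases "S \<in> sets borel")
    case True
    have "range (\<lambda>i. A i \<inter> S) \<subseteq> sets borel" using 2(2) True by auto
    moreover have "disjoint_family (\<lambda>i. A i \<inter> S)"
      using 2(3) by (rule disjoint_family_on_bisimulation) auto
    ultimately have "(\<lambda>i. \<sigma> (A i \<inter> S)) sums \<sigma> (\<Union>i. A i \<inter> S)" using 2(1) by blast
    moreover have "(\<Union>i. A i) \<in> sets borel" using 2(2) by auto
    ultimately show ?thesis using True 2(2) by (simp add: range_subsetD)
  qed simp
qed simp

lemma mass_dirac: "A \<in> sets borel \<Longrightarrow> mass (dirac x) A = indicator A x"
  by transfer (simp add: measure_return)

lemma mass_restrict_sm: "S \<in> sets borel \<Longrightarrow> A \<in> sets borel \<Longrightarrow> mass (restrict_sm S \<mu>) A = mass \<mu> (A \<inter> S)"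
  by transfer simp

lemma mass_zero [simp]: "mass 0 A = 0"
  by transfer simp

lemma dirac_in: "x \<in> X \<Longrightarrow> dirac x \<in> signed_measures_on X"
  by (auto simp: signed_measures_on_def mass_dirac indicator_def)

lemma subspace_signed_measures_on: "subspace (signed_measures_on X)"
  by (auto simp: subspace_def signed_measures_on_def)

lemma signed_measures_on_mono: "X \<subseteq> Y \<Longrightarrow> signed_measures_on X \<subseteq> signed_measures_on Y"
  by (auto simp: signed_measures_on_def)

lemma restrict_sm_in:
  "S \<in> sets borel \<Longrightarrow> restrict_sm S \<mu> \<in> signed_measures_on S"
  by (auto simp: signed_measures_on_def mass_restrict_sm)

lemma restrict_sm_split:
  assumes "\<mu> \<in> signed_measures_on X" "S \<in> sets borel" "T \<in> sets borel" "S \<inter> T = {}" "X \<subseteq> S \<union> T"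
  shows "\<mu> = restrict_sm S \<mu> + restrict_sm T \<mu>"
proof (rule signed_measure_eqI)
  fix A :: "'a set" assume A: "A \<in> sets borel"
  have "mass \<mu> (A - (S \<union> T)) = 0"
  proof -
    have "(A - (S \<union> T)) \<inter> X = {}" using assms(5) by blast
    then show ?thesis using assms(1-3) A by (simp add: signed_measures_on_def)
  qed
  moreover have "mass \<mu> ((A \<inter> S) \<union> (A \<inter> T)) = mass \<mu> (A \<inter> S) + mass \<mu> (A \<inter> T)"
    using assms A by (intro mass_union) auto
  moreover have "mass \<mu> (((A \<inter> S) \<union> (A \<inter> T)) \<union> (A - (S \<union> T))) =
      mass \<mu> ((A \<inter> S) \<union> (A \<inter> T)) + mass \<mu> (A - (S \<union> T))"
    using assms A by (intro mass_union) auto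
  moreover have "((A \<inter> S) \<union> (A \<inter> T)) \<union> (A - (S \<union> T)) = A" by blast
  ultimately show "mass \<mu> A = mass (restrict_sm S \<mu> + restrict_sm T \<mu>) A"
    using assms A by (simp add: mass_restrict_sm)
qed

lemma measure_pos_part_eq_0:
  assumes "\<mu> \<in> signed_measures_on X" "A \<in> sets borel" "A \<inter> X = {}"
  shows "emeasure (pos_part \<mu>) A = 0" "emeasure (neg_part \<mu>) A = 0"
proof -
  have "emeasure (pos_part \<mu>) A = 0" if "\<mu> \<in> signed_measures_on X" for \<mu>
  proof -
    have "mass \<mu> B = 0" if "B \<in> sets borel" "B \<subseteq> A" for B
    proof -
      have "B \<inter> X = {}" using that(2) assms(3) by blast
      then show ?thesis
        using that(1) \<open>\<mu> \<in> signed_measures_on X\<close> by (simp add: signed_measures_on_def)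
    qed
    then have "upvar \<mu> A \<le> 0" unfolding upvar_def by (intro SUP_least) auto
    then show ?thesis using assms(2) by (simp add: emeasure_pos_part)
  qed
  then show "emeasure (pos_part \<mu>) A = 0" "emeasure (neg_part \<mu>) A = 0"
    using assms(1) subspace_neg[OF subspace_signed_measures_on] by (auto simp: neg_part_def)
qed

definition bounded_Borel_on :: "'a::topological_space set \<Rightarrow> real \<Rightarrow> ('a \<Rightarrow> real) \<Rightarrow> bool" where
  "bounded_Borel_on X c u \<longleftrightarrow>
     (\<lambda>x. indicator X x * u x) \<in> borel_measurable borel \<and> (\<forall>x\<in>X. \<bar>u x\<bar> \<le> c) \<and> 0 \<le> c"

lemma bounded_Borel_on_integrable:
  fixes u :: "'a::topological_space \<Rightarrow> real"
  assumes u: "bounded_Borel_on X c u" and M: "finite_measure M" "sets M = sets borel"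
  shows "integrable M (\<lambda>x. indicator X x * u x)"
proof -
  interpret finite_measure M by fact
  show ?thesis
    by (rule integrable_const_bound[of _ c])
       (use u in \<open>auto simp: bounded_Borel_on_def measurable_cong_sets[OF M(2) refl] indicator_def\<close>)
qed

lemma smint_linear:
  assumes "bounded_Borel_on X c u"
  shows "smint X (\<mu> + \<nu>) u = smint X \<mu> u + smint X \<nu> u" "smint X (r *\<^sub>R \<mu>) u = r * smint X \<mu> u"
    "smint X (\<mu> - \<nu>) u = smint X \<mu> u - smint X \<nu> u" "smint X 0 u = 0"
proof -
  show add: "smint X (\<mu> + \<nu>) u = smint X \<mu> u + smint X \<nu> u"
    and scale: "smint X (r *\<^sub>R \<mu>) u = r * smint X \<mu> u" for \<mu> \<nu> r
    using assms by (auto intro!: smint_add_scale[of X u c] simp: bounded_Borel_on_def)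
  show "smint X (\<mu> - \<nu>) u = smint X \<mu> u - smint X \<nu> u"
    using add[of \<mu> "- \<nu>"] scale[of "-1" \<nu>] by simp
  show "smint X 0 u = 0" using scale[of 0 0] by simp
qed

lemma smint_scale_fun: "smint X \<mu> (\<lambda>x. c * u x) = c * smint X \<mu> u"
  by (simp add: smint_def set_lebesgue_integral_def mult.left_commute[of _ c] right_diff_distrib)

lemma smint_dirac:
  assumes u: "bounded_Borel_on X c u" and x: "x \<in> X"
  shows "smint X (dirac x) u = u x"
proof -
  define f where "f y = indicator X y * u y" for y
  have f: "f \<in> borel_measurable borel" "\<And>y. \<bar>f y\<bar> \<le> c"
    using u unfolding f_def bounded_Borel_on_def by (auto simp: indicator_def)
  define M where "M = (!) [pos_part (dirac x), neg_part (dirac x), return borel x]"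
  define a where "a = (!) [1, -1, -1 :: real]"
  have "(\<Sum>i<3. a i * (LINT x|M i. f x)) = 0"
  proof (rule combination_integral_eq_0[OF _ _ _ _ f])
    fix A :: "'a set" assume A: "A \<in> sets borel"
    show "(\<Sum>i<3. a i * measure (M i) A) = 0"
      using A jordan_decomposition[OF A, of "dirac x"]
      by (simp add: M_def a_def eval_nat_numeral mass_dirac measure_return)
  qed (auto simp: M_def eval_nat_numeral less_Suc_eq finite_pos_part finite_neg_part
      intro!: prob_space.finite_measure[OF prob_space_return])
  moreover have "(LINT y|return borel x. f y) = f x" using f(1) by (intro integral_return) auto
  ultimately show ?thesis
    using x by (simp add: M_def a_def eval_nat_numeral smint_def set_lebesgue_integral_def f_def)
qed

lemma smint_cong_on:
  fixes u v :: "'a::topological_space \<Rightarrow> real"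
  assumes \<mu>: "\<mu> \<in> signed_measures_on Z" and Z: "Z \<in> sets borel"
    and u: "bounded_Borel_on X c u" and v: "bounded_Borel_on Y d v"
    and eq: "\<And>x. x \<in> Z \<Longrightarrow> indicator X x * u x = indicator Y x * v x"
  shows "smint X \<mu> u = smint Y \<mu> v"
proof -
  have int: "(LINT x|M. indicator X x * u x) = (LINT x|M. indicator Y x * v x)"
    if M: "finite_measure M" "sets M = sets borel" "emeasure M (- Z) = 0" for M
  proof (rule integral_cong_AE)
    show "(\<lambda>x. indicator X x * u x) \<in> borel_measurable M" "(\<lambda>x. indicator Y x * v x) \<in> borel_measurable M"
      using u v by (auto simp: bounded_Borel_on_def measurable_cong_sets[OF M(2) refl])
    have "- Z \<in> null_sets M" using M Z by (auto simp: null_sets_def)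
    then show "AE x in M. indicator X x * u x = indicator Y x * v x"
      by (rule AE_I') (use eq in auto)
  qed
  have "- Z \<in> sets borel" "- Z \<inter> Z = {}" using Z by auto
  then show ?thesis
    unfolding smint_def set_lebesgue_integral_def
    using int[OF finite_pos_part[of \<mu>]] int[OF finite_neg_part[of \<mu>]] measure_pos_part_eq_0[OF \<mu>]
    by simp
qed

lemma abs_smint_diff_le:
  fixes u v :: "'a::topological_space \<Rightarrow> real"
  assumes u: "bounded_Borel_on X c u" and v: "bounded_Borel_on X d v"
    and le: "\<And>x. x \<in> X \<Longrightarrow> \<bar>u x - v x\<bar> \<le> e" and e: "0 \<le> e"
  shows "\<bar>smint X \<mu> u - smint X \<mu> v\<bar> \<le> e * (measure (pos_part \<mu>) UNIV + measure (neg_part \<mu>) UNIV)"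
proof -
  have *: "\<bar>(LINT x|M. indicator X x * u x) - (LINT x|M. indicator X x * v x)\<bar> \<le> e * measure M UNIV"
    if M: "finite_measure M" "sets M = sets borel" for M
  proof -
    interpret finite_measure M by fact
    have sp: "space M = UNIV" using sets_eq_imp_space_eq[OF M(2)] by simp
    note ints = bounded_Borel_on_integrable[OF u M] bounded_Borel_on_integrable[OF v M]
    have "\<bar>(LINT x|M. indicator X x * u x) - (LINT x|M. indicator X x * v x)\<bar> =
        \<bar>LINT x|M. indicator X x * u x - indicator X x * v x\<bar>"
      using ints by simp
    also have "\<dots> \<le> (LINT x|M. \<bar>indicator X x * u x - indicator X x * v x\<bar>)"
      by (rule integral_abs_bound)
    also have "\<dots> \<le> (LINT x|M. e)"
      using ints le e by (intro integral_mono) (auto simp: indicator_def)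
    finally show ?thesis by (simp add: sp mult.commute)
  qed
  show ?thesis
    unfolding smint_def set_lebesgue_integral_def
    using *[OF finite_pos_part[of \<mu>]] *[OF finite_neg_part[of \<mu>]] by (simp add: distrib_left)
qed

text \<open>
  The simple function with value \<open>v (x i)\<close> on \<open>A i\<close> differs from \<open>v\<close> by at most \<open>d\<close> on the pieces, and by at most
  1 off them.
\<close>

lemma integral_near_simple_function:
  fixes v :: "'a::metric_space \<Rightarrow> real" and n :: nat
  assumes M: "finite_measure M" "sets M = sets borel"
    and v: "bounded_Borel_on X 1 v"
    and A: "\<And>i. i < n \<Longrightarrow> A i \<in> sets borel" "disjoint_family_on A {..<n}" "\<And>i. i < n \<Longrightarrow> A i \<subseteq> X"
    and near: "\<And>i y. i < n \<Longrightarrow> y \<in> A i \<Longrightarrow> \<bar>v y - v (x i)\<bar> \<le> d" and d: "0 \<le> d"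
  shows "\<bar>(LINT y|M. indicator X y * v y) - (\<Sum>i<n. v (x i) * measure M (A i))\<bar>
    \<le> d * measure M UNIV + measure M (- (\<Union>i<n. A i))"
proof -
  interpret finite_measure M by fact
  have sp: "space M = UNIV" using sets_eq_imp_space_eq[OF M(2)] by simp
  define R where "R = - (\<Union>i<n. A i)"
  have "(\<Union>i<n. A i) \<in> sets borel" using A(1) by (intro sets.finite_UN) auto
  then have R: "R \<in> sets M" unfolding R_def M(2) by (rule borel_comp)
  define f where "f y = indicator X y * v y" for y
  define w where "w y = (\<Sum>i<n. v (x i) * indicator (A i) y)" for y
  have f_int: "integrable M f" unfolding f_def by (rule bounded_Borel_on_integrable[OF v M])
  have ind_int: "integrable M (\<lambda>y. v (x i) * indicator (A i) y)" if "i < n" for i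
    using A(1)[OF that] M(2) by (intro integrable_mult_right integrable_real_indicator) (auto simp: less_top[symmetric])
  have w_int: "integrable M w" unfolding w_def using ind_int by (intro Bochner_Integration.integrable_sum) auto
  have w_eq: "(LINT y|M. w y) = (\<Sum>i<n. v (x i) * measure M (A i))"
    unfolding w_def using ind_int by (subst Bochner_Integration.integral_sum) (auto simp: sp)
  have pt: "\<bar>f y - w y\<bar> \<le> d + indicator R y" for y
  proof (cases "y \<in> R")
    case True
    then have "w y = 0" by (auto simp: R_def w_def intro!: sum.neutral)
    moreover have "\<bar>f y\<bar> \<le> 1" using v by (auto simp: f_def bounded_Borel_on_def indicator_def)
    ultimately show ?thesis using True d by simp
  next
    case False
    then obtain i where i: "i < n" "y \<in> A i" by (auto simp: R_def)
    have "w y = (\<Sum>j<n. if j = i then v (x j) else 0)"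
      unfolding w_def
    proof (intro sum.cong refl)
      fix j assume "j \<in> {..<n}"
      then show "v (x j) * indicator (A j) y = (if j = i then v (x j) else 0)"
        using disjoint_family_onD[OF A(2), of i j] i by (auto simp: indicator_def)
    qed
    then have "w y = v (x i)" using i(1) by simp
    then show ?thesis using near[OF i] i A(3)[of i] False by (auto simp: f_def)
  qed
  have "\<bar>(LINT y|M. f y) - (LINT y|M. w y)\<bar> = \<bar>LINT y|M. f y - w y\<bar>" using f_int w_int by simp
  also have "\<dots> \<le> (LINT y|M. \<bar>f y - w y\<bar>)" by (rule integral_abs_bound)
  also have "\<dots> \<le> (LINT y|M. d + indicator R y)"
    using f_int w_int R pt
    by (intro integral_mono Bochner_Integration.integrable_add integrable_real_indicator)
       (auto simp: less_top[symmetric])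
  also have "\<dots> = d * measure M UNIV + measure M R"
    using R by (subst Bochner_Integration.integral_add) (auto simp: sp less_top[symmetric] mult.commute)
  finally show ?thesis by (simp add: f_def w_eq R_def)
qed

lemma small_ball_partition:
  fixes \<Omega> :: "'a::euclidean_space set"
  assumes \<Omega>: "open \<Omega>" "\<Omega> \<noteq> {}" and d: "0 < d"
  shows "\<exists>(x :: nat \<Rightarrow> 'a) A. (\<forall>i. x i \<in> \<Omega> \<and> A i \<in> sets borel \<and>
      (\<exists>r<d. A i \<subseteq> ball (x i) r \<and> ball (x i) r \<subseteq> \<Omega>)) \<and> disjoint_family A \<and> (\<Union>i. A i) = \<Omega>"
proof -
  define \<F> where "\<F> = {ball x r | x r. x \<in> \<Omega> \<and> r < d \<and> ball x r \<subseteq> \<Omega>}"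
  have "\<exists>S\<in>\<F>. x \<in> S" if x: "x \<in> \<Omega>" for x
  proof -
    obtain e where e: "e > 0" "ball x e \<subseteq> \<Omega>" using \<Omega>(1) x open_contains_ball by blast
    define r where "r = min e (d / 2)"
    have "ball x r \<subseteq> \<Omega>" using e(2) by (force simp: r_def)
    moreover have "0 < r" "r < d" using e d by (auto simp: r_def)
    ultimately show ?thesis
      unfolding \<F>_def using x by (intro bexI[of _ "ball x r"]) auto
  qed
  then have cover: "\<Union>\<F> = \<Omega>" by (auto simp: \<F>_def)
  obtain \<F>' where F': "\<F>' \<subseteq> \<F>" "countable \<F>'" "\<Union>\<F>' = \<Union>\<F>"
    using Lindelof[of \<F>] by (auto simp: \<F>_def)
  have ne: "\<F>' \<noteq> {}" using F'(3) cover \<Omega>(2) by auto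
  define b where "b = from_nat_into \<F>'"
  have b_in: "b i \<in> \<F>" for i using from_nat_into[OF ne, of i] F'(1) by (auto simp: b_def)
  have range_b: "range b = \<F>'" unfolding b_def by (rule range_from_nat_into[OF ne F'(2)])
  have "\<exists>x r. b i = ball x r \<and> x \<in> \<Omega> \<and> r < d \<and> ball x r \<subseteq> \<Omega>" for i
    using b_in[of i] by (auto simp: \<F>_def)
  then obtain x r where xr: "\<And>i. b i = ball (x i) (r i)" "\<And>i. x i \<in> \<Omega>" "\<And>i. r i < d"
    "\<And>i. ball (x i) (r i) \<subseteq> \<Omega>" by metis
  have sets: "disjointed b i \<in> sets borel" for i
  proof -
    have "range b \<subseteq> sets borel" using xr(1) by auto
    from sets.range_disjointed_sets[OF this] show ?thesis by auto
  qed
  have "(\<Union>i. disjointed b i) = \<Omega>"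
    using UN_disjointed_eq[of b] range_b F'(3) cover by simp
  moreover have "disjointed b i \<subseteq> ball (x i) (r i)" for i
    using disjointed_subset[of b i] xr(1) by simp
  ultimately show ?thesis
    using xr sets disjoint_family_disjointed[of b]
    by (intro exI[of _ x] exI[of _ "disjointed b"]) blast
qed

text \<open>
  The mass of each piece of a fine partition is moved to the centre of a small ball around the piece.
  The number of pieces depends on \<open>\<mu>\<close> but not on \<open>v\<close>. The pieces lie in balls inside \<open>\<Omega>\<close>, since near the boundary the
  functions \<open>v\<close> need not be equicontinuous; what is left outside the first \<open>n\<close> pieces has small
  total variation, because \<open>\<mu>\<close> gives no mass to the boundary.
\<close>

lemma approximation_by_point_masses:
  fixes \<Omega> :: "'a::euclidean_space set"
  assumes \<Omega>: "open \<Omega>" "\<Omega> \<noteq> {}" and \<mu>: "\<mu> \<in> signed_measures_on \<Omega>" and \<epsilon>: "0 < \<epsilon>"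
  shows "\<exists>n a x. (\<forall>i<n::nat. x i \<in> \<Omega>) \<and>
    (\<forall>v. bounded_Borel_on (closure \<Omega>) 1 v \<longrightarrow> segment_Lipschitz \<Omega> v \<longrightarrow>
         \<bar>smint (closure \<Omega>) \<mu> v - (\<Sum>i<n. a i * v (x i))\<bar> \<le> \<epsilon>)"
proof -
  define P where "P = pos_part \<mu>"
  define N where "N = neg_part \<mu>"
  interpret P: finite_measure P unfolding P_def by (rule finite_pos_part)
  interpret N: finite_measure N unfolding N_def by (rule finite_neg_part)
  have [simp]: "sets P = sets borel" "sets N = sets borel" by (simp_all add: P_def N_def)
  define T where "T = measure P UNIV + measure N UNIV"
  have T: "0 \<le> T" by (simp add: T_def)
  \<comment> \<open>half of the error is spent on the pieces, the other half on the remainder \<open>R n\<close>\<close>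
  define d where "d = \<epsilon> / (2 * (1 + T))"
  have d: "0 < d" using \<epsilon> T by (simp add: d_def)
  have "d * (2 * (1 + T)) = \<epsilon>" using T by (simp add: d_def)
  then have dT: "d * T \<le> \<epsilon> / 2" using d by (simp add: algebra_simps)
  obtain x :: "nat \<Rightarrow> 'a" and A where
    x: "\<And>i. x i \<in> \<Omega>" and A: "\<And>i. A i \<in> sets borel" and
    small: "\<And>i. \<exists>r<d. A i \<subseteq> ball (x i) r \<and> ball (x i) r \<subseteq> \<Omega>" and
    disj: "disjoint_family A" and UN: "(\<Union>i. A i) = \<Omega>"
    using small_ball_partition[OF \<Omega> d] by blast
  define R where "R n = - (\<Union>i<n. A i)" for n :: nat
  have "(\<Union>i<n. A i) \<in> sets borel" for n using A by (intro sets.finite_UN) auto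
  then have "R n \<in> sets borel" for n unfolding R_def by (rule borel_comp)
  then have R: "range R \<subseteq> sets borel" by blast
  have dec: "decseq R" by (rule decseq_SucI) (auto simp: R_def)
  have INT: "(\<Inter>n. R n) = - \<Omega>" unfolding UN[symmetric] R_def by auto
  have "emeasure P (- \<Omega>) = 0" "emeasure N (- \<Omega>) = 0"
    using measure_pos_part_eq_0[OF \<mu>, of "- \<Omega>"] \<Omega>(1) by (auto simp: P_def N_def)
  then have "measure P (- \<Omega>) = 0" "measure N (- \<Omega>) = 0" by (simp_all add: measure_def)
  then have "(\<lambda>n. measure P (R n)) \<longlonglongrightarrow> 0" "(\<lambda>n. measure N (R n)) \<longlonglongrightarrow> 0"
    using P.finite_Lim_measure_decseq[of R] N.finite_Lim_measure_decseq[of R] R dec INT by auto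
  then have "(\<lambda>n. measure P (R n) + measure N (R n)) \<longlonglongrightarrow> 0 + 0" by (rule tendsto_add)
  then have "\<forall>\<^sub>F n in sequentially. measure P (R n) + measure N (R n) < \<epsilon> / 2"
    by (rule order_tendstoD) (use \<epsilon> in simp)
  then obtain n where n: "measure P (R n) + measure N (R n) < \<epsilon> / 2"
    by (auto simp: eventually_sequentially)
  define a where "a i = mass \<mu> (A i)" for i
  have "\<bar>smint (closure \<Omega>) \<mu> v - (\<Sum>i<n. a i * v (x i))\<bar> \<le> \<epsilon>"
    if v: "bounded_Borel_on (closure \<Omega>) 1 v" "segment_Lipschitz \<Omega> v" for v
  proof -
    have near: "\<bar>v y - v (x i)\<bar> \<le> d" if y: "y \<in> A i" for i y
    proof -
      obtain r where r: "r < d" "A i \<subseteq> ball (x i) r" "ball (x i) r \<subseteq> \<Omega>" using small by blast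
      have yb: "y \<in> ball (x i) r" using y r(2) by blast
      then have "x i \<in> ball (x i) r" using order_le_less_trans[OF zero_le_dist] by auto
      then have "closed_segment y (x i) \<subseteq> ball (x i) r"
        using yb by (intro closed_segment_subset convex_ball)
      then have seg: "open_segment y (x i) \<subseteq> \<Omega>" using r(3) by (auto simp: open_segment_def)
      have "y \<in> closure \<Omega>" "x i \<in> closure \<Omega>" using yb r(3) x closure_subset by blast+
      then have "\<bar>v y - v (x i)\<bar> \<le> dist y (x i)"
        using v(2) seg unfolding segment_Lipschitz_def by blast
      then show ?thesis using yb r(1) by (simp add: dist_commute)
    qed
    have sub: "A i \<subseteq> closure \<Omega>" for i
      using UN_upper[of i UNIV A] closure_subset[of \<Omega>] unfolding UN by (rule subset_trans) simp
    have dj: "disjoint_family_on A {..<n}" using disj by (rule disjoint_family_on_mono[rotated]) simp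
    have bound: "\<bar>(LINT y|M. indicator (closure \<Omega>) y * v y) - (\<Sum>i<n. v (x i) * measure M (A i))\<bar>
        \<le> d * measure M UNIV + measure M (R n)" if "finite_measure M" "sets M = sets borel" for M
      unfolding R_def using d
      by (intro integral_near_simple_function[OF that v(1) A dj sub near]) auto
    have "(\<Sum>i<n. a i * v (x i)) =
        (\<Sum>i<n. v (x i) * measure P (A i)) - (\<Sum>i<n. v (x i) * measure N (A i))"
      unfolding sum_subtractf[symmetric] a_def P_def N_def jordan_decomposition[OF A]
      by (intro sum.cong refl) (simp add: algebra_simps)
    then show ?thesis
      using bound[OF P.finite_measure_axioms] bound[OF N.finite_measure_axioms] n dT
      unfolding smint_def set_lebesgue_integral_def T_def P_def[symmetric] N_def[symmetric]
      by (simp add: distrib_left abs_le_iff)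
  qed
  then show ?thesis using x by blast
qed

section \<open>The completion and the pairing\<close>

lemma grad_le_1_scale:
  assumes "grad_le_1 \<Omega> u" "\<bar>k\<bar> \<le> 1"
  shows "grad_le_1 \<Omega> (\<lambda>x. k * u x)"
proof -
  have "AE x in lebesgue_on \<Omega>. \<exists>g. (GDERIV u x :> g) \<and> norm g \<le> 1"
    using assms(1) by (simp add: grad_le_1_def)
  then show ?thesis
    unfolding grad_le_1_def
  proof eventually_elim
    case (elim x)
    then obtain g where g: "GDERIV u x :> g" "norm g \<le> 1" by blast
    have "\<bar>k\<bar> * norm g \<le> 1 * 1" using g(2) assms(2) by (intro mult_mono) auto
    moreover have "GDERIV (\<lambda>x. k * u x) x :> k *\<^sub>R g"
      by (rule GDERIV_DERIV_compose[OF g(1)]) (auto intro!: derivative_eq_intros)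
    ultimately show ?case by (intro exI[of _ "k *\<^sub>R g"]) simp
  qed
qed

lemma Lip_scale:
  assumes "u \<in> Lip X"
  shows "(\<lambda>x. k * u x) \<in> Lip X"
proof -
  obtain L where "L-lipschitz_on X u" using assms by (auto simp: Lip_def)
  from lipschitz_on_cmult_real[OF this, of k] show ?thesis by (auto simp: Lip_def)
qed

lemma Lip_bounded_Borel_on:
  fixes u :: "'a::euclidean_space \<Rightarrow> real"
  assumes "bounded \<Omega>" "u \<in> Lip (closure \<Omega>)"
  shows "\<exists>c. bounded_Borel_on (closure \<Omega>) c u"
proof -
  obtain L where "L-lipschitz_on (closure \<Omega>) u" using assms(2) by (auto simp: Lip_def)
  then have cont: "continuous_on (closure \<Omega>) u" by (rule lipschitz_on_continuous_on)
  have "compact (u ` closure \<Omega>)"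
    using cont assms(1) by (intro compact_continuous_image) auto
  then have "bounded (u ` closure \<Omega>)" by (rule compact_imp_bounded)
  then obtain c where "\<And>x. x \<in> closure \<Omega> \<Longrightarrow> \<bar>u x\<bar> \<le> c"
    unfolding bounded_iff by auto
  then have "bounded_Borel_on (closure \<Omega>) (max c 0) u"
    using borel_measurable_continuous_on_indicator[OF _ cont]
    by (auto simp: bounded_Borel_on_def intro: le_max_iff_disj[THEN iffD2])
  then show ?thesis ..
qed

lemma bounded_Borel_on_subset:
  assumes u: "bounded_Borel_on X c u" and Y: "Y \<in> sets borel" "Y \<subseteq> X"
  shows "bounded_Borel_on Y c u"
proof -
  have "(\<lambda>x. indicator X x * u x) \<in> borel_measurable borel"
    using u by (simp add: bounded_Borel_on_def)
  then have "(\<lambda>x. indicator Y x * (indicator X x * u x)) \<in> borel_measurable borel"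
    using Y(1) by (rule borel_measurable_times[OF borel_measurable_indicator, rotated])
  moreover have "(\<lambda>x. indicator Y x * (indicator X x * u x)) = (\<lambda>x. indicator Y x * u x)"
    using Y(2) by (auto simp: indicator_def fun_eq_iff)
  ultimately show ?thesis using u Y(2) by (auto simp: bounded_Borel_on_def)
qed

lemma closure_subspace:
  fixes V :: "'b::real_normed_vector set"
  assumes V: "subspace V"
  shows "subspace (closure V)"
proof (rule subspaceI)
  show "0 \<in> closure V" by (intro subsetD[OF closure_subset] subspace_0[OF V])
  fix x y c assume "x \<in> closure V"
  then obtain X where X: "\<And>n::nat. X n \<in> V" "X \<longlonglongrightarrow> x" unfolding closure_sequential by blast
  have "(\<lambda>n. c *\<^sub>R X n) \<longlonglongrightarrow> c *\<^sub>R x" by (intro tendsto_intros X)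
  then show "c *\<^sub>R x \<in> closure V"
    unfolding closure_sequential by (intro exI[of _ "\<lambda>n. c *\<^sub>R X n"]) (simp add: subspace_scale[OF V X(1)])
  assume "y \<in> closure V"
  then obtain Y where Y: "\<And>n::nat. Y n \<in> V" "Y \<longlonglongrightarrow> y" unfolding closure_sequential by blast
  have "(\<lambda>n. X n + Y n) \<longlonglongrightarrow> x + y" by (intro tendsto_intros X Y)
  then show "x + y \<in> closure V"
    unfolding closure_sequential by (intro exI[of _ "\<lambda>n. X n + Y n"]) (simp add: subspace_add[OF V X(1) Y(1)])
qed

locale KR_completion =
  fixes \<Omega> :: "'a::euclidean_space set" and \<iota> :: "'a signed_measure \<Rightarrow> 'b::real_normed_vector"
  assumes open_\<Omega>: "open \<Omega>" and bounded_\<Omega>: "bounded \<Omega>" and \<Omega>_ne: "\<Omega> \<noteq> {}"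
    and emb: "KR_embedding \<Omega> \<iota>"
begin

abbreviation Mc where "Mc \<equiv> signed_measures_on (closure \<Omega>)"
abbreviation U where "U \<equiv> {u \<in> Lip0 \<Omega>. grad_le_1 \<Omega> u}"
abbreviation N where "N \<equiv> KR_boundary \<Omega> \<iota>"
abbreviation q where "q \<xi> \<equiv> quotient_norm (coset N \<xi>)"
abbreviation pairing where "pairing \<equiv> KR_pairing \<Omega> \<iota>"
text \<open>
  The functions in \<open>U\<close> are bounded by the inradius, so dividing them by this constant gives test
  functions for the Kantorovich--Rubinstein norm.
\<close>

definition C where "C = max 1 (inradius \<Omega>)"

lemma C_ge_1: "1 \<le> C" by (simp add: C_def)

lemmas Mc_subspace = subspace_signed_measures_on[of "closure \<Omega>"]

lemma iota_add: "\<mu> \<in> Mc \<Longrightarrow> \<nu> \<in> Mc \<Longrightarrow> \<iota> (\<mu> + \<nu>) = \<iota> \<mu> + \<iota> \<nu>"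
  and iota_scale: "\<mu> \<in> Mc \<Longrightarrow> \<iota> (c *\<^sub>R \<mu>) = c *\<^sub>R \<iota> \<mu>"
  and norm_iota: "\<mu> \<in> Mc \<Longrightarrow> norm (\<iota> \<mu>) = KR_norm \<Omega> \<mu>"
  using emb unfolding KR_embedding_def by blast+

lemma iota_0: "\<iota> 0 = 0"
  using iota_scale[OF subspace_0[OF Mc_subspace], of 0] by simp

lemma iota_diff: "\<mu> \<in> Mc \<Longrightarrow> \<nu> \<in> Mc \<Longrightarrow> \<iota> (\<mu> - \<nu>) = \<iota> \<mu> - \<iota> \<nu>"
  using iota_add[of \<mu> "(-1) *\<^sub>R \<nu>"] iota_scale[of \<nu> "-1"] subspace_scale[OF Mc_subspace, of \<nu> "-1"] by simp

lemma iota_sum: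
  fixes \<mu> :: "nat \<Rightarrow> 'a signed_measure"
  assumes "\<And>i. i < n \<Longrightarrow> \<mu> i \<in> Mc"
  shows "(\<Sum>i<n. a i *\<^sub>R \<mu> i) \<in> Mc \<and> \<iota> (\<Sum>i<n. a i *\<^sub>R \<mu> i) = (\<Sum>i<n. a i *\<^sub>R \<iota> (\<mu> i))"
  using assms
proof (induction n)
  case 0
  then show ?case using subspace_0[OF Mc_subspace] by (simp add: iota_0)
next
  case (Suc n)
  then have "\<mu> n \<in> Mc" "(\<Sum>i<n. a i *\<^sub>R \<mu> i) \<in> Mc \<and> \<iota> (\<Sum>i<n. a i *\<^sub>R \<mu> i) = (\<Sum>i<n. a i *\<^sub>R \<iota> (\<mu> i))"
    by auto
  then show ?case
    using iota_scale[of "\<mu> n" "a n"] subspace_scale[OF Mc_subspace, of "\<mu> n" "a n"]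
    by (simp add: iota_add subspace_add[OF Mc_subspace])
qed

lemma subspace_iota_image:
  assumes "X \<subseteq> closure \<Omega>"
  shows "subspace (\<iota> ` signed_measures_on X)"
proof -
  note sub = subspace_signed_measures_on[of X]
  have in_Mc: "\<mu> \<in> Mc" if "\<mu> \<in> signed_measures_on X" for \<mu>
    using that signed_measures_on_mono[OF assms] by blast
  show ?thesis
  proof (rule subspaceI)
    show "0 \<in> \<iota> ` signed_measures_on X" using subspace_0[OF sub] iota_0 by force
    fix x y c assume "x \<in> \<iota> ` signed_measures_on X"
    then obtain \<mu> where \<mu>: "x = \<iota> \<mu>" "\<mu> \<in> signed_measures_on X" by blast
    show "c *\<^sub>R x \<in> \<iota> ` signed_measures_on X"
      using subspace_scale[OF sub \<mu>(2)] iota_scale[OF in_Mc[OF \<mu>(2)]] \<mu>(1) by (metis image_eqI)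
    assume "y \<in> \<iota> ` signed_measures_on X"
    then obtain \<nu> where \<nu>: "y = \<iota> \<nu>" "\<nu> \<in> signed_measures_on X" by blast
    show "x + y \<in> \<iota> ` signed_measures_on X"
      using subspace_add[OF sub \<mu>(2) \<nu>(2)] iota_add[OF in_Mc[OF \<mu>(2)] in_Mc[OF \<nu>(2)]] \<mu>(1) \<nu>(1)
      by (metis image_eqI)
  qed
qed

lemma frontier_sub: "frontier \<Omega> \<subseteq> closure \<Omega>"
  by (simp add: frontier_def)

lemma KR_boundary_eq_closure: "N = closure (\<iota> ` signed_measures_on (frontier \<Omega>))"
proof -
  have span: "span (\<iota> ` signed_measures_on (frontier \<Omega>)) = \<iota> ` signed_measures_on (frontier \<Omega>)"
    unfolding span_eq_iff by (rule subspace_iota_image[OF frontier_sub])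
  show ?thesis unfolding KR_boundary_def span ..
qed

lemma N_subspace: "subspace N"
  unfolding KR_boundary_eq_closure by (intro closure_subspace subspace_iota_image frontier_sub)

lemma KR_subspace: "subspace (KR \<Omega> \<iota>)"
  unfolding KR_def by (intro closure_subspace subspace_iota_image order_refl)

lemma N_sub_KR: "N \<subseteq> KR \<Omega> \<iota>"
  unfolding KR_boundary_eq_closure KR_def by (intro closure_mono image_mono signed_measures_on_mono frontier_sub)

lemma iota_in_KR: "\<mu> \<in> Mc \<Longrightarrow> \<iota> \<mu> \<in> KR \<Omega> \<iota>"
  unfolding KR_def by (intro subsetD[OF closure_subset] imageI)

lemma iota_in_N: "\<mu> \<in> signed_measures_on (frontier \<Omega>) \<Longrightarrow> \<iota> \<mu> \<in> N"
  unfolding KR_boundary_eq_closure by (intro subsetD[OF closure_subset] imageI)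

lemma test_bounded_Borel_on: "v \<in> KR_test \<Omega> \<Longrightarrow> bounded_Borel_on (closure \<Omega>) 1 v"
  using KR_test_measurable[of v \<Omega>] by (simp add: bounded_Borel_on_def)

lemma smint_test_le:
  assumes "v \<in> KR_test \<Omega>" "\<mu> \<in> Mc"
  shows "\<bar>smint (closure \<Omega>) \<mu> v\<bar> \<le> norm (\<iota> \<mu>)"
proof -
  have "bdd_above (smint (closure \<Omega>) \<mu> ` KR_test \<Omega>)"
    using smint_bound[of _ \<Omega> \<mu>]
    by (intro bdd_aboveI2[of _ _ "measure (pos_part \<mu>) UNIV + measure (neg_part \<mu>) UNIV"])
       (meson abs_le_D1)
  then have "smint (closure \<Omega>) \<mu> w \<le> norm (\<iota> \<mu>)" if "w \<in> KR_test \<Omega>" for w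
    unfolding norm_iota[OF assms(2)] KR_norm_def using that by (intro cSUP_upper)
  from this[OF assms(1)] this[OF uminus_in_KR_test[OF assms(1)]] show ?thesis
    by (simp add: smint_uminus_fun)
qed

lemma norm_iota_le:
  assumes "\<mu> \<in> Mc" "\<And>v. v \<in> KR_test \<Omega> \<Longrightarrow> smint (closure \<Omega>) \<mu> v \<le> a"
  shows "norm (\<iota> \<mu>) \<le> a"
  unfolding norm_iota[OF assms(1)] KR_norm_def using assms(2) zero_in_KR_test by (intro cSUP_least) auto

lemma U_bounded_Borel_on: "u \<in> U \<Longrightarrow> \<exists>c. bounded_Borel_on (closure \<Omega>) c u"
  using Lip_bounded_Borel_on[OF bounded_\<Omega>] by (auto simp: Lip0_def)

lemma smint_U_le:
  assumes u: "u \<in> U" and \<mu>: "\<mu> \<in> Mc"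
  shows "\<bar>smint (closure \<Omega>) \<mu> u\<bar> \<le> C * norm (\<iota> \<mu>)"
proof -
  have C: "0 < C" using C_ge_1 by simp
  have "(\<lambda>x. inverse C * u x) \<in> KR_test \<Omega>"
    unfolding KR_test_def
  proof (intro CollectI conjI ballI)
    show "(\<lambda>x. inverse C * u x) \<in> Lip (closure \<Omega>)" using u by (intro Lip_scale) (simp add: Lip0_def)
    show "grad_le_1 \<Omega> (\<lambda>x. inverse C * u x)"
      using u C_ge_1 by (intro grad_le_1_scale) (auto simp: inverse_le_1_iff)
    fix x assume "x \<in> closure \<Omega>"
    then have "\<bar>u x\<bar> \<le> C"
      using Lip0_abs_le_inradius[OF open_\<Omega> bounded_\<Omega> \<Omega>_ne, of u x] u by (simp add: C_def)
    then show "\<bar>inverse C * u x\<bar> \<le> 1" using C by (simp add: abs_mult field_simps)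
  qed
  from smint_test_le[OF this \<mu>] have "inverse C * \<bar>smint (closure \<Omega>) \<mu> u\<bar> \<le> norm (\<iota> \<mu>)"
    using C by (simp add: smint_scale_fun abs_mult)
  then show ?thesis using C by (simp add: field_simps)
qed

text \<open>
  The definite description in the pairing denotes something: by the bound \<open>smint_U_le\<close>, the integrals
  along a convergent sequence form a Cauchy sequence, and two sequences with the same limit
  give the same value.
\<close>

lemma pairing_limit:
  assumes u: "u \<in> U" and \<mu>: "\<And>k. \<mu> k \<in> Mc" "(\<lambda>k. \<iota> (\<mu> k)) \<longlonglongrightarrow> \<xi>"
  shows "(\<lambda>k. smint (closure \<Omega>) (\<mu> k) u) \<longlonglongrightarrow> pairing \<xi> u"
proof -
  let ?s = "\<lambda>\<mu>. smint (closure \<Omega>) \<mu> u"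
  obtain c where c: "bounded_Borel_on (closure \<Omega>) c u" using U_bounded_Borel_on[OF u] by blast
  have C: "0 < C" using C_ge_1 by simp
  have le: "\<bar>?s \<nu> - ?s \<nu>'\<bar> \<le> C * norm (\<iota> \<nu> - \<iota> \<nu>')" if "\<nu> \<in> Mc" "\<nu>' \<in> Mc" for \<nu> \<nu>'
    using smint_U_le[OF u subspace_diff[OF Mc_subspace that]] iota_diff[OF that] smint_linear(3)[OF c]
    by simp
  have "Cauchy (\<lambda>k. ?s (\<mu> k))"
  proof (rule metric_CauchyI)
    fix e :: real assume e: "0 < e"
    obtain M where M: "\<And>m n. m \<ge> M \<Longrightarrow> n \<ge> M \<Longrightarrow> dist (\<iota> (\<mu> m)) (\<iota> (\<mu> n)) < e / C"
      using LIMSEQ_imp_Cauchy[OF \<mu>(2)] e C unfolding Cauchy_def by (meson divide_pos_pos)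
    have "dist (?s (\<mu> m)) (?s (\<mu> n)) < e" if "m \<ge> M" "n \<ge> M" for m n
    proof -
      have "C * norm (\<iota> (\<mu> m) - \<iota> (\<mu> n)) < e"
        using M[OF that] C by (simp add: dist_norm field_simps)
      then show ?thesis using le[OF \<mu>(1) \<mu>(1), of m n] by (simp add: dist_real_def)
    qed
    then show "\<exists>M. \<forall>m\<ge>M. \<forall>n\<ge>M. dist (?s (\<mu> m)) (?s (\<mu> n)) < e" by blast
  qed
  then obtain l where l: "(\<lambda>k. ?s (\<mu> k)) \<longlonglongrightarrow> l"
    using real_Cauchy_convergent convergent_def by blast
  have other: "(\<lambda>k. ?s (\<nu> k)) \<longlonglongrightarrow> l" if \<nu>: "\<And>k. \<nu> k \<in> Mc" "(\<lambda>k. \<iota> (\<nu> k)) \<longlonglongrightarrow> \<xi>" for \<nu>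
  proof -
    have "(\<lambda>k. C * norm (\<iota> (\<nu> k) - \<iota> (\<mu> k))) \<longlonglongrightarrow> C * norm (\<xi> - \<xi>)"
      by (intro tendsto_intros \<nu> \<mu>)
    then have lim0: "(\<lambda>k. C * norm (\<iota> (\<nu> k) - \<iota> (\<mu> k))) \<longlonglongrightarrow> 0" by simp
    have "(\<lambda>k. ?s (\<nu> k) - ?s (\<mu> k)) \<longlonglongrightarrow> 0"
    proof (rule Lim_null_comparison[OF _ lim0], rule always_eventually, rule allI)
      fix k show "norm (?s (\<nu> k) - ?s (\<mu> k)) \<le> C * norm (\<iota> (\<nu> k) - \<iota> (\<mu> k))"
        using le[OF \<nu>(1)[of k] \<mu>(1)[of k]] by simp
    qed
    from tendsto_add[OF this l] show ?thesis by simp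
  qed
  have "pairing \<xi> u = l"
    unfolding KR_pairing_def
  proof (rule the_equality)
    fix l' assume "\<forall>\<mu>. (\<forall>k::nat. \<mu> k \<in> Mc) \<longrightarrow> (\<lambda>k. \<iota> (\<mu> k)) \<longlonglongrightarrow> \<xi> \<longrightarrow> (\<lambda>k. ?s (\<mu> k)) \<longlonglongrightarrow> l'"
    then have "(\<lambda>k. ?s (\<mu> k)) \<longlonglongrightarrow> l'" using \<mu> by blast
    then show "l' = l" using l by (rule LIMSEQ_unique)
  qed (use other in blast)
  then show ?thesis using l by simp
qed

lemma pairing_iota: "u \<in> U \<Longrightarrow> \<mu> \<in> Mc \<Longrightarrow> pairing (\<iota> \<mu>) u = smint (closure \<Omega>) \<mu> u"
  using pairing_limit[of u "\<lambda>_. \<mu>" "\<iota> \<mu>"] by (simp add: LIMSEQ_const_iff)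

lemma KR_sequence:
  assumes "\<xi> \<in> KR \<Omega> \<iota>"
  obtains \<mu> where "\<And>k::nat. \<mu> k \<in> Mc" "(\<lambda>k. \<iota> (\<mu> k)) \<longlonglongrightarrow> \<xi>"
proof -
  obtain x where x: "\<And>k::nat. x k \<in> \<iota> ` Mc" "x \<longlonglongrightarrow> \<xi>"
    using assms unfolding KR_def closure_sequential by blast
  then obtain \<mu> where "\<And>k. \<mu> k \<in> Mc" "x = (\<lambda>k. \<iota> (\<mu> k))" unfolding image_iff by metis
  then show thesis using x(2) that[of \<mu>] by simp
qed

lemma pairing_le:
  assumes "u \<in> U" "\<xi> \<in> KR \<Omega> \<iota>"
  shows "\<bar>pairing \<xi> u\<bar> \<le> C * norm \<xi>"
proof -
  obtain \<mu> where \<mu>: "\<And>k::nat. \<mu> k \<in> Mc" "(\<lambda>k. \<iota> (\<mu> k)) \<longlonglongrightarrow> \<xi>" using KR_sequence[OF assms(2)] by blast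
  show ?thesis
  proof (rule LIMSEQ_le)
    show "(\<lambda>k. \<bar>smint (closure \<Omega>) (\<mu> k) u\<bar>) \<longlonglongrightarrow> \<bar>pairing \<xi> u\<bar>"
      by (intro tendsto_rabs pairing_limit[OF assms(1)] \<mu>)
    show "(\<lambda>k. C * norm (\<iota> (\<mu> k))) \<longlonglongrightarrow> C * norm \<xi>"
      by (intro tendsto_intros \<mu>)
  qed (use smint_U_le[OF assms(1) \<mu>(1)] in blast)
qed

lemma pairing_add:
  assumes "u \<in> U" "\<xi> \<in> KR \<Omega> \<iota>" "\<eta> \<in> KR \<Omega> \<iota>"
  shows "pairing (\<xi> + \<eta>) u = pairing \<xi> u + pairing \<eta> u"
proof -
  obtain c where c: "bounded_Borel_on (closure \<Omega>) c u" using U_bounded_Borel_on[OF assms(1)] by blast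
  obtain \<mu> where \<mu>: "\<And>k::nat. \<mu> k \<in> Mc" "(\<lambda>k. \<iota> (\<mu> k)) \<longlonglongrightarrow> \<xi>" using KR_sequence[OF assms(2)] by blast
  obtain \<nu> where \<nu>: "\<And>k::nat. \<nu> k \<in> Mc" "(\<lambda>k. \<iota> (\<nu> k)) \<longlonglongrightarrow> \<eta>" using KR_sequence[OF assms(3)] by blast
  have "(\<lambda>k. smint (closure \<Omega>) (\<mu> k + \<nu> k) u) \<longlonglongrightarrow> pairing (\<xi> + \<eta>) u"
    using \<mu> \<nu> by (intro pairing_limit[OF assms(1)] subspace_add[OF Mc_subspace])
      (simp_all add: iota_add tendsto_add)
  moreover have "(\<lambda>k. smint (closure \<Omega>) (\<mu> k + \<nu> k) u) \<longlonglongrightarrow> pairing \<xi> u + pairing \<eta> u"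
    unfolding smint_linear(1)[OF c] by (intro tendsto_add pairing_limit[OF assms(1)] \<mu> \<nu>)
  ultimately show ?thesis by (rule LIMSEQ_unique)
qed

lemma pairing_scale:
  assumes "u \<in> U" "\<xi> \<in> KR \<Omega> \<iota>"
  shows "pairing (r *\<^sub>R \<xi>) u = r * pairing \<xi> u"
proof -
  obtain c where c: "bounded_Borel_on (closure \<Omega>) c u" using U_bounded_Borel_on[OF assms(1)] by blast
  obtain \<mu> where \<mu>: "\<And>k::nat. \<mu> k \<in> Mc" "(\<lambda>k. \<iota> (\<mu> k)) \<longlonglongrightarrow> \<xi>" using KR_sequence[OF assms(2)] by blast
  have "(\<lambda>k. smint (closure \<Omega>) (r *\<^sub>R \<mu> k) u) \<longlonglongrightarrow> pairing (r *\<^sub>R \<xi>) u"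
    using \<mu> by (intro pairing_limit[OF assms(1)] subspace_scale[OF Mc_subspace])
      (simp_all add: iota_scale tendsto_scaleR)
  moreover have "(\<lambda>k. smint (closure \<Omega>) (r *\<^sub>R \<mu> k) u) \<longlonglongrightarrow> r * pairing \<xi> u"
    unfolding smint_linear(2)[OF c] by (intro tendsto_mult_left pairing_limit[OF assms(1)] \<mu>)
  ultimately show ?thesis by (rule LIMSEQ_unique)
qed

lemma smint_frontier:
  assumes u: "u \<in> U" and \<mu>: "\<mu> \<in> signed_measures_on (frontier \<Omega>)"
  shows "smint (closure \<Omega>) \<mu> u = 0"
proof -
  obtain c where c: "bounded_Borel_on (closure \<Omega>) c u" using U_bounded_Borel_on[OF u] by blast
  have zero: "bounded_Borel_on (closure \<Omega>) 0 (\<lambda>_. 0)" by (simp add: bounded_Borel_on_def)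
  have "smint (closure \<Omega>) \<mu> u = smint (closure \<Omega>) \<mu> (\<lambda>_. 0)"
    by (rule smint_cong_on[OF \<mu> _ c zero]) (use u in \<open>auto simp: Lip0_def\<close>)
  then show ?thesis by (simp add: smint_def set_lebesgue_integral_def)
qed

lemma pairing_N:
  assumes u: "u \<in> U" and \<nu>: "\<nu> \<in> N"
  shows "pairing \<nu> u = 0"
proof -
  obtain x where x: "\<And>k::nat. x k \<in> \<iota> ` signed_measures_on (frontier \<Omega>)" "x \<longlonglongrightarrow> \<nu>"
    using \<nu> unfolding KR_boundary_eq_closure closure_sequential by blast
  then obtain \<mu> where \<mu>: "\<And>k. \<mu> k \<in> signed_measures_on (frontier \<Omega>)" "x = (\<lambda>k. \<iota> (\<mu> k))"
    unfolding image_iff by metis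
  have "(\<lambda>k. smint (closure \<Omega>) (\<mu> k) u) \<longlonglongrightarrow> pairing \<nu> u"
    using x(2) \<mu> signed_measures_on_mono[OF frontier_sub]
    by (intro pairing_limit[OF u]) auto
  then show ?thesis by (simp add: smint_frontier[OF u \<mu>(1)] LIMSEQ_const_iff)
qed

lemma pairing_coset:
  assumes "u \<in> U" "\<xi> \<in> KR \<Omega> \<iota>" "\<nu> \<in> N"
  shows "pairing (\<xi> + \<nu>) u = pairing \<xi> u"
  using pairing_add[OF assms(1,2)] pairing_N[OF assms(1,3)] N_sub_KR assms(3) by auto

lemma Jstar_coset_eq:
  assumes "\<xi> \<in> KR \<Omega> \<iota>"
  shows "Jstar_coset \<Omega> \<iota> (coset N \<xi>) = (SUP u\<in>U. ereal (pairing \<xi> u))"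
  unfolding Jstar_coset_def
proof (intro SUP_cong refl arg_cong[where f = ereal] the_equality)
  fix u assume u: "u \<in> U"
  show "\<forall>\<zeta>\<in>coset N \<xi>. pairing \<zeta> u = pairing \<xi> u"
    using pairing_coset[OF u assms] by (auto simp: coset_def)
  fix r assume "\<forall>\<zeta>\<in>coset N \<xi>. pairing \<zeta> u = r"
  moreover have "\<xi> + 0 \<in> coset N \<xi>" unfolding coset_def using subspace_0[OF N_subspace] by blast
  ultimately show "r = pairing \<xi> u" by simp
qed

section \<open>Comparison of the two norms\<close>

text \<open>
  The pairing is constant on the coset, so \<open>C\<close> times the norm of each of its members is a bound.
\<close>

lemma Jstar_coset_le:
  assumes "\<xi> \<in> KR \<Omega> \<iota>"
  shows "Jstar_coset \<Omega> \<iota> (coset N \<xi>) \<le> ereal (C * q \<xi>)"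
  unfolding Jstar_coset_eq[OF assms]
proof (rule SUP_least)
  fix u assume u: "u \<in> U"
  have C: "0 < C" using C_ge_1 by simp
  have "pairing \<xi> u / C \<le> q \<xi>"
  proof (rule quotient_norm_coset_ge)
    show "N \<noteq> {}" using subspace_0[OF N_subspace] by blast
    fix \<nu> assume \<nu>: "\<nu> \<in> N"
    have "\<xi> + \<nu> \<in> KR \<Omega> \<iota>" using subspace_add[OF KR_subspace assms] \<nu> N_sub_KR by blast
    from pairing_le[OF u this] show "pairing \<xi> u / C \<le> norm (\<xi> + \<nu>)"
      using C unfolding pairing_coset[OF u assms \<nu>] by (simp add: field_simps)
  qed
  then show "ereal (pairing \<xi> u) \<le> ereal (C * q \<xi>)" using C by (simp add: field_simps)
qed

text \<open>
  The function \<open>u\<close> inherits its properties from the norm of point masses: \<open>\<delta>\<^sub>x\<close> has norm at most 1, the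
  distance of \<open>\<delta>\<^sub>x\<close> and \<open>\<delta>\<^sub>y\<close> is at most \<open>dist x y\<close> whenever the segment between them runs
  inside \<open>\<Omega>\<close>, and \<open>\<delta>\<^sub>x\<close> lies in \<open>N\<close> for boundary points \<open>x\<close>. Both sides of the last equation agree on
  combinations of point masses, and the approximation of \<open>\<mu>\<close> by such combinations
  is uniform over the test functions and over \<open>u\<close>, so it controls both the norm and the integral.
\<close>

lemma functional_eq_integral:
  assumes f: "linear f" "\<And>\<xi>. \<bar>f \<xi>\<bar> \<le> norm \<xi>" "\<forall>\<nu>\<in>N. f \<nu> = 0"
    and u_eq: "u = (\<lambda>x. f (\<iota> (dirac x)))"
  shows "1-lipschitz_on (closure \<Omega>) u" "\<And>x. x \<in> frontier \<Omega> \<Longrightarrow> u x = 0"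
    and "bounded_Borel_on (closure \<Omega>) 1 u"
    and "\<And>\<mu>. \<mu> \<in> signed_measures_on \<Omega> \<Longrightarrow> f (\<iota> \<mu>) = smint (closure \<Omega>) \<mu> u"
proof -
  have d_in: "dirac x \<in> Mc" if "x \<in> closure \<Omega>" for x using dirac_in[OF that] .
  have u_bound: "\<bar>u x\<bar> \<le> 1" if "x \<in> closure \<Omega>" for x
  proof -
    have "norm (\<iota> (dirac x)) \<le> 1"
      using d_in[OF that]
    proof (rule norm_iota_le)
      fix v assume "v \<in> KR_test \<Omega>"
      then have v: "bounded_Borel_on (closure \<Omega>) 1 v" by (rule test_bounded_Borel_on)
      then have "\<bar>v x\<bar> \<le> 1" using that by (simp add: bounded_Borel_on_def)
      then show "smint (closure \<Omega>) (dirac x) v \<le> 1" by (simp add: smint_dirac[OF v that])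
    qed
    then show ?thesis unfolding u_eq using f(2) order_trans by blast
  qed
  have seg: "segment_Lipschitz \<Omega> u"
    unfolding segment_Lipschitz_def
  proof (intro ballI impI)
    fix x y assume xy: "x \<in> closure \<Omega>" "y \<in> closure \<Omega>" "open_segment x y \<subseteq> \<Omega>"
    have "norm (\<iota> (dirac x - dirac y)) \<le> dist x y"
      using subspace_diff[OF Mc_subspace d_in[OF xy(1)] d_in[OF xy(2)]]
    proof (rule norm_iota_le)
      fix v assume v: "v \<in> KR_test \<Omega>"
      have "\<bar>v x - v y\<bar> \<le> dist x y"
        using Lip_grad_le_1_imp_segment_Lipschitz[OF open_\<Omega>, of v] v xy
        unfolding KR_test_def segment_Lipschitz_def by blast
      then show "smint (closure \<Omega>) (dirac x - dirac y) v \<le> dist x y"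
        using xy test_bounded_Borel_on[OF v] by (simp add: smint_linear(3) smint_dirac)
    qed
    moreover have "u x - u y = f (\<iota> (dirac x - dirac y))"
      using d_in xy by (simp add: u_eq iota_diff linear_diff[OF f(1)])
    ultimately show "\<bar>u x - u y\<bar> \<le> dist x y" using f(2) order_trans by metis
  qed
  show zero: "u x = 0" if "x \<in> frontier \<Omega>" for x
    unfolding u_eq using that by (intro bspec[OF f(3)] iota_in_N dirac_in)
  show lip: "1-lipschitz_on (closure \<Omega>) u"
    by (rule segment_Lipschitz_imp_Lipschitz[OF open_\<Omega> bounded_\<Omega> \<Omega>_ne seg zero])
  show Borel: "bounded_Borel_on (closure \<Omega>) 1 u"
    using u_bound borel_measurable_continuous_on_indicator[OF _ lipschitz_on_continuous_on[OF lip]]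
    by (simp add: bounded_Borel_on_def)
  fix \<mu> assume \<mu>: "\<mu> \<in> signed_measures_on \<Omega>"
  then have \<mu>_in: "\<mu> \<in> Mc" using signed_measures_on_mono[OF closure_subset] by blast
  have "\<bar>f (\<iota> \<mu>) - smint (closure \<Omega>) \<mu> u\<bar> \<le> 0 + e" if e: "0 < e" for e
  proof -
    have "0 < e / 2" using e by simp
    from approximation_by_point_masses[OF open_\<Omega> \<Omega>_ne \<mu> this]
    obtain n :: nat and a x where x: "\<And>i. i < n \<Longrightarrow> x i \<in> \<Omega>" and
      approx: "\<And>v. bounded_Borel_on (closure \<Omega>) 1 v \<Longrightarrow> segment_Lipschitz \<Omega> v \<Longrightarrow>
         \<bar>smint (closure \<Omega>) \<mu> v - (\<Sum>i<n. a i * v (x i))\<bar> \<le> e / 2" by blast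
    have x_cl: "x i \<in> closure \<Omega>" if "i < n" for i using subsetD[OF closure_subset x[OF that]] .
    define \<kappa> where "\<kappa> = (\<Sum>i<n. a i *\<^sub>R dirac (x i))"
    have \<kappa>: "\<kappa> \<in> Mc" "\<iota> \<kappa> = (\<Sum>i<n. a i *\<^sub>R \<iota> (dirac (x i)))"
      unfolding \<kappa>_def using iota_sum[of n "\<lambda>i. dirac (x i)" a] d_in x_cl by auto
    have smint_\<kappa>: "smint (closure \<Omega>) \<kappa> v = (\<Sum>i<n. a i * v (x i))"
      if v: "bounded_Borel_on (closure \<Omega>) 1 v" for v
    proof -
      have "m \<le> n \<Longrightarrow> smint (closure \<Omega>) (\<Sum>i<m. a i *\<^sub>R dirac (x i)) v = (\<Sum>i<m. a i * v (x i))" for m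
        by (induction m) (simp_all add: smint_linear[OF v] smint_dirac[OF v x_cl])
      then show ?thesis by (simp add: \<kappa>_def)
    qed
    have "norm (\<iota> (\<mu> - \<kappa>)) \<le> e / 2"
      using subspace_diff[OF Mc_subspace \<mu>_in \<kappa>(1)]
    proof (rule norm_iota_le)
      fix v assume v: "v \<in> KR_test \<Omega>"
      have "segment_Lipschitz \<Omega> v"
        using Lip_grad_le_1_imp_segment_Lipschitz[OF open_\<Omega>, of v] v by (simp add: KR_test_def)
      from approx[OF test_bounded_Borel_on[OF v] this]
      show "smint (closure \<Omega>) (\<mu> - \<kappa>) v \<le> e / 2"
        unfolding smint_linear(3)[OF test_bounded_Borel_on[OF v]] smint_\<kappa>[OF test_bounded_Borel_on[OF v]]
        by linarith
    qed
    then have "\<bar>f (\<iota> \<mu>) - f (\<iota> \<kappa>)\<bar> \<le> e / 2"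
      using f(2)[of "\<iota> (\<mu> - \<kappa>)"] by (simp add: iota_diff[OF \<mu>_in \<kappa>(1)] linear_diff[OF f(1)])
    moreover have "f (\<iota> \<kappa>) = (\<Sum>i<n. a i * u (x i))"
      by (simp add: \<kappa>(2) linear_sum[OF f(1)] linear_scale[OF f(1)] u_eq)
    ultimately show ?thesis using approx[OF Borel seg] by linarith
  qed
  then have "\<bar>f (\<iota> \<mu>) - smint (closure \<Omega>) \<mu> u\<bar> \<le> 0" by (rule field_le_epsilon)
  then show "f (\<iota> \<mu>) = smint (closure \<Omega>) \<mu> u" by simp
qed

text \<open>
  The part of \<open>\<mu>\<close> on the boundary contributes neither to the functional nor to the integrals of the
  competitors, so only the part on \<open>\<Omega>\<close>, where the functional is an integral, matters.
\<close>

lemma quotient_norm_measure_le: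
  assumes \<mu>: "\<mu> \<in> Mc"
  shows "ereal (q (\<iota> \<mu>)) \<le> (SUP u\<in>U. ereal (smint (closure \<Omega>) \<mu> u))"
proof (rule ereal_le_epsilon2)
  fix e :: real assume e: "0 < e"
  obtain f where f: "linear f" "\<And>\<xi>. \<bar>f \<xi>\<bar> \<le> norm \<xi>" "\<forall>\<nu>\<in>N. f \<nu> = 0"
    and f\<mu>: "f (\<iota> \<mu>) = q (\<iota> \<mu>)"
    using quotient_norming_functional[OF N_subspace] by blast
  define u where "u = (\<lambda>x. f (\<iota> (dirac x)))"
  note u = functional_eq_integral[OF f u_def]
  define \<mu>1 where "\<mu>1 = restrict_sm \<Omega> \<mu>"
  define \<mu>2 where "\<mu>2 = restrict_sm (frontier \<Omega>) \<mu>"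
  have split: "\<mu> = \<mu>1 + \<mu>2"
    unfolding \<mu>1_def \<mu>2_def using open_\<Omega>
    by (intro restrict_sm_split[OF \<mu>]) (auto simp: frontier_def interior_open)
  have \<mu>1: "\<mu>1 \<in> signed_measures_on \<Omega>"
    unfolding \<mu>1_def using open_\<Omega> by (intro restrict_sm_in) auto
  have \<mu>2: "\<mu>2 \<in> signed_measures_on (frontier \<Omega>)"
    unfolding \<mu>2_def by (intro restrict_sm_in) auto
  have in_Mc: "\<mu>1 \<in> Mc" "\<mu>2 \<in> Mc"
    using \<mu>1 \<mu>2 signed_measures_on_mono[OF closure_subset] signed_measures_on_mono[OF frontier_sub] by blast+
  define T where "T = measure (pos_part \<mu>1) UNIV + measure (neg_part \<mu>1) UNIV"
  have T: "0 \<le> T" by (simp add: T_def)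
  define \<eta> where "\<eta> = e / (1 + T)"
  have \<eta>: "0 < \<eta>" using e T by (simp add: \<eta>_def)
  have "\<eta> * (1 + T) = e" using T by (simp add: \<eta>_def)
  then have \<eta>T: "\<eta> * T \<le> e" using \<eta> by (simp add: algebra_simps)
  obtain w where w: "w \<in> U" "\<And>x. x \<in> closure \<Omega> \<Longrightarrow> \<bar>w x - u x\<bar> \<le> \<eta>"
    using Lip0_approximation[OF bounded_\<Omega> u(1,2) \<eta>] by blast
  obtain c where c: "bounded_Borel_on (closure \<Omega>) c w" using U_bounded_Borel_on[OF w(1)] by blast
  have "f (\<iota> \<mu>) = f (\<iota> \<mu>1) + f (\<iota> \<mu>2)"
    unfolding split iota_add[OF in_Mc] by (rule linear_add[OF f(1)])
  then have "q (\<iota> \<mu>) = f (\<iota> \<mu>1) + f (\<iota> \<mu>2)" unfolding f\<mu> .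
  also have "\<dots> = smint (closure \<Omega>) \<mu>1 u" using u(4)[OF \<mu>1] bspec[OF f(3) iota_in_N[OF \<mu>2]] by simp
  also have "\<dots> \<le> smint (closure \<Omega>) \<mu>1 w + e"
    using abs_smint_diff_le[OF c u(3) w(2) less_imp_le[OF \<eta>], of \<mu>1] \<eta>T by (simp add: T_def)
  also have "smint (closure \<Omega>) \<mu>1 w = smint (closure \<Omega>) \<mu> w"
    unfolding split by (simp add: smint_linear(1)[OF c] smint_frontier[OF w(1) \<mu>2])
  finally have "ereal (q (\<iota> \<mu>)) \<le> ereal (smint (closure \<Omega>) \<mu> w) + ereal e" by simp
  also have "\<dots> \<le> (SUP u\<in>U. ereal (smint (closure \<Omega>) \<mu> u)) + ereal e"
    by (intro add_right_mono SUP_upper w(1))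
  finally show "ereal (q (\<iota> \<mu>)) \<le> (SUP u\<in>U. ereal (smint (closure \<Omega>) \<mu> u)) + ereal e" .
qed

text \<open>
  Both sides are Lipschitz continuous in \<open>\<xi>\<close>, and measures are dense.
\<close>

lemma quotient_norm_le_Jstar_coset:
  assumes \<xi>: "\<xi> \<in> KR \<Omega> \<iota>"
  shows "ereal (q \<xi>) \<le> Jstar_coset \<Omega> \<iota> (coset N \<xi>)"
proof (rule ereal_le_epsilon2)
  fix e :: real assume e: "0 < e"
  have C: "0 < C" using C_ge_1 by simp
  define d where "d = e / (1 + C)"
  have d: "0 < d" using e C by (simp add: d_def)
  have "d * (1 + C) = e" using C by (simp add: d_def)
  then have dC: "d + C * d = e" by (simp add: algebra_simps)
  obtain \<mu> where \<mu>: "\<mu> \<in> Mc" "dist (\<iota> \<mu>) \<xi> < d"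
    using \<xi> d unfolding KR_def closure_approachable by blast
  have \<mu>_KR: "\<iota> \<mu> \<in> KR \<Omega> \<iota>" by (rule iota_in_KR[OF \<mu>(1)])
  have diff_KR: "\<iota> \<mu> - \<xi> \<in> KR \<Omega> \<iota>" by (rule subspace_diff[OF KR_subspace \<mu>_KR \<xi>])
  have "q \<xi> \<le> q (\<iota> \<mu>) + q (\<xi> - \<iota> \<mu>)"
    using sublinearD(1)[OF sublinear_quotient_norm[OF N_subspace], of "\<iota> \<mu>" "\<xi> - \<iota> \<mu>"] by simp
  moreover have "q (\<xi> - \<iota> \<mu>) \<le> d"
    using quotient_norm_coset_le[OF subspace_0[OF N_subspace], of "\<xi> - \<iota> \<mu>"] \<mu>(2)
    by (simp add: dist_norm norm_minus_commute)
  ultimately have "ereal (q \<xi>) \<le> ereal (q (\<iota> \<mu>)) + ereal d" by simp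
  also have "\<dots> \<le> (SUP u\<in>U. ereal (smint (closure \<Omega>) \<mu> u)) + ereal d"
    by (intro add_right_mono quotient_norm_measure_le \<mu>(1))
  also have "\<dots> \<le> ((SUP u\<in>U. ereal (pairing \<xi> u)) + ereal (C * d)) + ereal d"
  proof (intro add_right_mono SUP_least)
    fix u assume u: "u \<in> U"
    have "smint (closure \<Omega>) \<mu> u = pairing (\<xi> + (\<iota> \<mu> - \<xi>)) u"
      using pairing_iota[OF u \<mu>(1)] by simp
    also have "\<dots> = pairing \<xi> u + pairing (\<iota> \<mu> - \<xi>) u" by (rule pairing_add[OF u \<xi> diff_KR])
    also have "pairing (\<iota> \<mu> - \<xi>) u \<le> C * norm (\<iota> \<mu> - \<xi>)" using pairing_le[OF u diff_KR] by simp
    also have "\<dots> \<le> C * d" using \<mu>(2) C by (intro mult_left_mono) (auto simp: dist_norm)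
    finally have "ereal (smint (closure \<Omega>) \<mu> u) \<le> ereal (pairing \<xi> u) + ereal (C * d)" by simp
    also have "\<dots> \<le> (SUP u\<in>U. ereal (pairing \<xi> u)) + ereal (C * d)"
      by (intro add_right_mono SUP_upper u)
    finally show "ereal (smint (closure \<Omega>) \<mu> u) \<le> (SUP u\<in>U. ereal (pairing \<xi> u)) + ereal (C * d)" .
  qed
  also have "\<dots> = Jstar_coset \<Omega> \<iota> (coset N \<xi>) + ereal e"
    unfolding Jstar_coset_eq[OF \<xi>] add.assoc using dC by (simp add: add.commute)
  finally show "ereal (q \<xi>) \<le> Jstar_coset \<Omega> \<iota> (coset N \<xi>) + ereal e" .
qed

lemma U_uminus: "u \<in> U \<Longrightarrow> (\<lambda>x. - u x) \<in> U"
  using grad_le_1_scale[of \<Omega> u "-1"] Lip_scale[of u "closure \<Omega>" "-1"] by (auto simp: Lip0_def)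

lemma pairing_uminus:
  assumes "u \<in> U" "\<xi> \<in> KR \<Omega> \<iota>"
  shows "pairing \<xi> (\<lambda>x. - u x) = - pairing \<xi> u"
proof -
  obtain \<mu> where \<mu>: "\<And>k::nat. \<mu> k \<in> Mc" "(\<lambda>k. \<iota> (\<mu> k)) \<longlonglongrightarrow> \<xi>" using KR_sequence[OF assms(2)] by blast
  have "(\<lambda>k. smint (closure \<Omega>) (\<mu> k) (\<lambda>x. - u x)) \<longlonglongrightarrow> pairing \<xi> (\<lambda>x. - u x)"
    by (rule pairing_limit[OF U_uminus[OF assms(1)] \<mu>])
  moreover have "(\<lambda>k. smint (closure \<Omega>) (\<mu> k) (\<lambda>x. - u x)) \<longlonglongrightarrow> - pairing \<xi> u"
    unfolding smint_uminus_fun by (intro tendsto_minus pairing_limit[OF assms(1)] \<mu>)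
  ultimately show ?thesis by (rule LIMSEQ_unique)
qed

lemma coset_eq_coset_0_iff: "coset N \<xi> = coset N 0 \<longleftrightarrow> \<xi> \<in> N"
proof
  assume "coset N \<xi> = coset N 0"
  moreover have "\<xi> + 0 \<in> coset N \<xi>" unfolding coset_def using subspace_0[OF N_subspace] by blast
  ultimately show "\<xi> \<in> N" by (simp add: coset_def)
next
  assume \<xi>: "\<xi> \<in> N"
  have "\<nu> \<in> coset N \<xi>" if "\<nu> \<in> N" for \<nu>
    unfolding coset_def using subspace_diff[OF N_subspace that \<xi>] by (intro image_eqI[of _ _ "\<nu> - \<xi>"]) auto
  then show "coset N \<xi> = coset N 0"
    using subspace_add[OF N_subspace \<xi>] by (auto simp: coset_def)
qed

lemma quotient_norm_eq_0_imp:
  assumes "q \<xi> = 0"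
  shows "\<xi> \<in> N"
proof -
  have "\<exists>\<nu>\<in>N. dist \<nu> \<xi> < e" if e: "0 < e" for e
  proof (rule ccontr)
    assume contra: "\<not> (\<exists>\<nu>\<in>N. dist \<nu> \<xi> < e)"
    have "e \<le> q \<xi>"
    proof (rule quotient_norm_coset_ge)
      show "N \<noteq> {}" using subspace_0[OF N_subspace] by blast
      fix \<nu> assume "\<nu> \<in> N"
      then have "- \<nu> \<in> N" by (rule subspace_neg[OF N_subspace])
      then show "e \<le> norm (\<xi> + \<nu>)" using contra by (force simp: dist_norm norm_minus_commute not_less)
    qed
    then show False using assms e by simp
  qed
  then have "\<xi> \<in> closure N" by (simp add: closure_approachable)
  then show ?thesis by (simp add: KR_boundary_eq_closure)
qed

lemma equivalent_norm: "equivalent_quotient_norm (KR \<Omega> \<iota>) N (Jstar_coset \<Omega> \<iota>)"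
proof -
  let ?F = "\<lambda>\<xi>. Jstar_coset \<Omega> \<iota> (coset N \<xi>)"
  have C: "0 < C" using C_ge_1 by simp
  have q_nonneg: "0 \<le> q \<xi>" for \<xi>
    using subspace_0[OF N_subspace] by (intro quotient_norm_coset_ge) auto
  have F_nonneg: "0 \<le> ?F \<xi>" if "\<xi> \<in> KR \<Omega> \<iota>" for \<xi>
    using quotient_norm_le_Jstar_coset[OF that] q_nonneg[of \<xi>] by (meson ereal_less_eq(5) order_trans)
  have F_zero: "?F \<xi> = 0 \<longleftrightarrow> coset N \<xi> = coset N 0" if \<xi>: "\<xi> \<in> KR \<Omega> \<iota>" for \<xi>
  proof
    assume "?F \<xi> = 0"
    then have "q \<xi> \<le> 0" using quotient_norm_le_Jstar_coset[OF \<xi>] by simp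
    then show "coset N \<xi> = coset N 0"
      using q_nonneg[of \<xi>] quotient_norm_eq_0_imp[of \<xi>] coset_eq_coset_0_iff by simp
  next
    assume "coset N \<xi> = coset N 0"
    moreover have "q 0 = 0"
      by (rule sublinearD(3)[OF sublinear_quotient_norm[OF N_subspace]])
    ultimately have "?F \<xi> \<le> 0" using Jstar_coset_le[OF \<xi>] by (simp add: zero_ereal_def)
    then show "?F \<xi> = 0" using F_nonneg[OF \<xi>] by (rule antisym)
  qed
  have scale_le: "?F (c *\<^sub>R \<xi>) \<le> ereal \<bar>c\<bar> * ?F \<xi>" if \<xi>: "\<xi> \<in> KR \<Omega> \<iota>" for c \<xi>
    unfolding Jstar_coset_eq[OF subspace_scale[OF KR_subspace \<xi>]]
  proof (rule SUP_least)
    fix u assume u: "u \<in> U"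
    define v where "v = (if 0 \<le> c then u else (\<lambda>x. - u x))"
    have v: "v \<in> U" using u U_uminus[OF u] by (simp add: v_def)
    have "ereal (pairing (c *\<^sub>R \<xi>) u) = ereal \<bar>c\<bar> * ereal (pairing \<xi> v)"
      using pairing_scale[OF u \<xi>, of c] pairing_uminus[OF u \<xi>] by (simp add: v_def)
    also have "\<dots> \<le> ereal \<bar>c\<bar> * ?F \<xi>"
      unfolding Jstar_coset_eq[OF \<xi>] by (intro ereal_mult_left_mono SUP_upper v) simp
    finally show "ereal (pairing (c *\<^sub>R \<xi>) u) \<le> ereal \<bar>c\<bar> * ?F \<xi>" .
  qed
  have F_scale: "?F (c *\<^sub>R \<xi>) = ereal \<bar>c\<bar> * ?F \<xi>" if \<xi>: "\<xi> \<in> KR \<Omega> \<iota>" for c \<xi>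
  proof (rule antisym[OF scale_le[OF \<xi>]])
    note c\<xi> = subspace_scale[OF KR_subspace \<xi>, of c]
    show "ereal \<bar>c\<bar> * ?F \<xi> \<le> ?F (c *\<^sub>R \<xi>)"
    proof (cases "c = 0")
      case True
      then show ?thesis using F_nonneg[OF c\<xi>] by (simp add: zero_ereal_def[symmetric])
    next
      case False
      have "?F \<xi> \<le> ereal \<bar>inverse c\<bar> * ?F (c *\<^sub>R \<xi>)"
        using scale_le[OF c\<xi>, of "inverse c"] False by simp
      then have "ereal \<bar>c\<bar> * ?F \<xi> \<le> ereal \<bar>c\<bar> * (ereal \<bar>inverse c\<bar> * ?F (c *\<^sub>R \<xi>))"
        by (rule ereal_mult_left_mono) simp
      also have "\<dots> = ereal (\<bar>c\<bar> * \<bar>inverse c\<bar>) * ?F (c *\<^sub>R \<xi>)"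
        unfolding times_ereal.simps(1)[symmetric] by (rule mult.assoc[symmetric])
      also have "\<bar>c\<bar> * \<bar>inverse c\<bar> = 1" using False by (simp add: abs_mult[symmetric])
      finally show ?thesis by (simp add: one_ereal_def[symmetric])
    qed
  qed
  have F_add: "?F (\<xi> + \<eta>) \<le> ?F \<xi> + ?F \<eta>" if \<xi>: "\<xi> \<in> KR \<Omega> \<iota>" and \<eta>: "\<eta> \<in> KR \<Omega> \<iota>" for \<xi> \<eta>
    unfolding Jstar_coset_eq[OF \<xi>] Jstar_coset_eq[OF \<eta>] Jstar_coset_eq[OF subspace_add[OF KR_subspace \<xi> \<eta>]]
  proof (rule SUP_least)
    fix u assume u: "u \<in> U"
    have "ereal (pairing (\<xi> + \<eta>) u) = ereal (pairing \<xi> u) + ereal (pairing \<eta> u)"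
      using pairing_add[OF u \<xi> \<eta>] by simp
    also have "\<dots> \<le> (SUP u\<in>U. ereal (pairing \<xi> u)) + (SUP u\<in>U. ereal (pairing \<eta> u))"
      by (intro add_mono SUP_upper u)
    finally show "ereal (pairing (\<xi> + \<eta>) u) \<le> \<dots>" .
  qed
  have "\<exists>c>0. \<exists>C>0. \<forall>\<xi>\<in>KR \<Omega> \<iota>. ereal (c * q \<xi>) \<le> ?F \<xi> \<and> ?F \<xi> \<le> ereal (C * q \<xi>)"
    using C Jstar_coset_le quotient_norm_le_Jstar_coset
    by (intro exI[of _ 1] exI[of _ C] conjI ballI) auto
  then show ?thesis
    unfolding equivalent_quotient_norm_def
    by (intro conjI ballI allI F_nonneg F_zero F_scale F_add)
qed

lemma Jstar_eq_quotient_norm: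
  assumes r: "inradius \<Omega> \<le> 1" and \<mu>: "\<mu> \<in> signed_measures_on \<Omega>"
  shows "Jstar \<Omega> \<mu> = ereal (q (\<iota> \<mu>))"
proof -
  have \<mu>_in: "\<mu> \<in> Mc" using \<mu> signed_measures_on_mono[OF closure_subset] by blast
  have "Jstar \<Omega> \<mu> = (SUP u\<in>U. ereal (pairing (\<iota> \<mu>) u))"
    unfolding Jstar_def
  proof (intro SUP_cong refl arg_cong[where f = ereal])
    fix u assume u: "u \<in> U"
    obtain c where c: "bounded_Borel_on (closure \<Omega>) c u" using U_bounded_Borel_on[OF u] by blast
    have \<Omega>_Borel: "\<Omega> \<in> sets borel" using open_\<Omega> by simp
    have "smint \<Omega> \<mu> u = smint (closure \<Omega>) \<mu> u"
      by (rule smint_cong_on[OF \<mu> \<Omega>_Borel bounded_Borel_on_subset[OF c \<Omega>_Borel closure_subset] c])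
         (use closure_subset[of \<Omega>] in \<open>auto simp: indicator_def\<close>)
    then show "smint \<Omega> \<mu> u = pairing (\<iota> \<mu>) u" using pairing_iota[OF u \<mu>_in] by simp
  qed
  also have "\<dots> = Jstar_coset \<Omega> \<iota> (coset N (\<iota> \<mu>))"
    by (rule Jstar_coset_eq[OF iota_in_KR[OF \<mu>_in], symmetric])
  also have "\<dots> = ereal (q (\<iota> \<mu>))"
  proof (rule antisym)
    have "C = 1" using r by (simp add: C_def)
    then show "Jstar_coset \<Omega> \<iota> (coset N (\<iota> \<mu>)) \<le> ereal (q (\<iota> \<mu>))"
      using Jstar_coset_le[OF iota_in_KR[OF \<mu>_in]] by simp
  qed (rule quotient_norm_le_Jstar_coset[OF iota_in_KR[OF \<mu>_in]])
  finally show ?thesis .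
qed

end

theorem proposition4p3:
  fixes \<Omega> :: "'a::euclidean_space set"
    and \<iota> :: "'a signed_measure \<Rightarrow> 'b::banach"
  assumes "open \<Omega>" and "connected \<Omega>" and "bounded \<Omega>" and "\<Omega> \<noteq> {}"
    and "KR_embedding \<Omega> \<iota>"
  shows "equivalent_quotient_norm (KR \<Omega> \<iota>) (KR_boundary \<Omega> \<iota>) (Jstar_coset \<Omega> \<iota>) \<and>
    (inradius \<Omega> \<le> 1 \<longrightarrow>
      (\<forall>\<mu>\<in>signed_measures_on \<Omega>.
         Jstar \<Omega> \<mu> = ereal (quotient_norm (coset (KR_boundary \<Omega> \<iota>) (\<iota> \<mu>)))))"
proof -
  interpret KR_completion \<Omega> \<iota> using assms by unfold_locales
  show ?thesis using equivalent_norm Jstar_eq_quotient_norm by blast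
qed

end
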